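(* Let $\nu,\lambda>0$, $\tfrac12<\beta<\beta'<H<1$, $\sigma\in\ell^2$, and let $\omega\in C_0^{\beta'}(\mathbb R;\ell^2)$ be a path of the canonical $\ell^2$-valued fractional Brownian motion with Hurst parameter $H$ and covariance operator $Q$, $Q\mathbf e_i=\sigma_i^2\mathbf e_i$. Assume: (i) $f_i\in C^1(\mathbb R,\mathbb R)$ for $i\in\mathbb Z$, $\sum_{i\in\mathbb Z}f_i(0)^2<\infty$, and there is a constant $D_f\ge 0$ with $|f_i'(\zeta)|\le D_f$ for all $\zeta\in\mathbb R$, $i\in\mathbb Z$; (ii) $h_i\in C^2(\mathbb R,\mathbb R)$ for $i\in\mathbb Z$, $\sum_{i\in\mathbb Z}h_i(0)^2<\infty$, and there are constants $D_h,M_h\ge0$ with $|h_i'(\zeta)|\le D_h$ and $|h_i''(\zeta)|\le M_h$ for all $\zeta\in\mathbb R$, $i\in\mathbb Z$. Then for every $T>0$ and $x\in\ell^2$ the equation $$u(t)=S_\lambda(t)x+\int_0^tS_\lambda(t-r)f(u(r))\,dr+\int_0^tS_\lambda(t-r)h(u(r))\,d\omega(r),\qquad t\in[0,T],$$ has a unique solution $u=u(\cdot,\omega,x)\in C^\beta([0,T];\ell^2)$.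
   Context: $\ell^2$ is the Hilbert space of square summable real sequences $(u_i)_{i\in\mathbb Z}$ with its usual norm and inner product and standard orthonormal basis $(\mathbf e_i)_{i\in\mathbb Z}$; $L_2(\ell^2)$ is the space of Hilbert–Schmidt operators on $\ell^2$. $C^\beta([0,T];\ell^2)$ is the space of $\beta$-Hölder continuous functions. Operators: $(Au)_i=-\nu(u_{i-1}-2u_i+u_{i+1})$, $A_\lambda=A+\lambda\,\mathrm{id}$ (bounded on $\ell^2$), $S_\lambda(t)=e^{-A_\lambda t}$. For $u\in\ell^2$: $f(u)=(f_i(u_i))_{i\in\mathbb Z}$, and $h(u)$ is the operator $h(u)v=(h_i(u_i)v_i)_{i\in\mathbb Z}$, $v\in\ell^2$; under the assumptions $f:\ell^2\to\ell^2$ and $h:\ell^2\to L_2(\ell^2)$. Noise: $C_0(\mathbb R;\ell^2)$ is the space of continuous functions $\mathbb R\to\ell^2$ vanishing at $0$, with the compact open topology; $P_H$ is the law on its Borel $\sigma$-algebra of $B^H(t)=\sum_{i}\sigma_iB_i^H(t)\mathbf e_i$, where $(B_i^H)_{i}$ are i.i.d. centered Gaussian processes on $\mathbb R$ with covariance $\frac12(|s|^{2H}+|t|^{2H}-|t-s|^{2H})$ (fractional Brownian motions); the canonical process is $B^H(\omega)=\omega$. $C_0^{\beta'}(\mathbb R;\ell^2)$ is the subset of functions with finite $\beta'$-Hölder seminorm on every compact interval; it has $P_H$-measure one. Integral: for $Z\in C^\beta([T_1,T_2];L_2(\ell^2))$, $\omega\in C^{\beta'}([T_1,T_2];\ell^2)$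 with $\beta+\beta'>1$, $T_1\le s<t\le T_2$ and any $\alpha$ with $1-\beta'<\alpha<\beta$, $$\int_s^tZ\,d\omega:=(-1)^\alpha\sum_{j\in\mathbb Z}\Big(\sum_{i\in\mathbb Z}\int_s^tD^\alpha_{s+}\langle\mathbf e_j,Z(\cdot)\mathbf e_i\rangle[r]\;D^{1-\alpha}_{t-}\langle\mathbf e_i,\omega(\cdot)\rangle_{t-}[r]\,dr\Big)\mathbf e_j,$$ where for real functions $z,w$ and $s<r<t$ $$D^\alpha_{s+}z[r]=\frac1{\Gamma(1-\alpha)}\Big(\frac{z(r)}{(r-s)^\alpha}+\alpha\int_s^r\frac{z(r)-z(q)}{(r-q)^{1+\alpha}}dq\Big),$$ $$D^{1-\alpha}_{t-}w_{t-}[r]=\frac{(-1)^{1-\alpha}}{\Gamma(\alpha)}\Big(\frac{w(r)-w(t)}{(t-r)^{1-\alpha}}+(1-\alpha)\int_r^t\frac{w(r)-w(q)}{(q-r)^{2-\alpha}}dq\Big),$$ with the convention $(-1)^\alpha(-1)^{1-\alpha}=-1$. (This is the Young integral.) *)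

theory Defs
  imports "HOL-Probability.Probability"
begin

section \<open>The Hilbert space of square summable two-sided real sequences\<close>

typedef ell2 = "{u :: int \<Rightarrow> real. (\<lambda>i. (u i)\<^sup>2) summable_on UNIV}"
  morphisms coord Abs_ell2
  by (rule exI[of _ "\<lambda>_. 0"]) simp

setup_lifting type_definition_ell2

lemma summable_coord_square: "(\<lambda>i. (coord u i)\<^sup>2) summable_on UNIV"
  using coord by simp

lemma coord_Abs_ell2:
  "(\<lambda>i. (u i)\<^sup>2) summable_on UNIV \<Longrightarrow> coord (Abs_ell2 u) = u"
  by (simp add: Abs_ell2_inverse)

lemma ell2_eqI: "(\<And>i. coord u i = coord v i) \<Longrightarrow> u = v"
  by (simp add: coord_inject[symmetric] fun_eq_iff)

lemma square_summable_mult: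
  fixes u v :: "int \<Rightarrow> real"
  assumes "(\<lambda>i. (u i)\<^sup>2) summable_on UNIV" "(\<lambda>i. (v i)\<^sup>2) summable_on UNIV"
  shows "(\<lambda>i. u i * v i) summable_on UNIV"
proof -
  have "(\<lambda>i. (u i)\<^sup>2 + (v i)\<^sup>2) summable_on UNIV"
    by (intro summable_on_add assms)
  moreover have "norm (u i * v i) \<le> (u i)\<^sup>2 + (v i)\<^sup>2" for i
  proof -
    have "2 * (\<bar>u i\<bar> * \<bar>v i\<bar>) \<le> (u i)\<^sup>2 + (v i)\<^sup>2"
      using sum_squares_bound[of "\<bar>u i\<bar>" "\<bar>v i\<bar>"] by (simp add: mult.assoc)
    moreover have "0 \<le> \<bar>u i\<bar> * \<bar>v i\<bar>" by simp
    ultimately show ?thesis unfolding real_norm_def abs_mult by linarith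
  qed
  ultimately have "(\<lambda>i. norm (u i * v i)) summable_on UNIV"
    by (rule summable_on_comparison_test) auto
  then show ?thesis by (rule abs_summable_summable)
qed

lemma square_summable_add:
  fixes u v :: "int \<Rightarrow> real"
  assumes "(\<lambda>i. (u i)\<^sup>2) summable_on UNIV" "(\<lambda>i. (v i)\<^sup>2) summable_on UNIV"
  shows "(\<lambda>i. (u i + v i)\<^sup>2) summable_on UNIV"
proof -
  have "(\<lambda>i. (u i)\<^sup>2 + (v i)\<^sup>2 + 2 * (u i * v i)) summable_on UNIV"
    by (intro summable_on_add assms summable_on_cmult_right square_summable_mult)
  then show ?thesis by (simp add: power2_sum mult.assoc)
qed

lemma square_summable_cmult:
  fixes u :: "int \<Rightarrow> real"
  assumes "(\<lambda>i. (u i)\<^sup>2) summable_on UNIV"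
  shows "(\<lambda>i. (c * u i)\<^sup>2) summable_on UNIV"
  using summable_on_cmult_right[OF assms, of "c\<^sup>2"] by (simp add: power_mult_distrib)

lemma square_summable_bounded_mult:
  fixes u v :: "int \<Rightarrow> real"
  assumes "(\<lambda>i. (u i)\<^sup>2) summable_on UNIV" "\<And>i. \<bar>v i\<bar> \<le> C"
  shows "(\<lambda>i. (v i * u i)\<^sup>2) summable_on UNIV"
proof -
  have "(v i * u i)\<^sup>2 \<le> (C * u i)\<^sup>2" for i
    unfolding power_mult_distrib
    by (intro mult_right_mono) (use assms(2)[of i] in \<open>auto intro: power2_le_iff_abs_le[THEN iffD2]\<close>)
  then show ?thesis
    by (intro summable_on_comparison_test[OF square_summable_cmult[OF assms(1), of C]]) auto
qed

instantiation ell2 :: real_vector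
begin

lift_definition zero_ell2 :: ell2 is "\<lambda>_. 0" by simp

lift_definition plus_ell2 :: "ell2 \<Rightarrow> ell2 \<Rightarrow> ell2" is "\<lambda>u v i. u i + v i"
  by (rule square_summable_add)

lift_definition uminus_ell2 :: "ell2 \<Rightarrow> ell2" is "\<lambda>u i. - u i" by simp

lift_definition minus_ell2 :: "ell2 \<Rightarrow> ell2 \<Rightarrow> ell2" is "\<lambda>u v i. u i - v i"
  subgoal for u v using square_summable_add[of u "\<lambda>i. - v i"] by simp
  done

lift_definition scaleR_ell2 :: "real \<Rightarrow> ell2 \<Rightarrow> ell2" is "\<lambda>c u i. c * u i"
  by (rule square_summable_cmult)

instance
  by standard (transfer; simp add: algebra_simps fun_eq_iff)+

end

lemma coord_zero [simp]: "coord 0 i = 0" by transfer simp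
lemma coord_add [simp]: "coord (u + v) i = coord u i + coord v i" by transfer simp
lemma coord_minus [simp]: "coord (- u) i = - coord u i" by transfer simp
lemma coord_diff [simp]: "coord (u - v) i = coord u i - coord v i" by transfer simp
lemma coord_scaleR [simp]: "coord (c *\<^sub>R u) i = c * coord u i" by transfer simp

instantiation ell2 :: real_inner
begin

definition inner_ell2 :: "ell2 \<Rightarrow> ell2 \<Rightarrow> real"
  where "inner_ell2 u v = (\<Sum>\<^sub>\<infinity>i. coord u i * coord v i)"

definition norm_ell2 :: "ell2 \<Rightarrow> real" where "norm_ell2 u = sqrt (inner u u)"
definition dist_ell2 :: "ell2 \<Rightarrow> ell2 \<Rightarrow> real" where "dist_ell2 u v = norm (u - v)"
definition sgn_ell2 :: "ell2 \<Rightarrow> ell2" where "sgn_ell2 u = u /\<^sub>R norm u"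
definition uniformity_ell2 :: "(ell2 \<times> ell2) filter"
  where "uniformity_ell2 = (INF e\<in>{0<..}. principal {(x, y). dist x y < e})"
definition open_ell2 :: "ell2 set \<Rightarrow> bool"
  where "open_ell2 U \<longleftrightarrow> (\<forall>x\<in>U. \<forall>\<^sub>F (x', y) in uniformity. x' = x \<longrightarrow> y \<in> U)"

instance
proof
  fix u v w :: ell2 and c :: real
  show "dist u v = norm (u - v)" by (rule dist_ell2_def)
  show "sgn u = u /\<^sub>R norm u" by (rule sgn_ell2_def)
  show "(uniformity :: (ell2 \<times> ell2) filter) = (INF e\<in>{0<..}. principal {(x, y). dist x y < e})"
    by (rule uniformity_ell2_def)
  show "open U = (\<forall>x\<in>U. \<forall>\<^sub>F (x', y) in uniformity. x' = x \<longrightarrow> y \<in> U)" for U :: "ell2 set"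
    by (rule open_ell2_def)
  show "inner u v = inner v u" by (simp add: inner_ell2_def mult.commute)
  note prod = square_summable_mult[OF summable_coord_square summable_coord_square]
  show "inner (u + v) w = inner u w + inner v w"
    by (simp add: inner_ell2_def distrib_right infsum_add[OF prod prod])
  show "inner (c *\<^sub>R u) v = c * inner u v"
    by (simp add: inner_ell2_def mult.assoc infsum_cmult_right')
  show "0 \<le> inner u u"
    unfolding inner_ell2_def by (rule infsum_nonneg) simp
  show "(inner u u = 0) = (u = 0)"
  proof
    assume "inner u u = 0"
    then have "coord u i * coord u i = 0" for i
      by (intro nonneg_infsum_le_0D[where A = UNIV, OF _ prod]) (auto simp: inner_ell2_def)
    then show "u = 0" by (intro ell2_eqI) simp
  qed (simp add: inner_ell2_def)
  show "norm u = sqrt (inner u u)" by (rule norm_ell2_def)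
qed

end

lemma norm_ell2_square: "(norm u)\<^sup>2 = (\<Sum>\<^sub>\<infinity>i. (coord u i)\<^sup>2)"
  unfolding power2_norm_eq_inner by (simp add: inner_ell2_def power2_eq_square)

lemma sum_coord_square_le: "finite F \<Longrightarrow> (\<Sum>i\<in>F. (coord u i)\<^sup>2) \<le> (norm u)\<^sup>2"
  unfolding norm_ell2_square by (rule finite_sum_le_infsum[OF summable_coord_square]) auto

lemma abs_coord_le: "\<bar>coord u i\<bar> \<le> norm u"
  using sum_coord_square_le[of "{i}" u] by (simp add: abs_le_square_iff[symmetric])

instance ell2 :: banach
proof
  fix X :: "nat \<Rightarrow> ell2"
  assume X: "Cauchy X"
  have "Cauchy (\<lambda>n. coord (X n) i)" for i
  proof (rule CauchyI)
    fix e :: real assume "0 < e"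
    then obtain N where "\<forall>m\<ge>N. \<forall>n\<ge>N. norm (X m - X n) < e"
      using CauchyD[OF X] by blast
    then show "\<exists>N. \<forall>m\<ge>N. \<forall>n\<ge>N. norm (coord (X m) i - coord (X n) i) < e"
      by (metis abs_coord_le coord_diff order_le_less_trans real_norm_def)
  qed
  then have "\<exists>l. (\<lambda>n. coord (X n) i) \<longlonglongrightarrow> l" for i
    by (simp add: Cauchy_convergent_iff convergent_def)
  then obtain x where x: "\<And>i. (\<lambda>n. coord (X n) i) \<longlonglongrightarrow> x i" by metis
  have fin: "\<exists>N. \<forall>m\<ge>N. \<forall>F. finite F \<longrightarrow> (\<Sum>i\<in>F. (coord (X m) i - x i)\<^sup>2) \<le> e\<^sup>2"
    if e: "0 < e" for e :: real
  proof -
    obtain N where N: "\<And>m n. m \<ge> N \<Longrightarrow> n \<ge> N \<Longrightarrow> norm (X m - X n) < e"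
      using CauchyD[OF X e] by blast
    have "(\<Sum>i\<in>F. (coord (X m) i - x i)\<^sup>2) \<le> e\<^sup>2" if m: "m \<ge> N" and F: "finite F" for m F
    proof (rule LIMSEQ_le_const2)
      show "(\<lambda>n. \<Sum>i\<in>F. (coord (X m) i - coord (X n) i)\<^sup>2) \<longlonglongrightarrow> (\<Sum>i\<in>F. (coord (X m) i - x i)\<^sup>2)"
        by (intro tendsto_intros x)
      have "(\<Sum>i\<in>F. (coord (X m) i - coord (X n) i)\<^sup>2) \<le> e\<^sup>2" if n: "n \<ge> N" for n
      proof -
        have "(\<Sum>i\<in>F. (coord (X m) i - coord (X n) i)\<^sup>2) \<le> (norm (X m - X n))\<^sup>2"
          using sum_coord_square_le[OF F, of "X m - X n"] by simp
        also have "\<dots> \<le> e\<^sup>2"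
          using N[OF m n] by (intro power_mono) auto
        finally show ?thesis .
      qed
      then show "\<exists>N. \<forall>n\<ge>N. (\<Sum>i\<in>F. (coord (X m) i - coord (X n) i)\<^sup>2) \<le> e\<^sup>2" by blast
    qed
    then show ?thesis by blast
  qed
  have diff: "(\<lambda>i. (coord (X m) i - x i)\<^sup>2) summable_on UNIV"
    if "\<And>F. finite F \<Longrightarrow> (\<Sum>i\<in>F. (coord (X m) i - x i)\<^sup>2) \<le> e\<^sup>2" for m and e :: real
    by (intro nonneg_bdd_above_summable_on bdd_aboveI[of _ "e\<^sup>2"]) (use that in auto)
  obtain N where "\<forall>m\<ge>N. \<forall>F. finite F \<longrightarrow> (\<Sum>i\<in>F. (coord (X m) i - x i)\<^sup>2) \<le> 1\<^sup>2"
    using fin[of 1] by auto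
  then have "(\<lambda>i. (coord (X N) i - x i)\<^sup>2) summable_on UNIV"
    by (intro diff[of N 1]) auto
  then have "(\<lambda>i. (-1 * (coord (X N) i - x i))\<^sup>2) summable_on UNIV"
    by (rule square_summable_cmult)
  from square_summable_add[OF summable_coord_square[of "X N"] this]
  have xsum: "(\<lambda>i. (x i)\<^sup>2) summable_on UNIV" by simp
  define y where "y = Abs_ell2 x"
  have y: "coord y = x" unfolding y_def by (rule coord_Abs_ell2[OF xsum])
  have "X \<longlonglongrightarrow> y"
  proof (rule LIMSEQ_I)
    fix r :: real assume r: "0 < r"
    then obtain N where N: "\<And>m F. m \<ge> N \<Longrightarrow> finite F \<Longrightarrow> (\<Sum>i\<in>F. (coord (X m) i - x i)\<^sup>2) \<le> (r/2)\<^sup>2"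
      using fin[of "r/2"] by auto
    have "norm (X m - y) < r" if m: "m \<ge> N" for m
    proof -
      have "(norm (X m - y))\<^sup>2 \<le> (r/2)\<^sup>2"
        unfolding norm_ell2_square
        by (rule infsum_le_finite_sums[OF summable_coord_square]) (use N[OF m] y in auto)
      then have "norm (X m - y) \<le> r/2"
        using r by (simp add: power2_le_iff_abs_le)
      then show ?thesis using r by linarith
    qed
    then show "\<exists>N. \<forall>n\<ge>N. norm (X n - y) < r" by blast
  qed
  then show "convergent X" by (auto simp: convergent_def)
qed

lift_definition unit_vec :: "int \<Rightarrow> ell2" is "\<lambda>i j. if j = i then 1 else 0"
proof -
  fix i :: int
  have "(\<lambda>j. (if j = i then 1 else 0 :: real)\<^sup>2) summable_on UNIV
      \<longleftrightarrow> (\<lambda>j. (if j = i then 1 else 0 :: real)\<^sup>2) summable_on {i}"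
    by (rule summable_on_cong_neutral) auto
  then show "(\<lambda>j. (if j = i then 1 else 0 :: real)\<^sup>2) summable_on UNIV" by simp
qed

section \<open>The linear part and its semigroup\<close>

lift_definition shift_ell2 :: "int \<Rightarrow> ell2 \<Rightarrow> ell2" is "\<lambda>k u i. u (i + k)"
proof -
  fix k and u :: "int \<Rightarrow> real"
  assume u: "(\<lambda>i. (u i)\<^sup>2) summable_on UNIV"
  have "bij (\<lambda>i::int. i + k)" by (rule bij_plus_right)
  from summable_on_reindex_bij_betw[OF this, of "\<lambda>i. (u i)\<^sup>2"] u
  show "(\<lambda>i. (u (i + k))\<^sup>2) summable_on UNIV" by simp
qed

lemma norm_shift_ell2: "norm (shift_ell2 k u) = norm u"
proof -
  have "bij (\<lambda>i::int. i + k)" by (rule bij_plus_right)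
  from infsum_reindex_bij_betw[OF this, of "\<lambda>i. (coord u i)\<^sup>2"]
  have "(norm (shift_ell2 k u))\<^sup>2 = (norm u)\<^sup>2"
    by (simp add: norm_ell2_square shift_ell2.rep_eq)
  then show ?thesis by simp
qed

lift_definition laplacian_map :: "real \<Rightarrow> ell2 \<Rightarrow> ell2"
  is "\<lambda>\<nu> u i. - \<nu> * (u (i - 1) - 2 * u i + u (i + 1))"
proof -
  fix \<nu> and u :: "int \<Rightarrow> real"
  assume u: "(\<lambda>i. (u i)\<^sup>2) summable_on UNIV"
  have shift: "(\<lambda>i. (u (i + k))\<^sup>2) summable_on UNIV" for k
    using summable_coord_square[of "shift_ell2 k (Abs_ell2 u)"]
    by (simp add: shift_ell2.rep_eq coord_Abs_ell2[OF u])
  have "(\<lambda>i. (- \<nu> * (u (i + (-1)) + (-2) * u i + u (i + 1)))\<^sup>2) summable_on UNIV"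
    by (intro square_summable_cmult square_summable_add shift u)
  then show "(\<lambda>i. (- \<nu> * (u (i - 1) - 2 * u i + u (i + 1)))\<^sup>2) summable_on UNIV"
    by simp
qed

lift_definition op_A :: "real \<Rightarrow> ell2 \<Rightarrow>\<^sub>L ell2" is laplacian_map
proof
  fix \<nu> c :: real and u v :: ell2
  show "laplacian_map \<nu> (u + v) = laplacian_map \<nu> u + laplacian_map \<nu> v"
    by (rule ell2_eqI) (simp add: laplacian_map.rep_eq algebra_simps)
  show "laplacian_map \<nu> (c *\<^sub>R u) = c *\<^sub>R laplacian_map \<nu> u"
    by (rule ell2_eqI) (simp add: laplacian_map.rep_eq algebra_simps)
  show "\<exists>K. \<forall>u. norm (laplacian_map \<nu> u) \<le> norm u * K"
  proof (intro exI allI)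
    fix u
    have eq: "laplacian_map \<nu> u = (- \<nu>) *\<^sub>R (shift_ell2 (-1) u - 2 *\<^sub>R u + shift_ell2 1 u)"
      by (rule ell2_eqI) (simp add: laplacian_map.rep_eq shift_ell2.rep_eq)
    have "norm (shift_ell2 (-1) u - 2 *\<^sub>R u + shift_ell2 1 u)
        \<le> norm (shift_ell2 (-1) u) + norm (2 *\<^sub>R u) + norm (shift_ell2 1 u)"
      using norm_triangle_ineq[of "shift_ell2 (-1) u - 2 *\<^sub>R u" "shift_ell2 1 u"]
        norm_triangle_ineq4[of "shift_ell2 (-1) u" "2 *\<^sub>R u"] by linarith
    also have "\<dots> = norm u * 4" by (simp add: norm_shift_ell2)
    finally have "\<bar>\<nu>\<bar> * norm (shift_ell2 (-1) u - 2 *\<^sub>R u + shift_ell2 1 u) \<le> \<bar>\<nu>\<bar> * (norm u * 4)"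
      by (rule mult_left_mono) simp
    then show "norm (laplacian_map \<nu> u) \<le> norm u * (\<bar>\<nu>\<bar> * 4)"
      by (simp only: eq norm_scaleR abs_minus_cancel mult.left_commute)
  qed
qed

definition op_A_shifted :: "real \<Rightarrow> real \<Rightarrow> ell2 \<Rightarrow>\<^sub>L ell2" where
  "op_A_shifted \<nu> l = op_A \<nu> + l *\<^sub>R id_blinfun"

definition op_power :: "(ell2 \<Rightarrow>\<^sub>L ell2) \<Rightarrow> nat \<Rightarrow> ell2 \<Rightarrow>\<^sub>L ell2" where
  "op_power L n = (((o\<^sub>L) L) ^^ n) id_blinfun"

text \<open>The library's \<^const>\<open>exp\<close> needs a type class of Banach algebras, of which the space of
  bounded operators is not an instance; the series below is taken in operator norm.\<close>

definition op_exp :: "(ell2 \<Rightarrow>\<^sub>L ell2) \<Rightarrow> ell2 \<Rightarrow>\<^sub>L ell2" where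
  "op_exp L = (\<Sum>n. op_power L n /\<^sub>R fact n)"

definition semigroup_S :: "real \<Rightarrow> real \<Rightarrow> real \<Rightarrow> ell2 \<Rightarrow>\<^sub>L ell2" where
  "semigroup_S \<nu> l t = op_exp ((- t) *\<^sub>R op_A_shifted \<nu> l)"

section \<open>The nonlinear coefficients\<close>

definition drift_map :: "(int \<Rightarrow> real \<Rightarrow> real) \<Rightarrow> ell2 \<Rightarrow> ell2" where
  "drift_map f u = Abs_ell2 (\<lambda>i. f i (coord u i))"

definition diag_op :: "(int \<Rightarrow> real \<Rightarrow> real) \<Rightarrow> ell2 \<Rightarrow> ell2 \<Rightarrow>\<^sub>L ell2" where
  "diag_op h u = Blinfun (\<lambda>v. Abs_ell2 (\<lambda>i. h i (coord u i) * coord v i))"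

definition hilbert_schmidt :: "(ell2 \<Rightarrow>\<^sub>L ell2) \<Rightarrow> bool" where
  "hilbert_schmidt L \<longleftrightarrow> (\<lambda>i. (norm (blinfun_apply L (unit_vec i)))\<^sup>2) summable_on UNIV"

text \<open>\<^const>\<open>drift_map\<close> and \<^const>\<open>diag_op\<close> take their intended values, rather than unspecified
  values of \<^const>\<open>Abs_ell2\<close> and \<^const>\<open>Blinfun\<close>, whenever the components are square summable
  at 0 and have uniformly bounded derivatives.\<close>

lemma square_summable_components:
  fixes g :: "int \<Rightarrow> real \<Rightarrow> real"
  assumes diff: "\<And>i. g i C1_differentiable_on UNIV"
    and bd: "\<And>i z. \<bar>deriv (g i) z\<bar> \<le> D"
    and zero: "(\<lambda>i. (g i 0)\<^sup>2) summable_on UNIV"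
  shows "(\<lambda>i. (g i (coord u i))\<^sup>2) summable_on UNIV"
proof -
  have "\<bar>g i z - g i 0\<bar> \<le> D * \<bar>z\<bar>" for i z
  proof -
    have "(g i has_field_derivative deriv (g i) y) (at y within UNIV)" for y
      using diff[of i] unfolding C1_differentiable_on_def
      by (metis DERIV_deriv_iff_has_field_derivative UNIV_I has_real_derivative_iff_has_vector_derivative)
    from field_differentiable_bound[OF convex_UNIV this, of D z 0] bd
    show ?thesis by simp
  qed
  then have le: "(g i (coord u i) - g i 0)\<^sup>2 \<le> (D * coord u i)\<^sup>2" for i
  proof -
    have "\<bar>g i (coord u i) - g i 0\<bar> \<le> D * \<bar>coord u i\<bar>" by fact
    also have "\<dots> \<le> \<bar>D * coord u i\<bar>" unfolding abs_mult by (intro mult_right_mono) auto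
    finally show ?thesis by (simp only: abs_le_square_iff)
  qed
  have "(\<lambda>i. (g i (coord u i) - g i 0)\<^sup>2) summable_on UNIV"
    by (rule summable_on_comparison_test[OF square_summable_cmult[OF summable_coord_square[of u], of D]])
      (use le in auto)
  from square_summable_add[OF this zero] show ?thesis by simp
qed

lemma coord_drift_map:
  fixes f :: "int \<Rightarrow> real \<Rightarrow> real"
  assumes "\<And>i. f i C1_differentiable_on UNIV" "\<And>i z. \<bar>deriv (f i) z\<bar> \<le> D"
    and "(\<lambda>i. (f i 0)\<^sup>2) summable_on UNIV"
  shows "coord (drift_map f u) i = f i (coord u i)"
  unfolding drift_map_def by (subst coord_Abs_ell2[OF square_summable_components[OF assms]]) simp_all

lemma diag_op_well_defined:
  fixes h :: "int \<Rightarrow> real \<Rightarrow> real"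
  assumes "\<And>i. h i C1_differentiable_on UNIV" "\<And>i z. \<bar>deriv (h i) z\<bar> \<le> D"
    and "(\<lambda>i. (h i 0)\<^sup>2) summable_on UNIV"
  shows "coord (diag_op h u v) i = h i (coord u i) * coord v i"
    and "hilbert_schmidt (diag_op h u)"
proof -
  define w where "w = Abs_ell2 (\<lambda>i. h i (coord u i))"
  have w: "h i (coord u i) = coord w i" for i
    unfolding w_def by (subst coord_Abs_ell2[OF square_summable_components[OF assms]]) simp_all
  have sq: "(\<lambda>i. (coord w i * coord v i)\<^sup>2) summable_on UNIV" for v
    by (rule square_summable_bounded_mult[OF summable_coord_square abs_coord_le])
  define M where "M v = Abs_ell2 (\<lambda>i. coord w i * coord v i)" for v
  have M: "coord (M v) i = coord w i * coord v i" for v i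
    unfolding M_def by (subst coord_Abs_ell2[OF sq]) simp_all
  have "bounded_linear M"
  proof
    fix v v' c
    show "M (v + v') = M v + M v'" by (rule ell2_eqI) (simp add: M algebra_simps)
    show "M (c *\<^sub>R v) = c *\<^sub>R M v" by (rule ell2_eqI) (simp add: M)
    show "\<exists>K. \<forall>v. norm (M v) \<le> norm v * K"
    proof (intro exI allI)
      fix v
      have le: "(coord (M v) i)\<^sup>2 \<le> (norm w)\<^sup>2 * (coord v i)\<^sup>2" for i
        unfolding M power_mult_distrib
        by (intro mult_right_mono) (auto simp: abs_coord_le power2_le_iff_abs_le)
      have "(norm (M v))\<^sup>2 \<le> (\<Sum>\<^sub>\<infinity>i. (norm w)\<^sup>2 * (coord v i)\<^sup>2)"
        unfolding norm_ell2_square[of "M v"]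
        by (intro infsum_mono summable_coord_square summable_on_cmult_right le)
      also have "\<dots> = (norm w)\<^sup>2 * (norm v)\<^sup>2"
        by (simp only: infsum_cmult_right' norm_ell2_square[of v])
      also have "\<dots> = (norm v * norm w)\<^sup>2"
        by (simp only: power_mult_distrib mult.commute)
      finally show "norm (M v) \<le> norm v * norm w"
        by (rule power2_le_imp_le) simp
    qed
  qed
  then have app: "blinfun_apply (diag_op h u) = M"
    by (simp add: diag_op_def w M_def[abs_def] bounded_linear_Blinfun_apply)
  show "coord (diag_op h u v) i = h i (coord u i) * coord v i"
    by (simp add: app M w)
  have "norm (M (unit_vec i)) = \<bar>coord w i\<bar>" for i
  proof -
    have eq: "M (unit_vec i) = coord w i *\<^sub>R unit_vec i"
      by (rule ell2_eqI) (simp add: M unit_vec.rep_eq)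
    have "(norm (unit_vec i))\<^sup>2 = (\<Sum>\<^sub>\<infinity>j\<in>{i}. (coord (unit_vec i) j)\<^sup>2)"
      unfolding norm_ell2_square by (rule infsum_cong_neutral) (auto simp: unit_vec.rep_eq)
    also have "\<dots> = 1\<^sup>2" by (simp add: unit_vec.rep_eq)
    finally have "norm (unit_vec i) = 1" by (rule power2_eq_imp_eq) simp_all
    then show ?thesis by (simp add: eq)
  qed
  then show "hilbert_schmidt (diag_op h u)"
    by (simp add: hilbert_schmidt_def app summable_coord_square)
qed

section \<open>Paths and the law of fractional Brownian motion\<close>

definition holder_on :: "real \<Rightarrow> real set \<Rightarrow> (real \<Rightarrow> ell2) \<Rightarrow> bool" where
  "holder_on b S w \<longleftrightarrow> (\<exists>C. \<forall>s\<in>S. \<forall>t\<in>S. norm (w s - w t) \<le> C * \<bar>s - t\<bar> powr b)"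

definition C0_paths :: "(real \<Rightarrow> ell2) set" where
  "C0_paths = {w. continuous_on UNIV w \<and> w 0 = 0}"

definition C0_holder_paths :: "real \<Rightarrow> (real \<Rightarrow> ell2) set" where
  "C0_holder_paths b = {w \<in> C0_paths. \<forall>c d. holder_on b {c..d} w}"

definition compact_open_topology :: "(real \<Rightarrow> ell2) topology" where
  "compact_open_topology =
     topology_generated_by {{w \<in> C0_paths. w ` K \<subseteq> U} | K U. compact K \<and> open U}"

definition path_borel :: "(real \<Rightarrow> ell2) measure" where
  "path_borel = sigma C0_paths {U. openin compact_open_topology U}"

text \<open>A Gaussian variable may be degenerate, i.e. almost surely constant.\<close>

definition gaussian_rv :: "'a measure \<Rightarrow> ('a \<Rightarrow> real) \<Rightarrow> bool" where
  "gaussian_rv M X \<longleftrightarrow> X \<in> borel_measurable M \<and>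
     ((\<exists>m s. 0 < s \<and> distributed M lborel X (normal_density m s)) \<or> (\<exists>m. AE x in M. X x = m))"

definition centered_gaussian_process ::
    "'a measure \<Rightarrow> (real \<Rightarrow> real \<Rightarrow> real) \<Rightarrow> (real \<Rightarrow> 'a \<Rightarrow> real) \<Rightarrow> bool" where
  "centered_gaussian_process M K X \<longleftrightarrow>
     (\<forall>J c. finite J \<longrightarrow> gaussian_rv M (\<lambda>x. \<Sum>t\<in>J. c t * X t x)) \<and>
     (\<forall>t. (LINT x|M. X t x) = 0) \<and>
     (\<forall>s t. (LINT x|M. X s x * X t x) = K s t)"

definition fbm_covariance :: "real \<Rightarrow> real \<Rightarrow> real \<Rightarrow> real" where
  "fbm_covariance H s t = (\<bar>s\<bar> powr (2 * H) + \<bar>t\<bar> powr (2 * H) - \<bar>t - s\<bar> powr (2 * H)) / 2"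

text \<open>Independence is that of the whole processes, as random elements of the product space of
  real functions on the line; equality in distribution follows from the common covariance.\<close>

definition iid_fbm :: "'a measure \<Rightarrow> real \<Rightarrow> (int \<Rightarrow> real \<Rightarrow> 'a \<Rightarrow> real) \<Rightarrow> bool" where
  "iid_fbm M H B \<longleftrightarrow> prob_space M \<and>
     prob_space.indep_vars M (\<lambda>_. Pi\<^sub>M UNIV (\<lambda>_::real. borel)) (\<lambda>i x t. B i t x) UNIV \<and>
     (\<forall>i. centered_gaussian_process M (fbm_covariance H) (B i))"

text \<open>\<^term>\<open>P\<close> is the law on path space of a continuous version of
  \<open>\<Sum>i. \<sigma> i *\<^sub>R B i t *\<^sub>R e i\<close>, whose covariance operator maps \<open>e i\<close> to \<open>(\<sigma> i)\<^sup>2 *\<^sub>R e i\<close>.\<close>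

definition fbm_law ::
    "'a measure \<Rightarrow> (int \<Rightarrow> real \<Rightarrow> 'a \<Rightarrow> real) \<Rightarrow> real \<Rightarrow> ell2 \<Rightarrow> (real \<Rightarrow> ell2) measure \<Rightarrow> bool" where
  "fbm_law M B H \<sigma> P \<longleftrightarrow> iid_fbm M H B \<and>
     (\<exists>X \<in> measurable M path_borel.
        (\<forall>t. AE x in M. ((\<lambda>i. (coord \<sigma> i * B i t x) *\<^sub>R unit_vec i) has_sum X x t) UNIV) \<and>
        P = distr M path_borel X)"

section \<open>The pathwise integral\<close>

definition frac_deriv_left :: "real \<Rightarrow> real \<Rightarrow> (real \<Rightarrow> real) \<Rightarrow> real \<Rightarrow> real" where
  "frac_deriv_left a s z r =
     1 / Gamma (1 - a) * (z r / (r - s) powr a +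
       a * (LINT q:{s<..<r}|lborel. (z r - z q) / (r - q) powr (1 + a)))"

text \<open>The derivative of order \<open>1 - a\<close> of \<open>w - w t\<close>, without its factor \<open>(-1)\<^sup>1\<^sup>-\<^sup>a\<close>. That factor
  enters \<open>young_integral\<close> only through the product with \<open>(-1)\<^sup>a\<close>, which is \<open>-1\<close> by
  convention and appears there as a minus sign.\<close>

definition frac_deriv_right :: "real \<Rightarrow> real \<Rightarrow> (real \<Rightarrow> real) \<Rightarrow> real \<Rightarrow> real" where
  "frac_deriv_right a t w r =
     1 / Gamma a * ((w r - w t) / (t - r) powr (1 - a) +
       (1 - a) * (LINT q:{r<..<t}|lborel. (w r - w q) / (q - r) powr (2 - a)))"

definition young_integral ::
    "real \<Rightarrow> real \<Rightarrow> real \<Rightarrow> (real \<Rightarrow> ell2 \<Rightarrow>\<^sub>L ell2) \<Rightarrow> (real \<Rightarrow> ell2) \<Rightarrow> ell2" where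
  "young_integral a s t Z w =
     - (\<Sum>\<^sub>\<infinity>j. (\<Sum>\<^sub>\<infinity>i. LINT r:{s<..<t}|lborel.
           frac_deriv_left a s (\<lambda>q. inner (unit_vec j) (Z q (unit_vec i))) r *
           frac_deriv_right a t (\<lambda>q. inner (unit_vec i) (w q)) r) *\<^sub>R unit_vec j)"

section \<open>Mild solutions\<close>

definition mild_solution ::
    "real \<Rightarrow> real \<Rightarrow> (int \<Rightarrow> real \<Rightarrow> real) \<Rightarrow> (int \<Rightarrow> real \<Rightarrow> real) \<Rightarrow> real \<Rightarrow>
     (real \<Rightarrow> ell2) \<Rightarrow> ell2 \<Rightarrow> real \<Rightarrow> (real \<Rightarrow> ell2) \<Rightarrow> bool" where
  "mild_solution \<nu> l f h a w x T u \<longleftrightarrow>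
     (\<forall>t\<in>{0..T}. u t = semigroup_S \<nu> l t x
        + integral {0..t} (\<lambda>r. semigroup_S \<nu> l (t - r) (drift_map f (u r)))
        + young_integral a 0 t (\<lambda>r. semigroup_S \<nu> l (t - r) o\<^sub>L diag_op h (u r)) w)"

end

theory Submission
  imports Defs
begin

text \<open>
  The integral acts coordinatewise: the \<open>j\<close>-th coordinate of \<open>\<integral>\<^sub>s\<^sup>t h(u) d\<omega>\<close> is a scalar integral
  given by fractional derivatives. For \<open>C\<^sup>1\<close> data this integral is \<open>\<integral> z w' dr\<close>, by Fubini and the
  Beta integral. Averages of \<open>z\<close> and \<open>w\<close> are \<open>C\<^sup>1\<close> with the same Hoelder constants, so dominated
  convergence gives independence of \<open>\<alpha>\<close>, additivity in the interval, and integration by parts against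
  \<open>C\<^sup>1\<close> functions for all Hoelder data. With \<open>Y(t) = \<integral>\<^sub>0\<^sup>t h(u) d\<omega>\<close> the last fact yields
  \<open>\<integral>\<^sub>0\<^sup>t S(t-r) h(u) d\<omega> = Y(t) - \<integral>\<^sub>0\<^sup>t A S(t-r) Y(r) dr\<close>, and since \<open>A\<close> is bounded, variation of constants
  turns the mild equation into \<open>u(t) = x + \<integral>\<^sub>0\<^sup>t (f(u) - A u) dr + Y(t)\<close>. The latter is solved by Picard
  iteration: linear growth of \<open>f\<close> and \<open>h\<close> gives an invariant ball for one exponential weight, which
  bounds all iterates in \<open>C\<^sup>\<beta>\<close>, and the map is a contraction on that ball for a second, stronger weight.
\<close>

section \<open>Fractional derivatives and the scalar integral\<close>

text \<open>The integrand of the convolution depends on the upper limit \<open>t\<close>, so its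
  increments are not integrals over \<open>[s, t]\<close>. After the reduction to \<open>x\<close>,
  a time integral and \<open>Y\<close> they are, and the Young estimate applies to them directly.
  Working by coordinates is possible because \<open>h(u)\<close> is diagonal: coordinate
  \<open>i\<close> of \<open>Y\<close> involves only coordinate \<open>i\<close> of
  \<open>h(u)\<close> and of the path. Scalar bounds are proved for finite families in the l2 norm,
  with constants independent of the family, which yields square summability of \<open>Y\<close>. Two
  weights appear because \<open>h\<close> as a map on Hoelder paths is Lipschitz only locally:
  second differences of \<open>h\<close> contribute a quadratic term, whose coefficient is the
  Hoelder constant \<open>R\<close> of one of the paths. Growth, by contrast, is linear. So the
  first step \<open>d0\<close> depends only on the coefficients and the noise, it fixes
  \<open>R\<close>, and the step \<open>d\<close> of the contraction is chosen from
  \<open>R\<close>. Since \<open>\<beta> > 1/2\<close>, the order \<open>1/2\<close> is always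
  admissible and serves as the reference order.\<close>

lemma set_integrable_lborel_of_absolutely_integrable:
  fixes f :: "real \<Rightarrow> real"
  assumes "f absolutely_integrable_on {a..b}" "f \<in> borel_measurable borel"
  shows "set_integrable lborel {a<..<b} f"
proof -
  have "f absolutely_integrable_on {a<..<b}"
    by (rule set_integrable_subset[OF assms(1)]) auto
  \<comment> \<open>\<open>absolutely_integrable_on\<close> refers to the completed Lebesgue
    measure; Borel measurability brings the statement back to \<open>lborel\<close>.\<close>
  then show ?thesis
    using assms(2) unfolding set_integrable_def
    by (subst (asm) integrable_completion) auto
qed

text \<open>Derivatives are asked for in the interior only, because kernels such as a negative power
  of \<open>r - q\<close> blow up at an end point.\<close>

lemma FTC_set_integral_interior:
  fixes G g :: "real \<Rightarrow> real"
  assumes "s \<le> r" "continuous_on {s..r} G"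
    and "\<And>q. s < q \<Longrightarrow> q < r \<Longrightarrow> (G has_real_derivative g q) (at q)"
    and "set_integrable lborel {s<..<r} g"
  shows "(LINT q:{s<..<r}|lborel. g q) = G r - G s"
proof -
  have "(g has_integral G r - G s) {s..r}"
    by (rule fundamental_theorem_of_calculus_interior)
      (use assms in \<open>auto simp: has_real_derivative_iff_has_vector_derivative[symmetric]\<close>)
  then have "(g has_integral G r - G s) {s<..<r}"
    by (simp add: has_integral_Icc_iff_Ioo)
  then show ?thesis
    using set_borel_integral_eq_integral(2)[OF assms(4)] by (simp add: integral_unique)
qed

lemma powr_kernel:
  fixes p s r :: real
  assumes "0 < p" "s \<le> r"
  shows "set_integrable lborel {s<..<r} (\<lambda>q. (r - q) powr (p - 1))"
    and "(LINT q:{s<..<r}|lborel. (r - q) powr (p - 1)) = (r - s) powr p / p"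
proof -
  define G where "G = (\<lambda>q. - ((r - q) powr p / p))"
  have cont: "continuous_on {s..r} G"
    unfolding G_def using assms by (intro continuous_on_minus continuous_on_divide continuous_on_powr' continuous_on_diff continuous_on_const continuous_on_id) auto
  have der: "(G has_real_derivative (r - q) powr (p - 1)) (at q)" if "s < q" "q < r" for q
    unfolding G_def using assms that
    by (auto intro!: derivative_eq_intros simp: field_simps)
  have int: "((\<lambda>q. (r - q) powr (p - 1)) has_integral G r - G s) {s..r}"
    by (rule fundamental_theorem_of_calculus_interior)
      (use assms cont der in \<open>auto simp: has_real_derivative_iff_has_vector_derivative[symmetric]\<close>)
  \<comment> \<open>A nonnegative function with a gauge integral is absolutely integrable, so the
    fundamental theorem yields integrability as well as the value; \<open>p > 0\<close> makes the
    antiderivative continuous at \<open>r\<close>.\<close>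
  then have "(\<lambda>q. (r - q) powr (p - 1)) absolutely_integrable_on {s..r}"
    by (intro nonnegative_absolutely_integrable_1) auto
  then show si: "set_integrable lborel {s<..<r} (\<lambda>q. (r - q) powr (p - 1))"
    by (rule set_integrable_lborel_of_absolutely_integrable) measurable
  show "(LINT q:{s<..<r}|lborel. (r - q) powr (p - 1)) = (r - s) powr p / p"
    using FTC_set_integral_interior[OF assms(2) cont der si] by (simp add: G_def)
qed

text \<open>Reflection exchanges left-sided and right-sided kernels, so the right-sided facts are
  read off from the left-sided ones.\<close>

lemma set_integral_reflect_real:
  fixes f :: "real \<Rightarrow> real"
  shows "set_integrable lborel {a<..<b} (\<lambda>x. f (- x)) \<longleftrightarrow> set_integrable lborel {-b<..<-a} f"
    and "(LINT x:{a<..<b}|lborel. f (- x)) = (LINT x:{-b<..<-a}|lborel. f x)"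
proof -
  have ind: "indicator {-b<..<-a} (- x) = (indicator {a<..<b} x :: real)" for x
    by (auto simp: indicator_def)
  show "set_integrable lborel {a<..<b} (\<lambda>x. f (- x)) \<longleftrightarrow> set_integrable lborel {-b<..<-a} f"
    unfolding set_integrable_def
    using lborel_integrable_real_affine_iff[of "-1" "\<lambda>x. indicator {-b<..<-a} x *\<^sub>R f x" 0]
    by (simp add: ind)
  show "(LINT x:{a<..<b}|lborel. f (- x)) = (LINT x:{-b<..<-a}|lborel. f x)"
    unfolding set_lebesgue_integral_def
    using lborel_integral_real_affine[of "-1" "\<lambda>x. indicator {-b<..<-a} x *\<^sub>R f x" 0]
    by (simp add: ind)
qed

lemma powr_kernel_right:
  fixes p s r :: real
  assumes "0 < p" "s \<le> r"
  shows "set_integrable lborel {s<..<r} (\<lambda>q. (q - s) powr (p - 1))"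
    and "(LINT q:{s<..<r}|lborel. (q - s) powr (p - 1)) = (r - s) powr p / p"
  using powr_kernel[of p "-r" "-s"] assms set_integral_reflect_real[of s r "\<lambda>q. (- s - q) powr (p - 1)"]
  by simp_all

text \<open>The l2 norm of the products is at most their l1 norm, and Cauchy-Schwarz bounds the
  latter.\<close>

lemma L2_set_mult_le: "L2_set (\<lambda>i. f i * g i) F \<le> L2_set f F * L2_set g F"
  using L2_set_le_sum_abs[of "\<lambda>i. f i * g i" F] L2_set_mult_ineq[of f g F]
  by (simp add: abs_mult)

text \<open>Minkowski's integral inequality for a finite family, by duality: the vector
  \<open>c\<close> of integrals is paired with the family under the integral sign, Cauchy-Schwarz
  bounds \<open>X^2\<close> by \<open>X\<close> times the integral of \<open>\<psi>\<close>, and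
  \<open>X\<close> cancels.\<close>

lemma L2_set_set_integral_le:
  fixes \<phi> :: "'i \<Rightarrow> 'a \<Rightarrow> real"
  assumes A: "A \<in> sets M" and int: "\<And>i. i \<in> F \<Longrightarrow> set_integrable M A (\<phi> i)"
    and psi: "set_integrable M A \<psi>"
    and le: "\<And>x. x \<in> A \<Longrightarrow> L2_set (\<lambda>i. \<phi> i x) F \<le> \<psi> x"
  shows "L2_set (\<lambda>i. LINT x:A|M. \<phi> i x) F \<le> (LINT x:A|M. \<psi> x)"
proof -
  define c where "c i = (LINT x:A|M. \<phi> i x)" for i
  define X where "X = L2_set c F"
  have X0: "0 \<le> X" by (simp add: X_def)
  have psi0: "0 \<le> (LINT x:A|M. \<psi> x)"
    unfolding set_lebesgue_integral_def
    by (rule integral_nonneg_AE)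
      (auto simp: indicator_def intro!: order_trans[OF L2_set_nonneg le])
  have sint: "set_integrable M A (\<lambda>x. \<Sum>i\<in>F. c i * \<phi> i x)"
    using int unfolding set_integrable_def scaleR_sum_right
    by (intro Bochner_Integration.integrable_sum)
      (simp add: mult.left_commute)
  have "X\<^sup>2 = (\<Sum>i\<in>F. c i * c i)"
    by (simp add: X_def L2_set_def sum_nonneg power2_eq_square)
  also have "\<dots> = (LINT x:A|M. \<Sum>i\<in>F. c i * \<phi> i x)"
  proof -
    have "(LINT x:A|M. \<Sum>i\<in>F. c i * \<phi> i x) = (\<Sum>i\<in>F. LINT x:A|M. c i * \<phi> i x)"
      using int unfolding set_integrable_def set_lebesgue_integral_def scaleR_sum_right
      by (intro Bochner_Integration.integral_sum) (simp add: mult.left_commute)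
    then show ?thesis by (simp add: c_def)
  qed
  also have "\<dots> \<le> (LINT x:A|M. X * \<psi> x)"
  proof (rule set_integral_mono[OF sint])
    fix x assume x: "x \<in> A"
    have "(\<Sum>i\<in>F. c i * \<phi> i x) \<le> (\<Sum>i\<in>F. \<bar>c i\<bar> * \<bar>\<phi> i x\<bar>)"
      by (rule sum_mono) (metis abs_ge_self abs_mult)
    also have "\<dots> \<le> X * L2_set (\<lambda>i. \<phi> i x) F"
      unfolding X_def by (rule L2_set_mult_ineq)
    also have "\<dots> \<le> X * \<psi> x"
      by (rule mult_left_mono[OF le[OF x] X0])
    finally show "(\<Sum>i\<in>F. c i * \<phi> i x) \<le> X * \<psi> x" .
  qed (use psi in auto)
  finally have "X * X \<le> X * (LINT x:A|M. \<psi> x)" by (simp add: power2_eq_square)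
  then show ?thesis
    unfolding c_def[symmetric] X_def[symmetric] using X0 psi0
    by (cases "X = 0") (auto simp: mult_le_cancel_left)
qed

section \<open>Bounds for the fractional derivatives\<close>

lemma frac_deriv_left_measurable:
  assumes [measurable]: "z \<in> borel_measurable borel"
  shows "frac_deriv_left a s z \<in> borel_measurable borel"
proof -
  \<comment> \<open>Written as a condition on the pair \<open>(r, q)\<close>, the moving interval
    becomes part of a jointly measurable integrand.\<close>
  have [measurable]: "(\<lambda>r. LINT q:{s<..<r}|lborel. (z r - z q) / (r - q) powr (1 + a)) \<in> borel_measurable borel"
    unfolding set_lebesgue_integral_def indicator_def greaterThanLessThan_iff
    by measurable
  show ?thesis unfolding frac_deriv_left_def[abs_def] by measurable
qed

text \<open>Subtracting \<open>w t\<close> reproduces the boundary term of the right derivative and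
  leaves differences unchanged, so bounds, limits and measurability carry over from the left
  derivative.\<close>

lemma frac_deriv_right_reflect:
  "frac_deriv_right a t w r = frac_deriv_left (1 - a) (- t) (\<lambda>x. w (- x) - w t) (- r)"
proof -
  have "(LINT q:{r<..<t}|lborel. (w r - w q) / (q - r) powr (2 - a)) =
    (LINT q:{- t<..<- r}|lborel. (w r - w (- q)) / (- r - q) powr (1 + (1 - a)))"
    using set_integral_reflect_real(2)[of "-t" "-r" "\<lambda>q. (w r - w q) / (q - r) powr (2 - a)"]
    by (simp add: add.commute minus_diff_commute)
  then show ?thesis
    by (simp add: frac_deriv_right_def frac_deriv_left_def)
qed

lemma frac_deriv_right_measurable:
  assumes [measurable]: "w \<in> borel_measurable borel"
  shows "frac_deriv_right a t w \<in> borel_measurable borel"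
proof -
  have "(\<lambda>x. w (- x) - w t) \<in> borel_measurable borel" by measurable
  note [measurable] = frac_deriv_left_measurable[OF this]
  show ?thesis unfolding frac_deriv_right_reflect[abs_def] by measurable
qed

text \<open>Hoelder order \<open>b > a\<close> lowers the singularity from order
  \<open>1 + a\<close> to \<open>1 + a - b < 1\<close>, which is integrable.\<close>

lemma difference_quotient_integrable:
  fixes z :: "real \<Rightarrow> real"
  assumes "a < b" "s < r" and [measurable]: "z \<in> borel_measurable borel"
    and hol: "\<And>q. s < q \<Longrightarrow> q < r \<Longrightarrow> \<bar>z r - z q\<bar> \<le> C * \<bar>r - q\<bar> powr b"
  shows "set_integrable lborel {s<..<r} (\<lambda>q. (z r - z q) / (r - q) powr (1 + a))"
proof -
  have "set_integrable lborel {s<..<r} (\<lambda>q. C * (r - q) powr (b - a - 1))"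
    using powr_kernel(1)[of "b - a" s r] assms by simp
  then show ?thesis
  proof (rule set_integrable_bound)
    show "AE q in lborel. q \<in> {s<..<r} \<longrightarrow>
        norm ((z r - z q) / (r - q) powr (1 + a)) \<le> norm (C * (r - q) powr (b - a - 1))"
    proof (intro AE_I2 impI)
      fix q assume q: "q \<in> {s<..<r}"
      have "norm ((z r - z q) / (r - q) powr (1 + a)) \<le> C * (r - q) powr b / (r - q) powr (1 + a)"
        using hol[of q] q by (simp add: divide_right_mono)
      also have "\<dots> = C * (r - q) powr (b - a - 1)"
        using q powr_diff[of "r - q" b "1 + a"] by (simp add: diff_diff_eq add.commute)
      finally show "norm ((z r - z q) / (r - q) powr (1 + a)) \<le> norm (C * (r - q) powr (b - a - 1))"
        by simp
    qed
  qed (simp add: set_borel_measurable_def)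
qed

text \<open>The boundary term contributes \<open>C0 (r - s)^(-a)\<close>, and the integrated kernel
  of order \<open>1 + a - b\<close> contributes \<open>a / (b - a)\<close> times
  \<open>C (r - s)^(b - a)\<close>; the factor \<open>1 + a / (b - a)\<close> covers both.
  Minkowski's inequality keeps the constant independent of \<open>F\<close>.\<close>

lemma frac_deriv_left_L2_bound:
  fixes z :: "'i \<Rightarrow> real \<Rightarrow> real"
  assumes ab: "0 < a" "a < 1" "a < b" and "s < r" and F: "finite F"
    and meas: "\<And>i. i \<in> F \<Longrightarrow> z i \<in> borel_measurable borel"
    and hol: "\<And>q. s < q \<Longrightarrow> q < r \<Longrightarrow> L2_set (\<lambda>i. z i r - z i q) F \<le> C * \<bar>r - q\<bar> powr b"
    and bd: "L2_set (\<lambda>i. z i r) F \<le> C0"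
  shows "L2_set (\<lambda>i. frac_deriv_left a s (z i) r) F \<le>
    (1 + a / (b - a)) / Gamma (1 - a) * (C0 * (r - s) powr (-a) + C * (r - s) powr (b - a))"
proof -
  define I where "I i = (LINT q:{s<..<r}|lborel. (z i r - z i q) / (r - q) powr (1 + a))" for i
  \<comment> \<open>The midpoint is just some point at which the Hoelder bound is available.\<close>
  have C: "0 \<le> C"
  proof -
    have "0 \<le> C * \<bar>r - (s + r) / 2\<bar> powr b"
      by (rule order_trans[OF L2_set_nonneg hol]) (use assms in auto)
    moreover have "0 < \<bar>r - (s + r) / 2\<bar> powr b" using assms by simp
    ultimately show ?thesis by (simp add: zero_le_mult_iff)
  qed
  have C0: "0 \<le> C0" using bd L2_set_nonneg order_trans by blast
  have IL: "L2_set I F \<le> (LINT q:{s<..<r}|lborel. C * (r - q) powr (b - a - 1))"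
    unfolding I_def
  proof (rule L2_set_set_integral_le)
    fix i assume i: "i \<in> F"
    show "set_integrable lborel {s<..<r} (\<lambda>q. (z i r - z i q) / (r - q) powr (1 + a))"
    proof (rule difference_quotient_integrable[OF ab(3) \<open>s < r\<close> meas[OF i], where C=C])
      fix q assume "s < q" "q < r"
      from hol[OF this] member_le_L2_set[OF F i, of "\<lambda>i. \<bar>z i r - z i q\<bar>"]
      show "\<bar>z i r - z i q\<bar> \<le> C * \<bar>r - q\<bar> powr b" by (simp add: L2_set_def)
    qed
  next
    show "set_integrable lborel {s<..<r} (\<lambda>q. C * (r - q) powr (b - a - 1))"
      using powr_kernel(1)[of "b - a" s r] assms by simp
  next
    fix q assume q: "q \<in> {s<..<r}"
    have "L2_set (\<lambda>i. (z i r - z i q) / (r - q) powr (1 + a)) F =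
        L2_set (\<lambda>i. z i r - z i q) F / (r - q) powr (1 + a)"
      using L2_set_left_distrib[of "1 / (r - q) powr (1 + a)" "\<lambda>i. z i r - z i q" F] by simp
    also have "\<dots> \<le> C * (r - q) powr b / (r - q) powr (1 + a)"
      using hol[of q] q by (simp add: divide_right_mono)
    also have "\<dots> = C * (r - q) powr (b - a - 1)"
      using q powr_diff[of "r - q" b "1 + a"] by (simp add: diff_diff_eq add.commute)
    finally show "L2_set (\<lambda>i. (z i r - z i q) / (r - q) powr (1 + a)) F \<le> C * (r - q) powr (b - a - 1)" .
  qed simp
  also have "\<dots> = C * ((r - s) powr (b - a) / (b - a))"
    using powr_kernel(2)[of "b - a" s r] assms by simp
  finally have IL: "L2_set I F \<le> C * ((r - s) powr (b - a) / (b - a))" .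
  have G: "0 < Gamma (1 - a)" using ab by (simp add: Gamma_real_pos)
  have "L2_set (\<lambda>i. frac_deriv_left a s (z i) r) F =
     1 / Gamma (1 - a) * L2_set (\<lambda>i. z i r * (r - s) powr (-a) + a * I i) F"
    unfolding frac_deriv_left_def I_def[symmetric]
    using G by (subst L2_set_right_distrib) (simp_all add: powr_minus divide_inverse)
  also have "L2_set (\<lambda>i. z i r * (r - s) powr (-a) + a * I i) F \<le>
      L2_set (\<lambda>i. z i r) F * (r - s) powr (-a) + a * L2_set I F"
    by (rule order_trans[OF L2_set_triangle_ineq])
      (use ab in \<open>simp add: L2_set_left_distrib L2_set_right_distrib\<close>)
  also have "\<dots> \<le> C0 * (r - s) powr (-a) + a * (C * ((r - s) powr (b - a) / (b - a)))"
    using bd IL ab by (intro add_mono mult_right_mono mult_left_mono) auto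
  also have "\<dots> = C0 * (r - s) powr (-a) + (a / (b - a)) * (C * (r - s) powr (b - a))"
    by simp
  also have "\<dots> \<le> (1 + a / (b - a)) * (C0 * (r - s) powr (-a)) + (1 + a / (b - a)) * (C * (r - s) powr (b - a))"
  proof (intro add_mono mult_right_mono)
    have "1 * (C0 * (r - s) powr (-a)) \<le> (1 + a / (b - a)) * (C0 * (r - s) powr (-a))"
      using ab C0 by (intro mult_right_mono) auto
    then show "C0 * (r - s) powr (-a) \<le> (1 + a / (b - a)) * (C0 * (r - s) powr (-a))" by simp
  qed (use C in auto)
  finally show ?thesis
    using G by (simp add: divide_right_mono distrib_left mult_left_mono divide_simps)
qed


text \<open>Here the boundary term is \<open>w r - w t\<close>, itself of size
  \<open>C (t - r)^b\<close>. Both terms then have the same power \<open>b + a - 1\<close>, whence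
  the factor 2 and a bound by the Hoelder constant of \<open>w\<close> alone.\<close>

lemma frac_deriv_right_L2_bound:
  fixes w :: "'i \<Rightarrow> real \<Rightarrow> real"
  assumes ab: "0 < a" "a < 1" "1 - a < b" and rt: "r < t" and F: "finite F"
    and meas: "\<And>i. i \<in> F \<Longrightarrow> w i \<in> borel_measurable borel"
    and hol: "\<And>q. r < q \<Longrightarrow> q \<le> t \<Longrightarrow> L2_set (\<lambda>i. w i r - w i q) F \<le> C * \<bar>r - q\<bar> powr b"
  shows "L2_set (\<lambda>i. frac_deriv_right a t (w i) r) F \<le>
    2 * (1 + (1 - a) / (b - (1 - a))) / Gamma a * C * (t - r) powr (b + a - 1)"
proof -
  have "L2_set (\<lambda>i. frac_deriv_right a t (w i) r) F \<le>
     (1 + (1 - a) / (b - (1 - a))) / Gamma (1 - (1 - a)) *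
       (C * (t - r) powr b * (- r - (- t)) powr (- (1 - a)) + C * (- r - (- t)) powr (b - (1 - a)))"
    unfolding frac_deriv_right_reflect
  proof (rule frac_deriv_left_L2_bound)
    show "(\<lambda>x. w i (- x) - w i t) \<in> borel_measurable borel" if "i \<in> F" for i
      using meas[OF that] by measurable
    show "L2_set (\<lambda>i. (w i (- (- r)) - w i t) - (w i (- q) - w i t)) F \<le> C * \<bar>- r - q\<bar> powr b"
      if "- t < q" "q < - r" for q
      using hol[of "- q"] that by (simp add: minus_diff_commute)
    show "L2_set (\<lambda>i. w i (- (- r)) - w i t) F \<le> C * (t - r) powr b"
      using hol[of t] rt by simp
  qed (use ab rt F in auto)
  also have "C * (t - r) powr b * (- r - (- t)) powr (- (1 - a)) = C * (t - r) powr (b + a - 1)"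
    using rt powr_add[of "t - r" b "-(1-a)"] by (simp add: add_diff_eq)
  also have "- r - (- t) = t - r" by simp
  finally show ?thesis by (simp add: algebra_simps)
qed

section \<open>The scalar Young estimate\<close>

text \<open>One scalar entry of \<open>young_integral\<close>; the minus sign is the product of the
  two sign factors of the fractional derivatives under the convention of the integral.\<close>

definition frac_integral :: "real \<Rightarrow> real \<Rightarrow> real \<Rightarrow> (real \<Rightarrow> real) \<Rightarrow> (real \<Rightarrow> real) \<Rightarrow> real" where
  "frac_integral a s t z w =
     - (LINT r:{s<..<t}|lborel. frac_deriv_left a s z r * frac_deriv_right a t w r)"

definition young_bound :: "real \<Rightarrow> real \<Rightarrow> real \<Rightarrow> real" where
  "young_bound a b b' = (1 + a / (b - a)) / Gamma (1 - a) *
     (2 * (1 + (1 - a) / (b' - (1 - a))) / Gamma a)"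

lemma young_bound_nonneg: "0 < a \<Longrightarrow> a < 1 \<Longrightarrow> a < b \<Longrightarrow> 1 - a < b' \<Longrightarrow> 0 \<le> young_bound a b b'"
  unfolding young_bound_def by (intro mult_nonneg_nonneg divide_nonneg_pos Gamma_real_pos) auto

text \<open>The product of the two pointwise bounds, with \<open>t - r\<close> enlarged to
  \<open>t - s\<close> in the second, so that only an integrable singularity at \<open>s\<close>
  remains. The exponents are spelled \<open>p - 1\<close> to match \<open>powr_kernel_right\<close>
  for \<open>p = 1 - a\<close> and \<open>p = b - a + 1\<close>.\<close>

definition young_majorant ::
    "real \<Rightarrow> real \<Rightarrow> real \<Rightarrow> real \<Rightarrow> real \<Rightarrow> real \<Rightarrow> real \<Rightarrow> real \<Rightarrow> real \<Rightarrow> real" where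
  "young_majorant a b b' s t C0 C C' r = young_bound a b b' * C' * (t - s) powr (b' + a - 1) *
     (C0 * (r - s) powr (1 - a - 1) + C * (r - s) powr (b - a + 1 - 1))"

lemma young_majorant_integral:
  assumes ab: "0 < a" "a < b" "b < 1" "1 - a < b'" and "s < t" "0 \<le> C0" "0 \<le> C" "0 \<le> C'"
  shows "set_integrable lborel {s<..<t} (young_majorant a b b' s t C0 C C')"
    and "(LINT r:{s<..<t}|lborel. young_majorant a b b' s t C0 C C' r) \<le>
      young_bound a b b' / (1 - a) * C' * (C0 * (t - s) powr b' + C * (t - s) powr (b + b'))"
proof -
  let ?K = "young_bound a b b' * C' * (t - s) powr (b' + a - 1)"
  note k1 = powr_kernel_right[of "1 - a" s t]
  note k2 = powr_kernel_right[of "b - a + 1" s t]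
  have si: "set_integrable lborel {s<..<t} (\<lambda>r. C0 * (r - s) powr (1 - a - 1))"
    "set_integrable lborel {s<..<t} (\<lambda>r. C * (r - s) powr (b - a + 1 - 1))"
    using k1(1) k2(1) ab \<open>s < t\<close> by auto
  show "set_integrable lborel {s<..<t} (young_majorant a b b' s t C0 C C')"
    unfolding young_majorant_def[abs_def] by (intro set_integrable_mult_right set_integral_add(1)[OF si])
  have add: "(LINT r:{s<..<t}|lborel. C0 * (r - s) powr (1 - a - 1) + C * (r - s) powr (b - a + 1 - 1)) =
      C0 * ((t - s) powr (1 - a) / (1 - a)) + C * ((t - s) powr (b - a + 1) / (b - a + 1))"
    using k1(2) k2(2) ab \<open>s < t\<close> by (subst set_integral_add(2)[OF si]) simp_all
  have K0: "0 \<le> young_bound a b b'" using young_bound_nonneg ab by simp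
  have "(LINT r:{s<..<t}|lborel. young_majorant a b b' s t C0 C C' r) =
      ?K * (C0 * ((t - s) powr (1 - a) / (1 - a)) + C * ((t - s) powr (b - a + 1) / (b - a + 1)))"
    unfolding young_majorant_def by (simp only: set_integral_mult_right add)
  \<comment> \<open>As \<open>1 - a\<close> is at most \<open>b - a + 1\<close>, one denominator
    serves both terms.\<close>
  also have "\<dots> \<le> ?K * (C0 * ((t - s) powr (1 - a) / (1 - a)) + C * ((t - s) powr (b - a + 1) / (1 - a)))"
    using ab assms(5-8) K0 by (intro mult_left_mono add_mono divide_left_mono) auto
  also have "\<dots> = young_bound a b b' / (1 - a) * C' *
      (C0 * ((t - s) powr (b' + a - 1) * (t - s) powr (1 - a)) +
       C * ((t - s) powr (b' + a - 1) * (t - s) powr (b - a + 1)))"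
    by (simp only: divide_inverse distrib_left distrib_right mult_ac)
  also have "(t - s) powr (b' + a - 1) * (t - s) powr (1 - a) = (t - s) powr b'"
    by (simp add: powr_add[symmetric])
  also have "(t - s) powr (b' + a - 1) * (t - s) powr (b - a + 1) = (t - s) powr (b + b')"
    by (simp add: powr_add[symmetric] add.commute)
  finally show "(LINT r:{s<..<t}|lborel. young_majorant a b b' s t C0 C C' r) \<le>
      young_bound a b b' / (1 - a) * C' * (C0 * (t - s) powr b' + C * (t - s) powr (b + b'))" .
qed

lemma frac_deriv_product_L2_bound:
  fixes z w :: "'i \<Rightarrow> real \<Rightarrow> real"
  assumes ab: "0 < a" "a < b" "b < 1" "1 - a < b'" and r: "s < r" "r < t" and F: "finite F"
    and mz: "\<And>i. i \<in> F \<Longrightarrow> z i \<in> borel_measurable borel"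
    and mw: "\<And>i. i \<in> F \<Longrightarrow> w i \<in> borel_measurable borel"
    and hz: "\<And>r q. r \<in> {s..t} \<Longrightarrow> q \<in> {s..t} \<Longrightarrow> L2_set (\<lambda>i. z i r - z i q) F \<le> C * \<bar>r - q\<bar> powr b"
    and bz: "\<And>r. r \<in> {s..t} \<Longrightarrow> L2_set (\<lambda>i. z i r) F \<le> C0"
    and hw: "\<And>r q. r \<in> {s..t} \<Longrightarrow> q \<in> {s..t} \<Longrightarrow> L2_set (\<lambda>i. w i r - w i q) F \<le> C' * \<bar>r - q\<bar> powr b'"
  shows "L2_set (\<lambda>i. frac_deriv_left a s (z i) r * frac_deriv_right a t (w i) r) F
    \<le> young_majorant a b b' s t C0 C C' r"
proof -
  have C': "0 \<le> C'"
    using order_trans[OF L2_set_nonneg hw[of s t]] r by (auto simp: zero_le_mult_iff)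
  have C: "0 \<le> C"
    using order_trans[OF L2_set_nonneg hz[of s t]] r by (auto simp: zero_le_mult_iff)
  have C0: "0 \<le> C0"
    using order_trans[OF L2_set_nonneg bz[of r]] r by auto
  have l: "L2_set (\<lambda>i. frac_deriv_left a s (z i) r) F \<le>
    (1 + a / (b - a)) / Gamma (1 - a) * (C0 * (r - s) powr (-a) + C * (r - s) powr (b - a))"
  proof (rule frac_deriv_left_L2_bound)
    show "L2_set (\<lambda>i. z i r - z i q) F \<le> C * \<bar>r - q\<bar> powr b" if "s < q" "q < r" for q
      using hz[of r q] that r by simp
  qed (use ab r F mz bz in auto)
  have "L2_set (\<lambda>i. frac_deriv_right a t (w i) r) F \<le>
    2 * (1 + (1 - a) / (b' - (1 - a))) / Gamma a * C' * (t - r) powr (b' + a - 1)"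
  proof (rule frac_deriv_right_L2_bound)
    show "L2_set (\<lambda>i. w i r - w i q) F \<le> C' * \<bar>r - q\<bar> powr b'" if "r < q" "q \<le> t" for q
      using hw[of r q] that r by simp
  qed (use ab r F mw in auto)
  also have "\<dots> \<le> 2 * (1 + (1 - a) / (b' - (1 - a))) / Gamma a * C' * (t - s) powr (b' + a - 1)"
    using ab r C' by (intro mult_left_mono powr_mono2 mult_nonneg_nonneg divide_nonneg_pos Gamma_real_pos) auto
  finally have rr: "L2_set (\<lambda>i. frac_deriv_right a t (w i) r) F \<le>
    2 * (1 + (1 - a) / (b' - (1 - a))) / Gamma a * C' * (t - s) powr (b' + a - 1)" .
  have "L2_set (\<lambda>i. frac_deriv_left a s (z i) r * frac_deriv_right a t (w i) r) F \<le>
      ((1 + a / (b - a)) / Gamma (1 - a) * (C0 * (r - s) powr (-a) + C * (r - s) powr (b - a))) *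
      (2 * (1 + (1 - a) / (b' - (1 - a))) / Gamma a * C' * (t - s) powr (b' + a - 1))"
    by (rule order_trans[OF L2_set_mult_le mult_mono[OF l rr]])
      (use ab C C0 in \<open>auto intro!: mult_nonneg_nonneg divide_nonneg_pos Gamma_real_pos add_nonneg_nonneg\<close>)
  also have "\<dots> = young_majorant a b b' s t C0 C C' r"
    unfolding young_majorant_def young_bound_def by (simp add: mult_ac)
  finally show ?thesis .
qed

lemma frac_deriv_product_bound:
  fixes z w :: "real \<Rightarrow> real"
  assumes ab: "0 < a" "a < b" "b < 1" "1 - a < b'" and r: "s < r" "r < t"
    and mz: "z \<in> borel_measurable borel" and mw: "w \<in> borel_measurable borel"
    and hz: "\<And>r q. r \<in> {s..t} \<Longrightarrow> q \<in> {s..t} \<Longrightarrow> \<bar>z r - z q\<bar> \<le> C * \<bar>r - q\<bar> powr b"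
    and bz: "\<And>r. r \<in> {s..t} \<Longrightarrow> \<bar>z r\<bar> \<le> C0"
    and hw: "\<And>r q. r \<in> {s..t} \<Longrightarrow> q \<in> {s..t} \<Longrightarrow> \<bar>w r - w q\<bar> \<le> C' * \<bar>r - q\<bar> powr b'"
  shows "\<bar>frac_deriv_left a s z r * frac_deriv_right a t w r\<bar> \<le> young_majorant a b b' s t C0 C C' r"
  \<comment> \<open>A family with a single index has the absolute value as its l2 norm.\<close>
  using frac_deriv_product_L2_bound[OF ab r, of "{()}" "\<lambda>_. z" "\<lambda>_. w" C C0 C'] assms by simp

lemma frac_deriv_product_integrable:
  fixes z w :: "real \<Rightarrow> real"
  assumes ab: "0 < a" "a < b" "b < 1" "1 - a < b'" and st: "s < t"
    and mz[measurable]: "z \<in> borel_measurable borel" and mw[measurable]: "w \<in> borel_measurable borel"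
    and hz: "\<And>r q. r \<in> {s..t} \<Longrightarrow> q \<in> {s..t} \<Longrightarrow> \<bar>z r - z q\<bar> \<le> C * \<bar>r - q\<bar> powr b"
    and bz: "\<And>r. r \<in> {s..t} \<Longrightarrow> \<bar>z r\<bar> \<le> C0"
    and hw: "\<And>r q. r \<in> {s..t} \<Longrightarrow> q \<in> {s..t} \<Longrightarrow> \<bar>w r - w q\<bar> \<le> C' * \<bar>r - q\<bar> powr b'"
  shows "set_integrable lborel {s<..<t} (\<lambda>r. frac_deriv_left a s z r * frac_deriv_right a t w r)"
proof (rule set_integrable_bound)
  have "0 \<le> C'" "0 \<le> C" "0 \<le> C0"
    using order_trans[OF abs_ge_zero hw[of s t]] order_trans[OF abs_ge_zero hz[of s t]]
      order_trans[OF abs_ge_zero bz[of s]] st by (auto simp: zero_le_mult_iff)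
  then show "set_integrable lborel {s<..<t} (young_majorant a b b' s t C0 C C')"
    using ab st by (intro young_majorant_integral)
  note [measurable] = frac_deriv_left_measurable[OF mz] frac_deriv_right_measurable[OF mw]
  show "set_borel_measurable lborel {s<..<t} (\<lambda>r. frac_deriv_left a s z r * frac_deriv_right a t w r)"
    unfolding set_borel_measurable_def by measurable
  show "AE r in lborel. r \<in> {s<..<t} \<longrightarrow> norm (frac_deriv_left a s z r * frac_deriv_right a t w r)
      \<le> norm (young_majorant a b b' s t C0 C C' r)"
    using frac_deriv_product_bound[OF ab _ _ mz mw hz bz hw] by (intro AE_I2 impI) (fastforce intro: order_trans)
qed

text \<open>The Young estimate: Minkowski's inequality applied to the integrable majorant. Since the
  constant does not depend on \<open>F\<close>, the estimate passes to square summable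
  families.\<close>

lemma frac_integral_L2_bound:
  fixes z w :: "'i \<Rightarrow> real \<Rightarrow> real"
  assumes ab: "0 < a" "a < b" "b < 1" "1 - a < b'" and st: "s \<le> t" and F: "finite F"
    and mz: "\<And>i. i \<in> F \<Longrightarrow> z i \<in> borel_measurable borel"
    and mw: "\<And>i. i \<in> F \<Longrightarrow> w i \<in> borel_measurable borel"
    and hz: "\<And>r q. r \<in> {s..t} \<Longrightarrow> q \<in> {s..t} \<Longrightarrow> L2_set (\<lambda>i. z i r - z i q) F \<le> C * \<bar>r - q\<bar> powr b"
    and bz: "\<And>r. r \<in> {s..t} \<Longrightarrow> L2_set (\<lambda>i. z i r) F \<le> C0"
    and hw: "\<And>r q. r \<in> {s..t} \<Longrightarrow> q \<in> {s..t} \<Longrightarrow> L2_set (\<lambda>i. w i r - w i q) F \<le> C' * \<bar>r - q\<bar> powr b'"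
  shows "L2_set (\<lambda>i. frac_integral a s t (z i) (w i)) F \<le>
    young_bound a b b' / (1 - a) * C' * (C0 * (t - s) powr b' + C * (t - s) powr (b + b'))"
proof (cases "s = t")
  case True
  then show ?thesis by (simp add: frac_integral_def L2_set_def set_lebesgue_integral_def)
next
  case False
  with st have st: "s < t" by simp
  have nn: "0 \<le> C'" "0 \<le> C" "0 \<le> C0"
    using order_trans[OF L2_set_nonneg hw[of s t]] order_trans[OF L2_set_nonneg hz[of s t]]
      order_trans[OF L2_set_nonneg bz[of s]] st by (auto simp: zero_le_mult_iff)
  have "L2_set (\<lambda>i. frac_integral a s t (z i) (w i)) F =
      L2_set (\<lambda>i. LINT r:{s<..<t}|lborel. frac_deriv_left a s (z i) r * frac_deriv_right a t (w i) r) F"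
    by (simp add: frac_integral_def L2_set_def)
  also have "\<dots> \<le> (LINT r:{s<..<t}|lborel. young_majorant a b b' s t C0 C C' r)"
  proof (rule L2_set_set_integral_le)
    fix i assume i: "i \<in> F"
    have le: "\<bar>x i\<bar> \<le> L2_set x F" for x :: "'i \<Rightarrow> real"
      using member_le_L2_set[OF F i, of "\<lambda>i. \<bar>x i\<bar>"] by (simp add: L2_set_def)
    show "set_integrable lborel {s<..<t} (\<lambda>r. frac_deriv_left a s (z i) r * frac_deriv_right a t (w i) r)"
      by (rule frac_deriv_product_integrable[OF ab st mz[OF i] mw[OF i]])
        (rule order_trans[OF le hz] order_trans[OF le bz] order_trans[OF le hw]; assumption)+
  next
    fix r assume "r \<in> {s<..<t}"
    then show "L2_set (\<lambda>i. frac_deriv_left a s (z i) r * frac_deriv_right a t (w i) r) F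
        \<le> young_majorant a b b' s t C0 C C' r"
      by (intro frac_deriv_product_L2_bound ab F mz mw hz bz hw) auto
  qed (use young_majorant_integral(1)[OF ab st] nn in auto)
  also note young_majorant_integral(2)[OF ab st nn(3,2,1)]
  finally show ?thesis .
qed

section \<open>Passage to the limit under uniform Hoelder bounds\<close>

text \<open>The common Hoelder constant supplies the dominating kernel. The value at
  \<open>r\<close> enters the boundary term and every difference, so convergence is asked for at
  \<open>r\<close> too.\<close>

lemma frac_deriv_left_tendsto:
  fixes zn :: "nat \<Rightarrow> real \<Rightarrow> real"
  assumes "a < b" "s < r"
    and [measurable]: "\<And>n. zn n \<in> borel_measurable borel" "z \<in> borel_measurable borel"
    and hol: "\<And>n q. s < q \<Longrightarrow> q < r \<Longrightarrow> \<bar>zn n r - zn n q\<bar> \<le> C * \<bar>r - q\<bar> powr b"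
    and lim: "\<And>q. s < q \<Longrightarrow> q \<le> r \<Longrightarrow> (\<lambda>n. zn n q) \<longlonglongrightarrow> z q"
  shows "(\<lambda>n. frac_deriv_left a s (zn n) r) \<longlonglongrightarrow> frac_deriv_left a s z r"
proof -
  have "(\<lambda>n. LINT q:{s<..<r}|lborel. (zn n r - zn n q) / (r - q) powr (1 + a)) \<longlonglongrightarrow>
      (LINT q:{s<..<r}|lborel. (z r - z q) / (r - q) powr (1 + a))"
    unfolding set_lebesgue_integral_def
  proof (rule integral_dominated_convergence)
    show "integrable lborel (\<lambda>q. indicator {s<..<r} q *\<^sub>R (C * (r - q) powr (b - a - 1)))"
      using powr_kernel(1)[of "b - a" s r] assms unfolding set_integrable_def[symmetric] by simp
    show "AE q in lborel. (\<lambda>n. indicator {s<..<r} q *\<^sub>R ((zn n r - zn n q) / (r - q) powr (1 + a)))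
        \<longlonglongrightarrow> indicator {s<..<r} q *\<^sub>R ((z r - z q) / (r - q) powr (1 + a))"
      using lim[of r] \<open>s < r\<close>
      by (intro AE_I2) (auto simp: indicator_def intro!: tendsto_divide tendsto_diff lim)
    fix n
    show "AE q in lborel. norm (indicator {s<..<r} q *\<^sub>R ((zn n r - zn n q) / (r - q) powr (1 + a)))
        \<le> indicator {s<..<r} q *\<^sub>R (C * (r - q) powr (b - a - 1))"
    proof (intro AE_I2)
      fix q
      show "norm (indicator {s<..<r} q *\<^sub>R ((zn n r - zn n q) / (r - q) powr (1 + a)))
        \<le> indicator {s<..<r} q *\<^sub>R (C * (r - q) powr (b - a - 1))"
      proof (cases "q \<in> {s<..<r}")
        case True
        then have "norm ((zn n r - zn n q) / (r - q) powr (1 + a)) \<le> C * (r - q) powr b / (r - q) powr (1 + a)"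
          using hol[of q n] by (simp add: divide_right_mono)
        also have "\<dots> = C * (r - q) powr (b - a - 1)"
          using True powr_diff[of "r - q" b "1 + a"] by (simp add: diff_diff_eq add.commute)
        finally show ?thesis using True by simp
      qed simp
    qed
  qed measurable
  then show ?thesis
    unfolding frac_deriv_left_def using lim[of r] \<open>s < r\<close>
    by (intro tendsto_mult tendsto_add tendsto_divide tendsto_const) auto
qed

lemma frac_deriv_right_tendsto:
  fixes wn :: "nat \<Rightarrow> real \<Rightarrow> real"
  assumes "1 - a < b" "r < t"
    and [measurable]: "\<And>n. wn n \<in> borel_measurable borel" "w \<in> borel_measurable borel"
    and hol: "\<And>n q. r < q \<Longrightarrow> q < t \<Longrightarrow> \<bar>wn n r - wn n q\<bar> \<le> C * \<bar>r - q\<bar> powr b"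
    and lim: "\<And>q. r \<le> q \<Longrightarrow> q \<le> t \<Longrightarrow> (\<lambda>n. wn n q) \<longlonglongrightarrow> w q"
  shows "(\<lambda>n. frac_deriv_right a t (wn n) r) \<longlonglongrightarrow> frac_deriv_right a t w r"
  unfolding frac_deriv_right_reflect
proof (rule frac_deriv_left_tendsto)
  show "\<bar>(wn n (- (- r)) - wn n t) - (wn n (- q) - wn n t)\<bar> \<le> C * \<bar>- r - q\<bar> powr b"
    if "- t < q" "q < - r" for n q
    using hol[of "- q" n] that by (simp add: minus_diff_commute)
  show "(\<lambda>n. wn n (- q) - wn n t) \<longlonglongrightarrow> w (- q) - w t" if "- t < q" "q \<le> - r" for q
    using that \<open>r < t\<close> by (intro tendsto_diff lim) auto
qed (use assms in auto)

text \<open>Pointwise convergence with common constants is enough, with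
  \<open>young_majorant\<close> dominating. Convergence in Hoelder norm would be too much to ask of
  approximations, since smooth functions are not dense in a Hoelder space.\<close>

lemma frac_integral_tendsto:
  fixes zn wn :: "nat \<Rightarrow> real \<Rightarrow> real"
  assumes ab: "0 < a" "a < b" "b < 1" "1 - a < b'" and st: "s \<le> t"
    and mz: "\<And>n. zn n \<in> borel_measurable borel" "z \<in> borel_measurable borel"
    and mw: "\<And>n. wn n \<in> borel_measurable borel" "w \<in> borel_measurable borel"
    and hz: "\<And>n r q. r \<in> {s..t} \<Longrightarrow> q \<in> {s..t} \<Longrightarrow> \<bar>zn n r - zn n q\<bar> \<le> C * \<bar>r - q\<bar> powr b"
    and bz: "\<And>n r. r \<in> {s..t} \<Longrightarrow> \<bar>zn n r\<bar> \<le> C0"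
    and hw: "\<And>n r q. r \<in> {s..t} \<Longrightarrow> q \<in> {s..t} \<Longrightarrow> \<bar>wn n r - wn n q\<bar> \<le> C' * \<bar>r - q\<bar> powr b'"
    and limz: "\<And>r. r \<in> {s..t} \<Longrightarrow> (\<lambda>n. zn n r) \<longlonglongrightarrow> z r"
    and limw: "\<And>r. r \<in> {s..t} \<Longrightarrow> (\<lambda>n. wn n r) \<longlonglongrightarrow> w r"
  shows "(\<lambda>n. frac_integral a s t (zn n) (wn n)) \<longlonglongrightarrow> frac_integral a s t z w"
proof (cases "s = t")
  case True
  then show ?thesis by (simp add: frac_integral_def set_lebesgue_integral_def)
next
  case False
  with st have st: "s < t" by simp
  have nn: "0 \<le> C'" "0 \<le> C" "0 \<le> C0"
    using order_trans[OF abs_ge_zero hw[of s t]] order_trans[OF abs_ge_zero hz[of s t]]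
      order_trans[OF abs_ge_zero bz[of s]] st by (auto simp: zero_le_mult_iff)
  note [measurable] = frac_deriv_left_measurable[OF mz(1)] frac_deriv_left_measurable[OF mz(2)]
    frac_deriv_right_measurable[OF mw(1)] frac_deriv_right_measurable[OF mw(2)]
  show ?thesis
    unfolding frac_integral_def set_lebesgue_integral_def
  proof (intro tendsto_minus integral_dominated_convergence)
    show "integrable lborel (\<lambda>r. indicator {s<..<t} r *\<^sub>R young_majorant a b b' s t C0 C C' r)"
      using young_majorant_integral(1)[OF ab st nn(3,2,1)] by (simp add: set_integrable_def)
    show "AE r in lborel. (\<lambda>n. indicator {s<..<t} r *\<^sub>R
        (frac_deriv_left a s (zn n) r * frac_deriv_right a t (wn n) r)) \<longlonglongrightarrow>
        indicator {s<..<t} r *\<^sub>R (frac_deriv_left a s z r * frac_deriv_right a t w r)"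
    proof (intro AE_I2)
      fix r
      show "(\<lambda>n. indicator {s<..<t} r *\<^sub>R
        (frac_deriv_left a s (zn n) r * frac_deriv_right a t (wn n) r)) \<longlonglongrightarrow>
        indicator {s<..<t} r *\<^sub>R (frac_deriv_left a s z r * frac_deriv_right a t w r)"
      proof (cases "r \<in> {s<..<t}")
        case True
        have "(\<lambda>n. frac_deriv_left a s (zn n) r) \<longlonglongrightarrow> frac_deriv_left a s z r"
        proof (rule frac_deriv_left_tendsto[where b=b and C=C])
          show "\<bar>zn n r - zn n q\<bar> \<le> C * \<bar>r - q\<bar> powr b" if "s < q" "q < r" for n q
            using hz[of r q n] that True by simp
        qed (use True ab mz limz in auto)
        moreover have "(\<lambda>n. frac_deriv_right a t (wn n) r) \<longlonglongrightarrow> frac_deriv_right a t w r"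
        proof (rule frac_deriv_right_tendsto[where b=b' and C=C'])
          show "\<bar>wn n r - wn n q\<bar> \<le> C' * \<bar>r - q\<bar> powr b'" if "r < q" "q < t" for n q
            using hw[of r q n] that True by simp
        qed (use True ab mw limw in auto)
        ultimately show ?thesis by (intro tendsto_intros)
      qed simp
    qed
    fix n
    show "AE r in lborel. norm (indicator {s<..<t} r *\<^sub>R
        (frac_deriv_left a s (zn n) r * frac_deriv_right a t (wn n) r)) \<le>
        indicator {s<..<t} r *\<^sub>R young_majorant a b b' s t C0 C C' r"
      using frac_deriv_product_bound[OF ab _ _ mz(1) mw(1) hz bz hw]
      by (intro AE_I2) (auto simp: indicator_def)
  qed measurable
qed

section \<open>Continuously differentiable data\<close>

lemma set_integrable_continuous:
  fixes f :: "real \<Rightarrow> real"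
  assumes "continuous_on {s..t} f"
  shows "set_integrable lborel {s<..<t} f"
  by (rule set_integrable_subset[OF borel_integrable_atLeastAtMost'[OF assms]]) auto

lemma set_integrable_mult_kernel:
  fixes f k :: "real \<Rightarrow> real"
  assumes k: "set_integrable lborel {s<..<t} k" and bd: "\<And>q. q \<in> {s<..<t} \<Longrightarrow> \<bar>f q\<bar> \<le> C"
    and [measurable]: "f \<in> borel_measurable borel" "k \<in> borel_measurable borel"
  shows "set_integrable lborel {s<..<t} (\<lambda>q. f q * k q)"
proof (rule set_integrable_bound)
  show "set_integrable lborel {s<..<t} (\<lambda>q. C * k q)" using k by simp
  show "AE q in lborel. q \<in> {s<..<t} \<longrightarrow> norm (f q * k q) \<le> norm (C * k q)"
    using bd by (intro AE_I2 impI) (force simp: abs_mult intro!: mult_right_mono)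
qed (simp add: set_borel_measurable_def)

lemma C1_bounded_Icc:
  fixes z' :: "real \<Rightarrow> real"
  assumes "continuous_on UNIV z'"
  obtains L where "0 \<le> L" "\<And>q. q \<in> {s..t} \<Longrightarrow> \<bar>z' q\<bar> \<le> L"
proof -
  have "compact (z' ` {s..t})"
    by (intro compact_continuous_image continuous_on_subset[OF assms]) auto
  then obtain L where L: "\<And>x. x \<in> z' ` {s..t} \<Longrightarrow> norm x \<le> L"
    using compact_imp_bounded bounded_iff by metis
  show thesis by (rule that[of "\<bar>L\<bar>"]) (use L in force)+
qed

lemma C1_Lipschitz_Icc:
  fixes z z' :: "real \<Rightarrow> real"
  assumes der: "\<And>x. (z has_real_derivative z' x) (at x)" and bd: "\<And>q. q \<in> {s..t} \<Longrightarrow> \<bar>z' q\<bar> \<le> L"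
    and "p \<in> {s..t}" "q \<in> {s..t}"
  shows "\<bar>z p - z q\<bar> \<le> L * \<bar>p - q\<bar>"
  using field_differentiable_bound[of "{s..t}" z z' L p q] assms
  by (auto intro: has_field_derivative_at_within)

text \<open>Integrating the difference quotient by parts expresses the derivative of order
  \<open>a\<close> as a boundary value at \<open>s\<close> plus the fractional integral of order
  \<open>1 - a\<close> of \<open>z'\<close>, whose kernel is integrable by itself.\<close>

lemma frac_deriv_left_C1:
  fixes z z' :: "real \<Rightarrow> real"
  assumes der: "\<And>x. (z has_real_derivative z' x) (at x)" and cont: "continuous_on UNIV z'"
    and a: "0 < a" "a < 1" and "s < r"
  shows "frac_deriv_left a s z r =
    (z s * (r - s) powr (- a) + (LINT p:{s<..<r}|lborel. z' p * (r - p) powr (- a))) / Gamma (1 - a)"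
proof -
  obtain L where L0: "0 \<le> L" and L: "\<And>q. q \<in> {s..r} \<Longrightarrow> \<bar>z' q\<bar> \<le> L"
    using C1_bounded_Icc[OF cont] by metis
  have lip: "\<bar>z p - z q\<bar> \<le> L * \<bar>p - q\<bar>" if "p \<in> {s..r}" "q \<in> {s..r}" for p q
    using C1_Lipschitz_Icc[OF der L that] by blast
  have contz: "continuous_on UNIV z"
    using der by (meson DERIV_isCont continuous_at_imp_continuous_on)
  have [measurable]: "z \<in> borel_measurable borel" "z' \<in> borel_measurable borel"
    using contz cont by (auto intro: borel_measurable_continuous_onI)
  have i1: "set_integrable lborel {s<..<r} (\<lambda>p. z' p * (r - p) powr (- a))"
    by (rule set_integrable_mult_kernel[where C=L])
      (use powr_kernel(1)[of "1 - a" s r] a \<open>s < r\<close> L in auto)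
  have i2: "set_integrable lborel {s<..<r} (\<lambda>q. a * ((z r - z q) / (r - q) powr (1 + a)))"
    using lip[of r] \<open>s < r\<close> a
    by (intro set_integrable_mult_right difference_quotient_integrable[where b=1 and C=L]) auto
  \<comment> \<open>The antiderivative: differentiating the kernel gives the difference quotient,
    differentiating the other factor gives the term with \<open>z'\<close>.\<close>
  define G where "G q = (z r - z q) * (r - q) powr (- a)" for q
  have "(LINT q:{s<..<r}|lborel. a * ((z r - z q) / (r - q) powr (1 + a)) - z' q * (r - q) powr (- a)) = G r - G s"
  proof (rule FTC_set_integral_interior)
    show "continuous_on {s..r} G"
      unfolding continuous_on_def
    proof
      fix x assume x: "x \<in> {s..r}"
      show "(G \<longlongrightarrow> G x) (at x within {s..r})"
      proof (cases "x = r")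
        \<comment> \<open>At the singular end the Lipschitz bound on \<open>z\<close> beats the
          kernel, since \<open>1 - a > 0\<close>; the value \<open>G r\<close> is 0 because its
          first factor is.\<close>
        case True
        have "((\<lambda>q. L * (r - q) powr (1 - a)) \<longlongrightarrow> L * (r - r) powr (1 - a)) (at r within {s..r})"
          using a by (intro tendsto_mult tendsto_const tendsto_powr' tendsto_diff tendsto_ident_at)
            (auto simp: eventually_at_filter)
        then have lim0: "((\<lambda>q. L * (r - q) powr (1 - a)) \<longlongrightarrow> 0) (at r within {s..r})" by simp
        have "(G \<longlongrightarrow> 0) (at r within {s..r})"
        proof (rule Lim_null_comparison[OF _ lim0])
          show "\<forall>\<^sub>F q in at r within {s..r}. norm (G q) \<le> L * (r - q) powr (1 - a)"
            unfolding eventually_at_filter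
          proof (intro always_eventually allI impI)
            fix q assume q: "q \<noteq> r" "q \<in> {s..r}"
            have "norm (G q) \<le> (L * (r - q)) * (r - q) powr (- a)"
              unfolding G_def using lip[of r q] q \<open>s < r\<close> by (auto simp: abs_mult intro!: mult_right_mono)
            also have "\<dots> = L * (r - q) powr (1 - a)"
              using q powr_add[of "r - q" 1 "-a"] by simp
            finally show "norm (G q) \<le> L * (r - q) powr (1 - a)" .
          qed
        qed
        then show ?thesis using True by (simp add: G_def)
      next
        case False
        then have "isCont G x"
          unfolding G_def using x contz
          by (intro continuous_intros) (auto simp: continuous_on_eq_continuous_at)
        then show ?thesis
          by (simp add: continuous_at_imp_continuous_at_within continuous_within[symmetric])
      qed
    qed
    show "(G has_real_derivative a * ((z r - z q) / (r - q) powr (1 + a)) - z' q * (r - q) powr (- a)) (at q)"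
      if "s < q" "q < r" for q
    proof -
      have e: "(r - q) powr (- a - 1) = 1 / (r - q) powr (1 + a)"
        using that powr_minus_divide[of "r - q" "1 + a"] by (simp add: minus_diff_commute)
      show ?thesis unfolding G_def[abs_def] using that
        by (auto intro!: derivative_eq_intros der simp: e simp del: minus_add_distrib)
    qed
    show "set_integrable lborel {s<..<r} (\<lambda>q. a * ((z r - z q) / (r - q) powr (1 + a)) - z' q * (r - q) powr (- a))"
      by (intro set_integral_diff i1 i2)
  qed (use \<open>s < r\<close> in auto)
  then have "a * (LINT q:{s<..<r}|lborel. (z r - z q) / (r - q) powr (1 + a)) =
      (LINT p:{s<..<r}|lborel. z' p * (r - p) powr (- a)) - (z r - z s) * (r - s) powr (- a)"
    unfolding set_integral_diff(2)[OF i2 i1] set_integral_mult_right by (simp add: G_def)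
  moreover have "z r / (r - s) powr a = z r * (r - s) powr (- a)"
    by (simp add: powr_minus divide_inverse)
  ultimately show ?thesis unfolding frac_deriv_left_def by (simp add: algebra_simps add_divide_distrib)
qed

text \<open>The reflected path \<open>w (- x) - w t\<close> vanishes at \<open>- t\<close>, so the
  boundary term of the left formula drops out.\<close>

lemma frac_deriv_right_C1:
  fixes w w' :: "real \<Rightarrow> real"
  assumes der: "\<And>x. (w has_real_derivative w' x) (at x)" and cont: "continuous_on UNIV w'"
    and a: "0 < a" "a < 1" and "r < t"
  shows "frac_deriv_right a t w r =
    - (LINT q:{r<..<t}|lborel. w' q * (q - r) powr (a - 1)) / Gamma a"
proof -
  have d: "((\<lambda>x. w (- x) - w t) has_real_derivative - w' (- x)) (at x)" for x
    using DERIV_chain'[of uminus "-1" x UNIV w "w' (- x)"] der[of "- x"]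
    by (auto intro!: derivative_eq_intros DERIV_chain'[where f=uminus])
  have c: "continuous_on UNIV (\<lambda>x. - w' (- x))"
    by (intro continuous_intros continuous_on_compose2[OF cont]) auto
  have "frac_deriv_right a t w r =
    (LINT p:{- t<..<- r}|lborel. - w' (- p) * (- r - p) powr (- (1 - a))) / Gamma a"
    unfolding frac_deriv_right_reflect using frac_deriv_left_C1[OF d c, of "1 - a" "- t" "- r"] a \<open>r < t\<close> by simp
  also have "(LINT p:{- t<..<- r}|lborel. - w' (- p) * (- r - p) powr (- (1 - a))) =
     (LINT q:{r<..<t}|lborel. - (w' q * (q - r) powr (a - 1)))"
    using set_integral_reflect_real(2)[of "-t" "-r" "\<lambda>q. - (w' q * (q - r) powr (a - 1))"]
    by (simp add: minus_diff_commute add.commute)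
  finally show ?thesis by (simp add: set_lebesgue_integral_def)
qed


text \<open>Exchange of order over the triangle \<open>s < p < r < t\<close>. Only integrability is
  asked of \<open>\<phi>\<close>, because one application puts a singular power there; boundedness
  of \<open>\<psi>\<close> and \<open>k < 1\<close> make the modulus integrable.\<close>

lemma frac_kernel_Fubini:
  fixes \<phi> \<psi> :: "real \<Rightarrow> real"
  assumes k: "k < 1" and phi: "set_integrable lborel {s<..<t} \<phi>"
    and [measurable]: "\<phi> \<in> borel_measurable borel" "\<psi> \<in> borel_measurable borel"
    and bd: "\<And>r. r \<in> {s<..<t} \<Longrightarrow> \<bar>\<psi> r\<bar> \<le> C"
  shows "(LINT r:{s<..<t}|lborel. (LINT p:{s<..<r}|lborel. \<phi> p * (r - p) powr (- k)) * \<psi> r) =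
    (LINT p:{s<..<t}|lborel. \<phi> p * (LINT r:{p<..<t}|lborel. \<psi> r * (r - p) powr (- k)))"
proof (cases "s < t")
  case False
  then show ?thesis by (simp add: set_lebesgue_integral_def)
next
  case True
  have C0: "0 \<le> C" using bd[of "(s + t) / 2"] True by auto
  \<comment> \<open>Extension by zero lets both iterated integrals run over the whole line;
    \<open>row\<close> and \<open>col\<close> factor the integrand for the two orders.\<close>
  define f where "f p r = (if s < p \<and> p < t \<and> p < r \<and> r < t then \<phi> p * (\<psi> r * (r - p) powr (- k)) else 0)" for p r
  have [measurable]: "case_prod f \<in> borel_measurable (lborel \<Otimes>\<^sub>M lborel)"
    unfolding f_def by measurable
  have row: "f p r = indicator {s<..<t} p * \<phi> p * (indicator {p<..<t} r *\<^sub>R (\<psi> r * (r - p) powr (- k)))" for p r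
    by (auto simp: f_def indicator_def)
  have col: "f p r = (indicator {s<..<t} r * \<psi> r) * (indicator {s<..<r} p *\<^sub>R (\<phi> p * (r - p) powr (- k)))" for p r
    by (auto simp: f_def indicator_def)
  have ker: "set_integrable lborel {p<..<t} (\<lambda>r. (r - p) powr (- k))"
    "(LINT r:{p<..<t}|lborel. (r - p) powr (- k)) = (t - p) powr (1 - k) / (1 - k)" if "p \<le> t" for p
    using powr_kernel_right[of "1 - k" p t] k that by auto
  have si: "set_integrable lborel {p<..<t} (\<lambda>r. \<psi> r * (r - p) powr (- k))" if "s < p" "p < t" for p
    by (rule set_integrable_mult_kernel[where C=C]) (use ker[of p] that bd in auto)
  have int2: "integrable lborel (f p)" for p
  proof (cases "s < p \<and> p < t")
    case True
    then show ?thesis using si[of p] unfolding row[abs_def] set_integrable_def by auto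
  qed (simp add: row[abs_def] indicator_def)
  \<comment> \<open>Bounds the inner integral over \<open>r\<close> of the kernel times
    \<open>\<psi>\<close>, uniformly in \<open>p\<close>.\<close>
  let ?D = "C * (t - s) powr (1 - k) / (1 - k)"
  have le: "(\<integral>r. norm (f p r) \<partial>lborel) \<le> indicator {s<..<t} p * \<bar>\<phi> p\<bar> * ?D" for p
  proof (cases "s < p \<and> p < t")
    case True
    have "(\<integral>r. norm (f p r) \<partial>lborel) = \<bar>\<phi> p\<bar> * (LINT r:{p<..<t}|lborel. \<bar>\<psi> r * (r - p) powr (- k)\<bar>)"
      using True by (simp add: row abs_mult set_lebesgue_integral_def)
    also have "(LINT r:{p<..<t}|lborel. \<bar>\<psi> r * (r - p) powr (- k)\<bar>) \<le> (LINT r:{p<..<t}|lborel. C * (r - p) powr (- k))"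
      using True si[of p] ker[of p] bd
      by (intro set_integral_mono set_integrable_abs) (auto simp: abs_mult intro!: mult_right_mono)
    also have "\<dots> \<le> ?D"
      using True ker[of p] k C0 by (simp add: divide_right_mono mult_left_mono powr_mono2)
    finally show ?thesis using True by (simp add: mult_left_mono)
  next
    case False
    then have "f p r = 0" for r by (auto simp: f_def)
    then show ?thesis using False by auto
  qed
  have int1: "integrable lborel (\<lambda>p. \<integral>r. norm (f p r) \<partial>lborel)"
  proof (rule Bochner_Integration.integrable_bound)
    show "integrable lborel (\<lambda>p. indicator {s<..<t} p * \<bar>\<phi> p\<bar> * ?D)"
      using set_integrable_abs[OF phi] by (simp add: set_integrable_def)
    show "AE p in lborel. norm (\<integral>r. norm (f p r) \<partial>lborel) \<le> norm (indicator {s<..<t} p * \<bar>\<phi> p\<bar> * ?D)"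
      using order_trans[OF le abs_ge_self] by (intro AE_I2) simp
  qed measurable
  have "integrable (lborel \<Otimes>\<^sub>M lborel) (case_prod f)"
    by (rule lborel_pair.Fubini_integrable) (use int1 int2 in auto)
  from lborel_pair.Fubini_integral[OF this]
  have "(\<integral>r. (\<integral>p. f p r \<partial>lborel) \<partial>lborel) = (\<integral>p. (\<integral>r. f p r \<partial>lborel) \<partial>lborel)" .
  also have "(\<integral>r. (\<integral>p. f p r \<partial>lborel) \<partial>lborel) =
     (LINT r:{s<..<t}|lborel. (LINT p:{s<..<r}|lborel. \<phi> p * (r - p) powr (- k)) * \<psi> r)"
    by (simp only: col set_lebesgue_integral_def integral_mult_right_zero) (simp add: mult_ac)
  also have "(\<integral>p. (\<integral>r. f p r \<partial>lborel) \<partial>lborel) =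
     (LINT p:{s<..<t}|lborel. \<phi> p * (LINT r:{p<..<t}|lborel. \<psi> r * (r - p) powr (- k)))"
    by (simp only: row set_lebesgue_integral_def integral_mult_right_zero) (simp add: mult_ac)
  finally show ?thesis .
qed

text \<open>The substitution \<open>p = s + (q - s) x\<close> produces powers of
  \<open>q - s\<close> with exponents 1, \<open>- a\<close> and \<open>a - 1\<close>, which cancel;
  what is left is the Beta integral at \<open>(1 - a, a)\<close>, whose denominator is
  \<open>Gamma 1\<close>. Independence of \<open>s\<close> and \<open>q\<close> is what makes
  fractional integrals of orders \<open>a\<close> and \<open>1 - a\<close> compose to an ordinary
  one.\<close>

lemma Beta_kernel_integral:
  fixes a s q :: real
  assumes a: "0 < a" "a < 1" and "s < q"
  shows "(LINT p:{s<..<q}|lborel. (p - s) powr (- a) * (q - p) powr (- (1 - a))) = Gamma (1 - a) * Gamma a"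
proof -
  let ?g = "\<lambda>x::real. x powr (1 - a - 1) * (1 - x) powr (a - 1)"
  have hi: "(?g has_integral Beta (1 - a) a) {0..1}"
    using has_integral_Beta_real[of "1 - a" a] a by simp
  then have "?g absolutely_integrable_on {0..1}"
    by (intro nonnegative_absolutely_integrable_1) auto
  then have "set_integrable lborel {0<..<1} ?g"
    by (rule set_integrable_lborel_of_absolutely_integrable) measurable
  from set_borel_integral_eq_integral(2)[OF this] hi
  have B: "(LINT x:{0<..<1}|lborel. ?g x) = Gamma (1 - a) * Gamma a"
    by (simp add: has_integral_Icc_iff_Ioo integral_unique Beta_def)
  define f where "f p = indicator {s<..<q} p *\<^sub>R ((p - s) powr (- a) * (q - p) powr (- (1 - a)))" for p
  have eq: "(q - s) * f (s + (q - s) * x) = indicator {0<..<1} x *\<^sub>R ?g x" for x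
  proof (cases "x \<in> {0<..<1}")
    case True
    have "(q - s) * x < (q - s) * 1"
      using True \<open>s < q\<close> by (intro mult_strict_left_mono) auto
    moreover have "0 < (q - s) * x" using True \<open>s < q\<close> by simp
    ultimately have "s < s + (q - s) * x" "s + (q - s) * x < s + (q - s) * 1" by linarith+
    then have "s + (q - s) * x \<in> {s<..<q}" by simp
    moreover have "q - (s + (q - s) * x) = (q - s) * (1 - x)" by (simp add: algebra_simps)
    moreover have "(q - s) * ((q - s) powr (- a) * (q - s) powr (a - 1)) = 1"
    proof -
      have "(q - s) powr (- a) * (q - s) powr (a - 1) = (q - s) powr (- 1)"
        by (simp only: powr_add[symmetric]) simp
      then show ?thesis using \<open>s < q\<close> powr_minus[of "q - s" 1] by simp
    qed
    ultimately show ?thesis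
      using True \<open>s < q\<close> by (simp add: f_def powr_mult mult_ac)
  next
    case False
    then consider "x \<le> 0" | "1 \<le> x" by fastforce
    then have "s + (q - s) * x \<notin> {s<..<q}"
    proof cases
      case 1
      then have "(q - s) * x \<le> 0" using \<open>s < q\<close> by (simp add: mult_nonneg_nonpos)
      then show ?thesis by simp
    next
      case 2
      then have "(q - s) * 1 \<le> (q - s) * x" using \<open>s < q\<close> by (intro mult_left_mono) auto
      then show ?thesis by simp
    qed
    then show ?thesis using False by (simp add: f_def)
  qed
  have "(LINT p:{s<..<q}|lborel. (p - s) powr (- a) * (q - p) powr (- (1 - a))) = (\<integral>p. f p \<partial>lborel)"
    by (simp add: f_def set_lebesgue_integral_def)
  also have "\<dots> = (\<integral>x. (q - s) * f (s + (q - s) * x) \<partial>lborel)"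
    using lborel_integral_real_affine[of "q - s" f s] \<open>s < q\<close> by simp
  also have "\<dots> = Gamma (1 - a) * Gamma a"
    unfolding eq B[symmetric] by (simp add: set_lebesgue_integral_def)
  finally show ?thesis .
qed

text \<open>Up to Gamma factors, \<open>R\<close> is the right fractional integral of order
  \<open>a\<close> of \<open>w'\<close> and \<open>I\<close> the left one of order
  \<open>1 - a\<close> of \<open>z'\<close>. Fubini moves the kernel of \<open>I\<close> onto
  \<open>R\<close>, where the two kernels combine to the constant \<open>B\<close>; ordinary
  integration by parts then removes \<open>z'\<close>.\<close>

lemma frac_integral_C1:
  fixes z w z' w' :: "real \<Rightarrow> real"
  assumes derz: "\<And>x. (z has_real_derivative z' x) (at x)" and contz: "continuous_on UNIV z'"
    and derw: "\<And>x. (w has_real_derivative w' x) (at x)" and contw: "continuous_on UNIV w'"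
    and a: "0 < a" "a < 1" and st: "s < t"
  shows "frac_integral a s t z w = (LINT r:{s<..<t}|lborel. z r * w' r)"
proof -
  have cz: "continuous_on UNIV z" and cw: "continuous_on UNIV w"
    using derz derw by (meson DERIV_isCont continuous_at_imp_continuous_on)+
  have [measurable]: "z \<in> borel_measurable borel" "z' \<in> borel_measurable borel"
    "w \<in> borel_measurable borel" "w' \<in> borel_measurable borel"
    using cz cw contz contw by (auto intro: borel_measurable_continuous_onI)
  obtain L where L0: "0 \<le> L" and L: "\<And>q. q \<in> {s..t} \<Longrightarrow> \<bar>z' q\<bar> \<le> L"
    using C1_bounded_Icc[OF contz] by metis
  obtain N where N0: "0 \<le> N" and N: "\<And>q. q \<in> {s..t} \<Longrightarrow> \<bar>w' q\<bar> \<le> N"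
    using C1_bounded_Icc[OF contw] by metis
  define B where "B = Gamma (1 - a) * Gamma a"
  have B: "B > 0" using a by (simp add: B_def Gamma_real_pos)
  define R where "R r = (LINT q:{r<..<t}|lborel. w' q * (q - r) powr (- (1 - a)))" for r
  define I where "I r = (LINT p:{s<..<r}|lborel. z' p * (r - p) powr (- a))" for r
  have [measurable]: "R \<in> borel_measurable borel" "I \<in> borel_measurable borel"
    unfolding R_def[abs_def] I_def[abs_def] set_lebesgue_integral_def indicator_def greaterThanLessThan_iff
    by measurable
  have kerR: "set_integrable lborel {r<..<t} (\<lambda>q. (q - r) powr (- (1 - a)))"
     "(LINT q:{r<..<t}|lborel. (q - r) powr (- (1 - a))) = (t - r) powr a / a" if "r < t" for r
    using powr_kernel_right[of a r t] a that by simp_all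
  have Rb: "\<bar>R r\<bar> \<le> N * ((t - s) powr a / a)" if r: "r \<in> {s<..<t}" for r
  proof -
    have si: "set_integrable lborel {r<..<t} (\<lambda>q. w' q * (q - r) powr (- (1 - a)))"
      by (rule set_integrable_mult_kernel[where C=N]) (use kerR r N in auto)
    have "\<bar>R r\<bar> \<le> (LINT q:{r<..<t}|lborel. \<bar>w' q * (q - r) powr (- (1 - a))\<bar>)"
      unfolding R_def using set_integral_norm_bound[OF si] by simp
    also have "\<dots> \<le> (LINT q:{r<..<t}|lborel. N * (q - r) powr (- (1 - a)))"
      using N r kerR[of r] by (intro set_integral_mono set_integrable_abs si) (auto simp: abs_mult intro!: mult_right_mono)
    also have "\<dots> = N * ((t - r) powr a / a)" using kerR[of r] r by simp
    also have "\<dots> \<le> N * ((t - s) powr a / a)"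
      using r a N0 by (intro mult_left_mono divide_right_mono powr_mono2) auto
    finally show ?thesis .
  qed
  \<comment> \<open>Integrating out the middle variable turns the two kernels into \<open>B\<close>
    and leaves the plain increment of \<open>w\<close>. The case \<open>p = s\<close> serves the
    boundary term of the left derivative.\<close>
  have part: "(LINT r:{p<..<t}|lborel. R r * (r - p) powr (- a)) = B * (w t - w p)" if p: "s \<le> p" "p < t" for p
  proof -
    have "(LINT r:{p<..<t}|lborel. R r * (r - p) powr (- a)) =
        (LINT r:{p<..<t}|lborel. (r - p) powr (- a) * (LINT q:{r<..<t}|lborel. w' q * (q - r) powr (- (1 - a))))"
      by (simp add: R_def mult.commute)
    also have "\<dots> = (LINT q:{p<..<t}|lborel. (LINT r:{p<..<q}|lborel. (r - p) powr (- a) * (q - r) powr (- (1 - a))) * w' q)"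
      by (rule frac_kernel_Fubini[where C=N, symmetric])
        (use powr_kernel_right[of "1 - a" p t] a p N in auto)
    also have "\<dots> = (LINT q:{p<..<t}|lborel. B * w' q)"
      using Beta_kernel_integral[OF a, of p] unfolding B_def[symmetric]
      by (intro set_lebesgue_integral_cong) auto
    also have "\<dots> = B * (w t - w p)"
      using FTC_set_integral_interior[of p t w w'] p derw cw
        set_integrable_continuous[of p t w'] contw continuous_on_subset by force
    finally show ?thesis .
  qed
  have si1: "set_integrable lborel {s<..<t} (\<lambda>r. z s * (R r * (r - s) powr (- a)))"
    by (intro set_integrable_mult_right set_integrable_mult_kernel[where C="N * ((t - s) powr a / a)"])
      (use powr_kernel_right[of "1 - a" s t] a st Rb in auto)
  have Ib: "\<bar>I r\<bar> \<le> L * ((t - s) powr (1 - a) / (1 - a))" if r: "r \<in> {s<..<t}" for r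
  proof -
    have si: "set_integrable lborel {s<..<r} (\<lambda>p. z' p * (r - p) powr (- a))"
      by (rule set_integrable_mult_kernel[where C=L]) (use powr_kernel[of "1 - a" s r] a r L in auto)
    have "\<bar>I r\<bar> \<le> (LINT p:{s<..<r}|lborel. \<bar>z' p * (r - p) powr (- a)\<bar>)"
      unfolding I_def using set_integral_norm_bound[OF si] by simp
    also have "\<dots> \<le> (LINT p:{s<..<r}|lborel. L * (r - p) powr (- a))"
      using L r powr_kernel[of "1 - a" s r] a
      by (intro set_integral_mono set_integrable_abs si) (auto simp: abs_mult intro!: mult_right_mono)
    also have "\<dots> = L * ((r - s) powr (1 - a) / (1 - a))" using powr_kernel[of "1 - a" s r] a r by simp
    also have "\<dots> \<le> L * ((t - s) powr (1 - a) / (1 - a))"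
      using r a L0 by (intro mult_left_mono divide_right_mono powr_mono2) auto
    finally show ?thesis .
  qed
  have si2: "set_integrable lborel {s<..<t} (\<lambda>r. I r * R r)"
  proof (rule set_integrable_mult_kernel[where C="L * ((t - s) powr (1 - a) / (1 - a))"])
    have "set_integrable lborel {s<..<t} (\<lambda>r. R r * 1)"
      by (rule set_integrable_mult_kernel[where C="N * ((t - s) powr a / a)"])
        (use Rb set_integrable_continuous[of s t "\<lambda>_. 1"] in auto)
    then show "set_integrable lborel {s<..<t} R" by simp
  qed (use Ib in auto)
  have cz': "continuous_on {s..t} z'" using contz continuous_on_subset by blast
  have "(LINT r:{s<..<t}|lborel. I r * R r) =
      (LINT p:{s<..<t}|lborel. z' p * (LINT r:{p<..<t}|lborel. R r * (r - p) powr (- a)))"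
    unfolding I_def
    by (rule frac_kernel_Fubini[where C="N * ((t - s) powr a / a)"])
      (use a Rb set_integrable_continuous[OF cz'] in auto)
  also have "\<dots> = (LINT p:{s<..<t}|lborel. B * (z' p * (w t - w p)))"
    using part by (intro set_lebesgue_integral_cong) auto
  finally have I: "(LINT r:{s<..<t}|lborel. I r * R r) = B * (LINT p:{s<..<t}|lborel. z' p * (w t - w p))"
    by simp
  have c1: "set_integrable lborel {s<..<t} (\<lambda>p. z' p * (w t - w p))"
    and c2: "set_integrable lborel {s<..<t} (\<lambda>p. z p * w' p)"
    by (intro set_integrable_continuous continuous_intros; use cz cw contz contw continuous_on_subset in blast)+
  \<comment> \<open>Integration by parts with \<open>w t - w p\<close>, which vanishes at
    \<open>t\<close>; the term at \<open>s\<close> will cancel against the boundary term of the left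
    derivative.\<close>
  have "(LINT p:{s<..<t}|lborel. z' p * (w t - w p) - z p * w' p) = z t * (w t - w t) - z s * (w t - w s)"
  proof (rule FTC_set_integral_interior)
    show "continuous_on {s..t} (\<lambda>p. z p * (w t - w p))"
      by (intro continuous_intros; use cz cw continuous_on_subset in blast)
    show "((\<lambda>p. z p * (w t - w p)) has_real_derivative z' q * (w t - w q) - z q * w' q) (at q)" for q
      by (auto intro!: derivative_eq_intros derz derw)
  qed (use st set_integral_diff(1)[OF c1 c2] in auto)
  then have parts: "(LINT p:{s<..<t}|lborel. z' p * (w t - w p)) =
      (LINT p:{s<..<t}|lborel. z p * w' p) - z s * (w t - w s)"
    by (simp add: set_integral_diff(2)[OF c1 c2])
  have "(LINT r:{s<..<t}|lborel. frac_deriv_left a s z r * frac_deriv_right a t w r) =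
      (LINT r:{s<..<t}|lborel. (- 1 / B) * (z s * (R r * (r - s) powr (- a)) + I r * R r))"
    by (intro set_lebesgue_integral_cong)
      (auto simp: frac_deriv_left_C1[OF derz contz a] frac_deriv_right_C1[OF derw contw a]
         I_def[symmetric] R_def B_def divide_simps algebra_simps)
  also have "\<dots> = (- 1 / B) * (z s * (B * (w t - w s)) + (LINT r:{s<..<t}|lborel. I r * R r))"
    using part[of s] st by (subst set_integral_mult_right, subst set_integral_add(2)[OF si1 si2]) simp
  also have "\<dots> = - (LINT r:{s<..<t}|lborel. z r * w' r)"
    unfolding I parts using B by (simp add: field_simps)
  finally show ?thesis by (simp add: frac_integral_def)
qed

section \<open>Hoelder data by approximation with averages\<close>

lemma continuous_antiderivative:
  fixes z :: "real \<Rightarrow> real"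
  assumes "continuous_on UNIV z"
  obtains Z where "\<And>x. (Z has_real_derivative z x) (at x)"
proof -
  have "\<exists>F. \<forall>x::real. -\<infinity> < ereal x \<longrightarrow> ereal x < \<infinity> \<longrightarrow> (F has_vector_derivative z x) (at x)"
    by (rule einterval_antiderivative) (use assms in \<open>auto simp: continuous_on_eq_continuous_at\<close>)
  then show thesis using that by (auto simp: has_real_derivative_iff_has_vector_derivative)
qed

lemma Holder_continuous_on:
  fixes z :: "real \<Rightarrow> 'a::real_normed_vector"
  assumes "0 < b" "\<And>r q. r \<in> X \<Longrightarrow> q \<in> X \<Longrightarrow> norm (z r - z q) \<le> C * \<bar>r - q\<bar> powr b"
  shows "continuous_on X z"
  unfolding continuous_on_def
proof
  fix x assume x: "x \<in> X"
  have "((\<lambda>q. C * \<bar>q - x\<bar> powr b) \<longlongrightarrow> C * \<bar>x - x\<bar> powr b) (at x within X)"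
    using assms(1) by (intro tendsto_intros) auto
  then have "((\<lambda>q. C * \<bar>q - x\<bar> powr b) \<longlongrightarrow> 0) (at x within X)" by simp
  then have "((\<lambda>q. z q - z x) \<longlongrightarrow> 0) (at x within X)"
    by (rule Lim_null_comparison[rotated]) (use assms(2) x in \<open>auto simp: eventually_at_filter\<close>)
  then show "(z \<longlongrightarrow> z x) (at x within X)" by (simp add: LIM_zero_iff)
qed

lemmas Holder_continuous = Holder_continuous_on[where X=UNIV, simplified]

text \<open>The averages \<open>n \<integral>\<^bsub>r\<^esub>\<^bsup>r+1/n\<^esup> z\<close> are \<open>C\<^sup>1\<close> and inherit every modulus of continuity of \<open>z\<close>.\<close>

lemma Holder_C1_approximation:
  fixes z :: "real \<Rightarrow> real"
  assumes b: "0 < b" and hol: "\<And>r q. \<bar>z r - z q\<bar> \<le> C * \<bar>r - q\<bar> powr b"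
  obtains zn zn' :: "nat \<Rightarrow> real \<Rightarrow> real" where
    "\<And>n x. (zn n has_real_derivative zn' n x) (at x)" "\<And>n. continuous_on UNIV (zn' n)"
    "\<And>n r q. \<bar>zn n r - zn n q\<bar> \<le> C * \<bar>r - q\<bar> powr b"
    "\<And>r. (\<lambda>n. zn n r) \<longlonglongrightarrow> z r" "\<And>n r. \<exists>x. zn n r = z x"
proof -
  have cont: "continuous_on UNIV z" using Holder_continuous[OF b, of z C] hol by simp
  obtain Z where Z: "\<And>x. (Z has_real_derivative z x) (at x)"
    using continuous_antiderivative[OF cont] by metis
  define \<delta> where "\<delta> n = 1 / real (Suc n)" for n
  have d: "0 < \<delta> n" for n by (simp add: \<delta>_def)
  define zn where "zn n r = (Z (r + \<delta> n) - Z r) / \<delta> n" for n r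
  define zn' where "zn' n r = (z (r + \<delta> n) - z r) / \<delta> n" for n r
  have ZD: "((\<lambda>x. Z (x + c)) has_real_derivative z (x + c)) (at x)"
    and ZD': "((\<lambda>x. Z (c + x)) has_real_derivative z (c + x)) (at x)" for c x
    using DERIV_shift[of Z "z (x + c)" x c] Z by (simp_all add: add.commute)
  \<comment> \<open>An average is a value of \<open>z\<close> at a nearby point, so it inherits the
    bounds of \<open>z\<close> and converges by continuity.\<close>
  have mv: "\<exists>x. r < x \<and> x < r + \<delta> n \<and> zn n r = z x" for n r
    using MVT2[of r "r + \<delta> n" Z z] Z d[of n] by (auto simp: zn_def)
  show thesis
  proof (rule that[of zn zn'])
    show "(zn n has_real_derivative zn' n x) (at x)" for n x
      unfolding zn_def zn'_def by (intro DERIV_cdivide DERIV_diff ZD Z)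
    show "continuous_on UNIV (zn' n)" for n
      unfolding zn'_def using d[of n]
      by (intro continuous_intros continuous_on_compose2[OF cont] cont) auto
    show "\<exists>x. zn n r = z x" for n r using mv by blast
    show "\<bar>zn n r - zn n q\<bar> \<le> C * \<bar>r - q\<bar> powr b" for n r q
    proof -
      \<comment> \<open>The mean value theorem for the difference of the two averages yields one
        common shift \<open>x\<close>, so the Hoelder constant is preserved exactly.\<close>
      have "\<exists>x. 0 < x \<and> x < \<delta> n \<and>
          (Z (r + \<delta> n) - Z (q + \<delta> n)) - (Z (r + 0) - Z (q + 0)) = (\<delta> n - 0) * (z (r + x) - z (q + x))"
        by (rule MVT2[of 0 "\<delta> n" "\<lambda>x. Z (r + x) - Z (q + x)" "\<lambda>x. z (r + x) - z (q + x)"])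
          (use d in \<open>auto intro!: DERIV_diff ZD'\<close>)
      then obtain x where "(Z (r + \<delta> n) - Z (q + \<delta> n)) - (Z r - Z q) = \<delta> n * (z (r + x) - z (q + x))"
        by auto
      then have "zn n r - zn n q = z (r + x) - z (q + x)"
        unfolding zn_def using d[of n] by (simp add: diff_divide_distrib[symmetric] field_simps)
      then show ?thesis using hol[of "r + x" "q + x"] by simp
    qed
    show "(\<lambda>n. zn n r) \<longlonglongrightarrow> z r" for r
    proof -
      obtain y where y: "\<And>n. r < y n \<and> y n < r + \<delta> n \<and> zn n r = z (y n)"
        using mv[of r] by metis
      have "\<delta> \<longlonglongrightarrow> 0" unfolding \<delta>_def by (rule LIMSEQ_Suc[OF lim_1_over_n])
      then have "(\<lambda>n. r + \<delta> n) \<longlonglongrightarrow> r + 0" by (intro tendsto_intros)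
      then have "y \<longlonglongrightarrow> r"
        by (intro tendsto_sandwich[of "\<lambda>_. r" y sequentially "\<lambda>n. r + \<delta> n"])
          (use y in \<open>auto intro!: always_eventually less_imp_le\<close>)
      then have "(\<lambda>n. z (y n)) \<longlonglongrightarrow> z r"
        by (rule continuous_on_tendsto_compose[OF cont]) auto
      then show ?thesis using y by simp
    qed
  qed
qed

lemma frac_integral_bound:
  fixes z w :: "real \<Rightarrow> real"
  assumes ab: "0 < a" "a < b" "b < 1" "1 - a < b'" and st: "s \<le> t"
    and mz: "z \<in> borel_measurable borel" and mw: "w \<in> borel_measurable borel"
    and hz: "\<And>r q. r \<in> {s..t} \<Longrightarrow> q \<in> {s..t} \<Longrightarrow> \<bar>z r - z q\<bar> \<le> C * \<bar>r - q\<bar> powr b"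
    and bz: "\<And>r. r \<in> {s..t} \<Longrightarrow> \<bar>z r\<bar> \<le> C0"
    and hw: "\<And>r q. r \<in> {s..t} \<Longrightarrow> q \<in> {s..t} \<Longrightarrow> \<bar>w r - w q\<bar> \<le> C' * \<bar>r - q\<bar> powr b'"
  shows "\<bar>frac_integral a s t z w\<bar> \<le>
    young_bound a b b' / (1 - a) * C' * (C0 * (t - s) powr b' + C * (t - s) powr (b + b'))"
  using frac_integral_L2_bound[OF ab st, of "{()}" "\<lambda>_. z" "\<lambda>_. w" C C0 C'] assms by simp

text \<open>Splitting the inner and outer integrals requires each part to converge, which is where
  the Hoelder bounds enter.\<close>

lemma frac_integral_diff:
  fixes z1 z2 w :: "real \<Rightarrow> real"
  assumes ab: "0 < a" "a < b" "b < 1" "1 - a < b'" and st: "s \<le> t"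
    and mz[measurable]: "z1 \<in> borel_measurable borel" "z2 \<in> borel_measurable borel"
    and mw[measurable]: "w \<in> borel_measurable borel"
    and hz1: "\<And>r q. r \<in> {s..t} \<Longrightarrow> q \<in> {s..t} \<Longrightarrow> \<bar>z1 r - z1 q\<bar> \<le> C * \<bar>r - q\<bar> powr b"
    and bz1: "\<And>r. r \<in> {s..t} \<Longrightarrow> \<bar>z1 r\<bar> \<le> C0"
    and hz2: "\<And>r q. r \<in> {s..t} \<Longrightarrow> q \<in> {s..t} \<Longrightarrow> \<bar>z2 r - z2 q\<bar> \<le> C * \<bar>r - q\<bar> powr b"
    and bz2: "\<And>r. r \<in> {s..t} \<Longrightarrow> \<bar>z2 r\<bar> \<le> C0"
    and hw: "\<And>r q. r \<in> {s..t} \<Longrightarrow> q \<in> {s..t} \<Longrightarrow> \<bar>w r - w q\<bar> \<le> C' * \<bar>r - q\<bar> powr b'"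
  shows "frac_integral a s t (\<lambda>r. z1 r - z2 r) w = frac_integral a s t z1 w - frac_integral a s t z2 w"
proof (cases "s = t")
  case True
  then show ?thesis by (simp add: frac_integral_def set_lebesgue_integral_def)
next
  case False
  with st have st: "s < t" by simp
  have left: "frac_deriv_left a s (\<lambda>r. z1 r - z2 r) r = frac_deriv_left a s z1 r - frac_deriv_left a s z2 r"
    if r: "r \<in> {s<..<t}" for r
  proof -
    have i: "set_integrable lborel {s<..<r} (\<lambda>q. (z1 r - z1 q) / (r - q) powr (1 + a))"
      "set_integrable lborel {s<..<r} (\<lambda>q. (z2 r - z2 q) / (r - q) powr (1 + a))"
      using r ab by (auto intro!: difference_quotient_integrable[where b=b and C=C] order_trans[OF hz1] order_trans[OF hz2])
    define I1 where "I1 = (LINT q:{s<..<r}|lborel. (z1 r - z1 q) / (r - q) powr (1 + a))"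
    define I2 where "I2 = (LINT q:{s<..<r}|lborel. (z2 r - z2 q) / (r - q) powr (1 + a))"
    have eq: "(LINT q:{s<..<r}|lborel. (z1 r - z2 r - (z1 q - z2 q)) / (r - q) powr (1 + a)) = I1 - I2"
      unfolding I1_def I2_def set_integral_diff(2)[OF i, symmetric]
      by (intro set_lebesgue_integral_cong) (auto simp: diff_divide_distrib[symmetric] algebra_simps)
    show ?thesis
      unfolding frac_deriv_left_def eq I1_def[symmetric] I2_def[symmetric]
      by (simp add: algebra_simps diff_divide_distrib add_divide_distrib)
  qed
  have i1: "set_integrable lborel {s<..<t} (\<lambda>r. frac_deriv_left a s z1 r * frac_deriv_right a t w r)"
    by (rule frac_deriv_product_integrable[OF ab st mz(1) mw hz1 bz1 hw])
  have i2: "set_integrable lborel {s<..<t} (\<lambda>r. frac_deriv_left a s z2 r * frac_deriv_right a t w r)"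
    by (rule frac_deriv_product_integrable[OF ab st mz(2) mw hz2 bz2 hw])
  have "(LINT r:{s<..<t}|lborel. frac_deriv_left a s (\<lambda>r. z1 r - z2 r) r * frac_deriv_right a t w r) =
    (LINT r:{s<..<t}|lborel. frac_deriv_left a s z1 r * frac_deriv_right a t w r -
       frac_deriv_left a s z2 r * frac_deriv_right a t w r)"
    by (intro set_lebesgue_integral_cong) (auto simp: left algebra_simps)
  then show ?thesis
    unfolding frac_integral_def by (simp add: set_integral_diff(2)[OF i1 i2])
qed

context
  fixes a b b' C C0 C' :: real and z w :: "real \<Rightarrow> real"
  assumes ab: "0 < a" "a < b" "b < 1" "1 - a < b'"
    and hz: "\<And>r q. \<bar>z r - z q\<bar> \<le> C * \<bar>r - q\<bar> powr b"
    and bz: "\<And>r. \<bar>z r\<bar> \<le> C0"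
    and hw: "\<And>r q. \<bar>w r - w q\<bar> \<le> C' * \<bar>r - q\<bar> powr b'"
begin

lemma frac_integral_approximation:
  obtains zn zn' wn wn' :: "nat \<Rightarrow> real \<Rightarrow> real" where
    "\<And>n x. (zn n has_real_derivative zn' n x) (at x)" "\<And>n. continuous_on UNIV (zn' n)"
    "\<And>n x. (wn n has_real_derivative wn' n x) (at x)" "\<And>n. continuous_on UNIV (wn' n)"
    "\<And>n r q. \<bar>zn n r - zn n q\<bar> \<le> C * \<bar>r - q\<bar> powr b" "\<And>n r. \<bar>zn n r\<bar> \<le> C0"
    "\<And>n r q. \<bar>wn n r - wn n q\<bar> \<le> C' * \<bar>r - q\<bar> powr b'"
    "\<And>r. (\<lambda>n. zn n r) \<longlonglongrightarrow> z r" "\<And>r. (\<lambda>n. wn n r) \<longlonglongrightarrow> w r"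
proof -
  have bb: "0 < b" "0 < b'" using ab by auto
  obtain zn zn' where zn: "\<And>n x. (zn n has_real_derivative zn' n x) (at x)" "\<And>n. continuous_on UNIV (zn' n)"
    "\<And>n r q. \<bar>zn n r - zn n q\<bar> \<le> C * \<bar>r - q\<bar> powr b"
    "\<And>r. (\<lambda>n. zn n r) \<longlonglongrightarrow> z r" "\<And>n r. \<exists>x. zn n r = z x"
    by (rule Holder_C1_approximation[OF bb(1) hz]) (rule that)
  obtain wn wn' where wn: "\<And>n x. (wn n has_real_derivative wn' n x) (at x)" "\<And>n. continuous_on UNIV (wn' n)"
    "\<And>n r q. \<bar>wn n r - wn n q\<bar> \<le> C' * \<bar>r - q\<bar> powr b'"
    "\<And>r. (\<lambda>n. wn n r) \<longlonglongrightarrow> w r"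
    by (rule Holder_C1_approximation[OF bb(2) hw]) (rule that)
  have "\<bar>zn n r\<bar> \<le> C0" for n r using zn(5)[of n r] bz by auto
  then show thesis by (rule that[OF zn(1,2) wn(1,2) zn(3) _ wn(3) zn(4) wn(4)])
qed

lemma Holder_measurable: "z \<in> borel_measurable borel" "w \<in> borel_measurable borel"
  using Holder_continuous[of b z C] Holder_continuous[of b' w C'] hz hw ab
  by (auto intro!: borel_measurable_continuous_onI)

text \<open>One sequence of primitives of \<open>zn wn'\<close> serves all \<open>s\<close>,
  \<open>t\<close> and \<open>a\<close>. Its increments are additive and do not involve
  \<open>a\<close>, so additivity and order independence of the limit both follow from uniqueness of
  limits.\<close>

lemma frac_integral_limit:
  obtains Y :: "nat \<Rightarrow> real \<Rightarrow> real" where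
    "\<And>s t a. 0 < a \<Longrightarrow> a < b \<Longrightarrow> 1 - a < b' \<Longrightarrow> s \<le> t \<Longrightarrow>
       (\<lambda>n. Y n t - Y n s) \<longlonglongrightarrow> frac_integral a s t z w"
proof -
  obtain zn zn' wn wn' where A: "\<And>n x. (zn n has_real_derivative zn' n x) (at x)" "\<And>n. continuous_on UNIV (zn' n)"
    "\<And>n x. (wn n has_real_derivative wn' n x) (at x)" "\<And>n. continuous_on UNIV (wn' n)"
    "\<And>n r q. \<bar>zn n r - zn n q\<bar> \<le> C * \<bar>r - q\<bar> powr b" "\<And>n r. \<bar>zn n r\<bar> \<le> C0"
    "\<And>n r q. \<bar>wn n r - wn n q\<bar> \<le> C' * \<bar>r - q\<bar> powr b'"
    "\<And>r. (\<lambda>n. zn n r) \<longlonglongrightarrow> z r" "\<And>r. (\<lambda>n. wn n r) \<longlonglongrightarrow> w r"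
    by (rule frac_integral_approximation) (rule that)
  have cz: "continuous_on UNIV (zn n)" and cw: "continuous_on UNIV (wn n)" for n
    using A(1,3) by (meson DERIV_isCont continuous_at_imp_continuous_on)+
  have "\<exists>Y. \<forall>x. (Y has_real_derivative zn n x * wn' n x) (at x)" for n
    using continuous_antiderivative[OF continuous_on_mult[OF cz[of n] A(4)[of n]]] by metis
  then obtain Y where Y: "\<And>n x. (Y n has_real_derivative zn n x * wn' n x) (at x)" by metis
  have cY: "continuous_on UNIV (Y n)" for n
    using Y by (meson DERIV_isCont continuous_at_imp_continuous_on)
  note sub = continuous_on_subset[OF _ subset_UNIV]
  show thesis
  proof (rule that[of Y])
    fix s t a :: real assume a: "0 < a" "a < b" "1 - a < b'" and st: "s \<le> t"
    have "Y n t - Y n s = frac_integral a s t (zn n) (wn n)" for n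
    proof (cases "s = t")
      case True
      then show ?thesis by (simp add: frac_integral_def set_lebesgue_integral_def)
    next
      case False
      have "(LINT r:{s<..<t}|lborel. zn n r * wn' n r) = Y n t - Y n s"
        by (rule FTC_set_integral_interior)
          (use st Y in \<open>auto intro!: set_integrable_continuous continuous_on_mult
             sub[OF cz] sub[OF A(4)] sub[OF cY]\<close>)
      then show ?thesis
        using frac_integral_C1[OF A(1,2) A(3,4), of a s t] False st a ab by simp
    qed
    moreover have "(\<lambda>n. frac_integral a s t (zn n) (wn n)) \<longlonglongrightarrow> frac_integral a s t z w"
      by (rule frac_integral_tendsto[where b=b and b'=b' and C=C and C'=C' and C0=C0])
        (use a ab st A Holder_measurable cz cw in \<open>auto intro: borel_measurable_continuous_onI\<close>)
    ultimately show "(\<lambda>n. Y n t - Y n s) \<longlonglongrightarrow> frac_integral a s t z w" by simp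
  qed
qed

lemma frac_integral_order_independent:
  assumes "0 < a'" "a' < b" "1 - a' < b'" "s \<le> t"
  shows "frac_integral a' s t z w = frac_integral a s t z w"
proof -
  obtain Y where "\<And>s t a. 0 < a \<Longrightarrow> a < b \<Longrightarrow> 1 - a < b' \<Longrightarrow> s \<le> t \<Longrightarrow>
       (\<lambda>n. Y n t - Y n s) \<longlonglongrightarrow> frac_integral a s t z w"
    by (rule frac_integral_limit) (rule that)
  then show ?thesis using assms ab by (intro LIMSEQ_unique[of "\<lambda>n. Y n t - Y n s"]) auto
qed

lemma frac_integral_combine:
  assumes "r \<le> s" "s \<le> t"
  shows "frac_integral a r s z w + frac_integral a s t z w = frac_integral a r t z w"
proof -
  obtain Y where Y: "\<And>s t a. 0 < a \<Longrightarrow> a < b \<Longrightarrow> 1 - a < b' \<Longrightarrow> s \<le> t \<Longrightarrow>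
       (\<lambda>n. Y n t - Y n s) \<longlonglongrightarrow> frac_integral a s t z w"
    by (rule frac_integral_limit) (rule that)
  have "(\<lambda>n. (Y n s - Y n r) + (Y n t - Y n s)) \<longlonglongrightarrow> frac_integral a r s z w + frac_integral a s t z w"
    using assms ab by (intro tendsto_add Y) auto
  moreover have "(\<lambda>n. Y n t - Y n r) \<longlonglongrightarrow> frac_integral a r t z w"
    using assms ab by (intro Y) auto
  ultimately show ?thesis by (simp add: LIMSEQ_unique)
qed

text \<open>For the smooth approximations this is the product rule for \<open>\<phi> r\<close> times
  \<open>H n r - H n s\<close>. The left side converges because the products
  \<open>\<phi> zn\<close> again have uniform Hoelder constants, the right side by dominated
  convergence.\<close>

lemma frac_integral_mult_C1:
  assumes der: "\<And>x. (\<phi> has_real_derivative \<phi>' x) (at x)" and cont: "continuous_on UNIV \<phi>'"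
    and st: "s \<le> t"
  shows "frac_integral a s t (\<lambda>r. \<phi> r * z r) w =
    \<phi> t * frac_integral a s t z w - (LINT r:{s<..<t}|lborel. \<phi>' r * frac_integral a s r z w)"
proof (cases "s = t")
  case True
  then show ?thesis by (simp add: frac_integral_def set_lebesgue_integral_def)
next
  case False
  with st have st: "s < t" by simp
  obtain zn zn' wn wn' where A: "\<And>n x. (zn n has_real_derivative zn' n x) (at x)" "\<And>n. continuous_on UNIV (zn' n)"
    "\<And>n x. (wn n has_real_derivative wn' n x) (at x)" "\<And>n. continuous_on UNIV (wn' n)"
    "\<And>n r q. \<bar>zn n r - zn n q\<bar> \<le> C * \<bar>r - q\<bar> powr b" "\<And>n r. \<bar>zn n r\<bar> \<le> C0"
    "\<And>n r q. \<bar>wn n r - wn n q\<bar> \<le> C' * \<bar>r - q\<bar> powr b'"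
    "\<And>r. (\<lambda>n. zn n r) \<longlonglongrightarrow> z r" "\<And>r. (\<lambda>n. wn n r) \<longlonglongrightarrow> w r"
    by (rule frac_integral_approximation) (rule that)
  have cz: "continuous_on UNIV (zn n)" and cw: "continuous_on UNIV (wn n)" for n
    using A(1,3) by (meson DERIV_isCont continuous_at_imp_continuous_on)+
  have cp: "continuous_on UNIV \<phi>"
    using der by (meson DERIV_isCont continuous_at_imp_continuous_on)
  note sub = continuous_on_subset[OF _ subset_UNIV]
  have [measurable]: "\<phi> \<in> borel_measurable borel" "\<phi>' \<in> borel_measurable borel"
    "\<And>n. zn n \<in> borel_measurable borel" "\<And>n. wn n \<in> borel_measurable borel"
    using cp cont cz cw by (auto intro: borel_measurable_continuous_onI)
  note [measurable] = Holder_measurable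
  have nn: "0 \<le> C" "0 \<le> C0" "0 \<le> C'"
    using order_trans[OF abs_ge_zero hz[of 0 1]] order_trans[OF abs_ge_zero bz]
      order_trans[OF abs_ge_zero hw[of 0 1]] by auto
  have "\<exists>Y. \<forall>x. (Y has_real_derivative zn n x * wn' n x) (at x)" for n
    using continuous_antiderivative[OF continuous_on_mult[OF cz[of n] A(4)[of n]]] by metis
  then obtain H where H: "\<And>n x. (H n has_real_derivative zn n x * wn' n x) (at x)" by metis
  have cH: "continuous_on UNIV (H n)" for n
    using H by (meson DERIV_isCont continuous_at_imp_continuous_on)
  have [measurable]: "H n \<in> borel_measurable borel" for n
    using cH by (auto intro: borel_measurable_continuous_onI)
  have J: "frac_integral a s r (zn n) (wn n) = H n r - H n s" if "s \<le> r" for n r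
  proof (cases "s = r")
    case True
    then show ?thesis by (simp add: frac_integral_def set_lebesgue_integral_def)
  next
    case False
    have "(LINT r:{s<..<r}|lborel. zn n r * wn' n r) = H n r - H n s"
      by (rule FTC_set_integral_interior)
        (use that H in \<open>auto intro!: set_integrable_continuous continuous_on_mult sub[OF cz] sub[OF A(4)] sub[OF cH]\<close>)
    then show ?thesis
      using frac_integral_C1[OF A(1,2) A(3,4), of a s r] False that ab by simp
  qed
  have limJ: "(\<lambda>n. H n r - H n s) \<longlonglongrightarrow> frac_integral a s r z w" if "s \<le> r" for r
  proof -
    have "(\<lambda>n. frac_integral a s r (zn n) (wn n)) \<longlonglongrightarrow> frac_integral a s r z w"
      by (rule frac_integral_tendsto[where b=b and b'=b' and C=C and C'=C' and C0=C0])
        (use that ab A in auto)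
    then show ?thesis using J[OF that] by simp
  qed
  obtain N where N0: "0 \<le> N" and N: "\<And>q. q \<in> {s..t} \<Longrightarrow> \<bar>\<phi>' q\<bar> \<le> N"
    using C1_bounded_Icc[OF cont] by metis
  obtain L where L0: "0 \<le> L" and L: "\<And>q. q \<in> {s..t} \<Longrightarrow> \<bar>\<phi> q\<bar> \<le> L"
    using C1_bounded_Icc[OF cp] by metis
  \<comment> \<open>Hoelder constant of a product: \<open>L\<close> bounds \<open>\<phi>\<close>,
    \<open>N\<close> bounds its derivative, and \<open>(t - s) powr (1 - b)\<close> turns a
    Lipschitz bound into one of order \<open>b\<close> on \<open>{s..t}\<close>.\<close>
  let ?C2 = "L * C + C0 * (N * (t - s) powr (1 - b))"
  have eq: "frac_integral a s t (\<lambda>r. \<phi> r * zn n r) (wn n) =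
      \<phi> t * (H n t - H n s) - (LINT r:{s<..<t}|lborel. \<phi>' r * (H n r - H n s))" for n
  proof -
    have i1: "set_integrable lborel {s<..<t} (\<lambda>r. \<phi> r * zn n r * wn' n r)"
      and i2: "set_integrable lborel {s<..<t} (\<lambda>r. \<phi>' r * (H n r - H n s))"
      by (intro set_integrable_continuous continuous_intros sub[OF cp] sub[OF cz] sub[OF A(4)] sub[OF cont] sub[OF cH])+
    have "frac_integral a s t (\<lambda>r. \<phi> r * zn n r) (wn n) = (LINT r:{s<..<t}|lborel. \<phi> r * zn n r * wn' n r)"
    proof (rule frac_integral_C1[OF _ _ A(3,4)])
      show "((\<lambda>r. \<phi> r * zn n r) has_real_derivative \<phi>' x * zn n x + \<phi> x * zn' n x) (at x)" for x
        using DERIV_mult[OF der[of x] A(1)[of n x]] by (simp add: algebra_simps)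
      show "continuous_on UNIV (\<lambda>x. \<phi>' x * zn n x + \<phi> x * zn' n x)"
        by (intro continuous_intros cp cont cz A)
    qed (use ab st in auto)
    moreover have "(LINT r:{s<..<t}|lborel. \<phi> r * zn n r * wn' n r + \<phi>' r * (H n r - H n s)) =
        \<phi> t * (H n t - H n s) - \<phi> s * (H n s - H n s)"
    proof (rule FTC_set_integral_interior)
      show "continuous_on {s..t} (\<lambda>r. \<phi> r * (H n r - H n s))"
        by (intro continuous_intros sub[OF cp] sub[OF cH])
      show "((\<lambda>r. \<phi> r * (H n r - H n s)) has_real_derivative \<phi> q * zn n q * wn' n q + \<phi>' q * (H n q - H n s)) (at q)" for q
        by (auto intro!: derivative_eq_intros der H)
    qed (use st set_integral_add(1)[OF i1 i2] in auto)
    ultimately show ?thesis by (simp add: set_integral_add(2)[OF i1 i2])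
  qed
  have "(\<lambda>n. frac_integral a s t (\<lambda>r. \<phi> r * zn n r) (wn n)) \<longlonglongrightarrow> frac_integral a s t (\<lambda>r. \<phi> r * z r) w"
  proof (rule frac_integral_tendsto[where b=b and b'=b' and C="?C2" and C'=C' and C0="L * C0"])
    fix n r q assume r: "r \<in> {s..t}" and q: "q \<in> {s..t}"
    have le: "\<bar>r - q\<bar> \<le> (t - s) powr (1 - b) * \<bar>r - q\<bar> powr b"
    proof (cases "r = q")
      case False
      have "\<bar>r - q\<bar> = \<bar>r - q\<bar> powr (1 - b) * \<bar>r - q\<bar> powr b"
        using False by (simp add: powr_add[symmetric])
      also have "\<dots> \<le> (t - s) powr (1 - b) * \<bar>r - q\<bar> powr b"
        using r q ab by (intro mult_right_mono powr_mono2) auto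
      finally show ?thesis .
    qed simp
    have "\<bar>\<phi> r * zn n r - \<phi> q * zn n q\<bar> = \<bar>\<phi> r * (zn n r - zn n q) + zn n q * (\<phi> r - \<phi> q)\<bar>"
      by (simp add: algebra_simps)
    also have "\<dots> \<le> \<bar>\<phi> r\<bar> * \<bar>zn n r - zn n q\<bar> + \<bar>zn n q\<bar> * \<bar>\<phi> r - \<phi> q\<bar>"
      by (rule order_trans[OF abs_triangle_ineq]) (simp add: abs_mult)
    also have "\<dots> \<le> L * (C * \<bar>r - q\<bar> powr b) + C0 * (N * ((t - s) powr (1 - b) * \<bar>r - q\<bar> powr b))"
    proof (intro add_mono mult_mono)
      have "\<bar>\<phi> r - \<phi> q\<bar> \<le> N * \<bar>r - q\<bar>" using C1_Lipschitz_Icc[OF der N r q] by blast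
      also have "\<dots> \<le> N * ((t - s) powr (1 - b) * \<bar>r - q\<bar> powr b)" by (rule mult_left_mono[OF le N0])
      finally show "\<bar>\<phi> r - \<phi> q\<bar> \<le> N * ((t - s) powr (1 - b) * \<bar>r - q\<bar> powr b)" .
    qed (use L[OF r] A L0 nn in auto)
    finally show "\<bar>\<phi> r * zn n r - \<phi> q * zn n q\<bar> \<le> ?C2 * \<bar>r - q\<bar> powr b"
      by (simp add: algebra_simps)
  next
    show "\<bar>\<phi> r * zn n r\<bar> \<le> L * C0" if "r \<in> {s..t}" for n r
      unfolding abs_mult using L[OF that] A(6)[of n r] L0 by (intro mult_mono) auto
  qed (use ab st A in \<open>auto intro!: tendsto_intros\<close>)
  moreover have "(\<lambda>n. \<phi> t * (H n t - H n s) - (LINT r:{s<..<t}|lborel. \<phi>' r * (H n r - H n s)))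
      \<longlonglongrightarrow> \<phi> t * frac_integral a s t z w - (LINT r:{s<..<t}|lborel. \<phi>' r * frac_integral a s r z w)"
  proof (intro tendsto_diff tendsto_mult tendsto_const limJ)
    \<comment> \<open>The Young estimate for the approximations holds uniformly in \<open>n\<close>
      and supplies the dominating constant.\<close>
    define D where "D = young_bound a b b' / (1 - a) * C' * (C0 * (t - s) powr b' + C * (t - s) powr (b + b'))"
    have lim: "(\<lambda>n. indicator {s<..<t} r *\<^sub>R (\<phi>' r * (H n r - H n s))) \<longlonglongrightarrow>
        indicator {s<..<t} r *\<^sub>R (\<phi>' r * frac_integral a s r z w)" for r
      by (cases "r \<in> {s<..<t}") (auto intro!: tendsto_intros limJ)
    have bd: "\<bar>H n r - H n s\<bar> \<le> D" if r: "r \<in> {s<..<t}" for n r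
    proof -
      have "\<bar>frac_integral a s r (zn n) (wn n)\<bar> \<le>
          young_bound a b b' / (1 - a) * C' * (C0 * (r - s) powr b' + C * (r - s) powr (b + b'))"
        by (rule frac_integral_bound) (use ab r A in auto)
      also have "\<dots> \<le> D"
        unfolding D_def using r ab nn young_bound_nonneg[of a b b']
        by (intro mult_left_mono add_mono powr_mono2 mult_nonneg_nonneg divide_nonneg_pos) auto
      finally show ?thesis using J[of r n] r by simp
    qed
    show "(\<lambda>n. LINT r:{s<..<t}|lborel. \<phi>' r * (H n r - H n s)) \<longlonglongrightarrow>
        (LINT r:{s<..<t}|lborel. \<phi>' r * frac_integral a s r z w)"
      unfolding set_lebesgue_integral_def
    proof (rule integral_dominated_convergence)
      \<comment> \<open>Measurability in the upper limit is inherited from the continuous primitives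
        \<open>H n\<close> by pointwise limits.\<close>
      show "(\<lambda>r. indicator {s<..<t} r *\<^sub>R (\<phi>' r * frac_integral a s r z w)) \<in> borel_measurable lborel"
        by (rule borel_measurable_LIMSEQ_real[OF lim]) measurable
      show "integrable lborel (\<lambda>r. indicator {s<..<t} r *\<^sub>R (N * D))"
        using set_integrable_continuous[of s t "\<lambda>_. N * D"] unfolding set_integrable_def by simp
      show "AE r in lborel. norm (indicator {s<..<t} r *\<^sub>R (\<phi>' r * (H n r - H n s)))
          \<le> indicator {s<..<t} r *\<^sub>R (N * D)" for n
        using N N0 bd by (intro AE_I2) (auto simp: indicator_def abs_mult intro!: mult_mono)
    qed (use lim in auto)
  qed (use st in auto)
  ultimately show ?thesis using LIMSEQ_unique unfolding eq by blast
qed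

end

section \<open>The integral of a square summable path against a square summable path\<close>

lemma norm_ell2_le_L2_set:
  assumes "\<And>F. finite F \<Longrightarrow> L2_set (coord x) F \<le> B"
  shows "norm x \<le> B"
proof -
  have B: "0 \<le> B" using assms[of "{}"] by simp
  have "(norm x)\<^sup>2 \<le> B\<^sup>2"
    unfolding norm_ell2_square
  proof (rule infsum_le_finite_sums[OF summable_coord_square])
    fix F :: "int set" assume "finite F"
    from power_mono[OF assms[OF this], of 2]
    show "(\<Sum>i\<in>F. (coord x i)\<^sup>2) \<le> B\<^sup>2" by (simp add: L2_set_def sum_nonneg)
  qed
  then show ?thesis using B by (rule power2_le_imp_le)
qed

lemma L2_set_coord_le: "finite F \<Longrightarrow> L2_set (coord x) F \<le> norm x"
  unfolding L2_set_def using sum_coord_square_le[of F x] by (simp add: real_le_lsqrt)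

lemma L2_set_coord_diff_le: "finite F \<Longrightarrow> L2_set (\<lambda>i. coord x i - coord y i) F \<le> norm (x - y)"
  using L2_set_coord_le[of F "x - y"] by (simp add: L2_set_def)

text \<open>Coordinatewise domination passes to norms by Minkowski over finite sets; estimates of
  superposition operators are reduced in this way to their scalar components.\<close>

lemma norm_ell2_le_combination:
  assumes "0 \<le> c" "0 \<le> d" and le: "\<And>i. \<bar>coord x i\<bar> \<le> c * \<bar>coord y i\<bar> + d * \<bar>coord z i\<bar>"
  shows "norm x \<le> c * norm y + d * norm z"
proof (rule norm_ell2_le_L2_set)
  fix F :: "int set" assume F: "finite F"
  have abs: "L2_set (\<lambda>i. \<bar>v i\<bar>) F = L2_set v F" for v :: "int \<Rightarrow> real"
    by (simp add: L2_set_def)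
  have "L2_set (coord x) F = L2_set (\<lambda>i. \<bar>coord x i\<bar>) F" by (simp add: abs)
  also have "\<dots> \<le> L2_set (\<lambda>i. c * \<bar>coord y i\<bar> + d * \<bar>coord z i\<bar>) F"
    by (rule L2_set_mono) (use le in auto)
  also have "\<dots> \<le> L2_set (\<lambda>i. c * \<bar>coord y i\<bar>) F + L2_set (\<lambda>i. d * \<bar>coord z i\<bar>) F"
    by (rule L2_set_triangle_ineq)
  also have "\<dots> = c * L2_set (coord y) F + d * L2_set (coord z) F"
    using assms(1,2) by (simp add: L2_set_right_distrib[symmetric] abs)
  also have "\<dots> \<le> c * norm y + d * norm z"
    using assms(1,2) L2_set_coord_le[OF F] by (intro add_mono mult_left_mono) auto
  finally show "L2_set (coord x) F \<le> c * norm y + d * norm z" .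
qed

lemma bounded_linear_coord: "bounded_linear (\<lambda>u. coord u i)"
  by (rule bounded_linear_intro[where K=1]) (simp_all add: abs_coord_le)

lemmas continuous_on_coord [continuous_intros] =
  bounded_linear.continuous_on[OF bounded_linear_coord]

lemmas tendsto_coord = bounded_linear.tendsto[OF bounded_linear_coord]

text \<open>The integral of the diagonal operator with entries \<open>g\<close>. The value of
  \<open>Abs_ell2\<close> is meaningful once the coordinates are square summable, which
  \<open>young_diag_estimate\<close> shows.\<close>

definition young_diag :: "real \<Rightarrow> real \<Rightarrow> real \<Rightarrow> (real \<Rightarrow> ell2) \<Rightarrow> (real \<Rightarrow> ell2) \<Rightarrow> ell2" where
  "young_diag a s t g w = Abs_ell2 (\<lambda>i. frac_integral a s t (\<lambda>r. coord (g r) i) (\<lambda>r. coord (w r) i))"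

lemma coord_borel_measurable:
  "continuous_on UNIV g \<Longrightarrow> (\<lambda>r. coord (g r) i) \<in> borel_measurable borel" for g :: "real \<Rightarrow> ell2"
  by (intro borel_measurable_continuous_onI continuous_intros)

text \<open>A bound on the l2 norm over all finite \<open>F\<close> gives square summability, hence
  the coordinates of \<open>Abs_ell2\<close>, and the same bound for its norm.\<close>

lemma young_diag_estimate:
  assumes ab: "0 < a" "a < b" "b < 1" "1 - a < b'" and st: "s \<le> t"
    and cg: "continuous_on UNIV g" and cw: "continuous_on UNIV w"
    and hg: "\<And>r q. r \<in> {s..t} \<Longrightarrow> q \<in> {s..t} \<Longrightarrow> norm (g r - g q) \<le> C * \<bar>r - q\<bar> powr b"
    and bg: "\<And>r. r \<in> {s..t} \<Longrightarrow> norm (g r) \<le> C0"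
    and hw: "\<And>r q. r \<in> {s..t} \<Longrightarrow> q \<in> {s..t} \<Longrightarrow> norm (w r - w q) \<le> C' * \<bar>r - q\<bar> powr b'"
  shows "coord (young_diag a s t g w) i = frac_integral a s t (\<lambda>r. coord (g r) i) (\<lambda>r. coord (w r) i)"
    and "norm (young_diag a s t g w) \<le>
      young_bound a b b' / (1 - a) * C' * (C0 * (t - s) powr b' + C * (t - s) powr (b + b'))"
proof -
  let ?y = "\<lambda>i. frac_integral a s t (\<lambda>r. coord (g r) i) (\<lambda>r. coord (w r) i)"
  let ?B = "young_bound a b b' / (1 - a) * C' * (C0 * (t - s) powr b' + C * (t - s) powr (b + b'))"
  have le: "L2_set ?y F \<le> ?B" if F: "finite F" for F
  proof (rule frac_integral_L2_bound[OF ab st F])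
    show "L2_set (\<lambda>i. coord (g r) i - coord (g q) i) F \<le> C * \<bar>r - q\<bar> powr b"
      if "r \<in> {s..t}" "q \<in> {s..t}" for r q
      by (rule order_trans[OF L2_set_coord_diff_le[OF F] hg[OF that]])
    show "L2_set (\<lambda>i. coord (w r) i - coord (w q) i) F \<le> C' * \<bar>r - q\<bar> powr b'"
      if "r \<in> {s..t}" "q \<in> {s..t}" for r q
      by (rule order_trans[OF L2_set_coord_diff_le[OF F] hw[OF that]])
    show "L2_set (\<lambda>i. coord (g r) i) F \<le> C0" if "r \<in> {s..t}" for r
      by (rule order_trans[OF L2_set_coord_le[OF F] bg[OF that]])
  qed (use coord_borel_measurable cg cw in auto)
  have "(\<lambda>i. (?y i)\<^sup>2) summable_on UNIV"
  proof (rule nonneg_bdd_above_summable_on)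
    show "bdd_above (sum (\<lambda>i. (?y i)\<^sup>2) ` {F. F \<subseteq> UNIV \<and> finite F})"
    proof (rule bdd_aboveI2)
      fix F :: "int set" assume "F \<in> {F. F \<subseteq> UNIV \<and> finite F}"
      then have "finite F" by simp
      from power_mono[OF le[OF this], of 2]
      show "(\<Sum>i\<in>F. (?y i)\<^sup>2) \<le> ?B\<^sup>2" by (simp add: L2_set_def sum_nonneg)
    qed
  qed auto
  then have c: "coord (young_diag a s t g w) = ?y"
    unfolding young_diag_def by (rule coord_Abs_ell2)
  then show "coord (young_diag a s t g w) i = ?y i" by simp
  show "norm (young_diag a s t g w) \<le> ?B"
    by (rule norm_ell2_le_L2_set) (use le c in simp)
qed

text \<open>Stated on the whole line because the averages look beyond the interval of integration;
  paths on \<open>[0, T]\<close> are first extended by constants.\<close>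

definition bounded_Holder :: "real \<Rightarrow> (real \<Rightarrow> 'a::real_normed_vector) \<Rightarrow> bool" where
  "bounded_Holder b g \<longleftrightarrow>
     (\<exists>C. \<forall>r q. norm (g r - g q) \<le> C * \<bar>r - q\<bar> powr b) \<and> (\<exists>C0. \<forall>r. norm (g r) \<le> C0)"

lemma bounded_HolderE:
  assumes "bounded_Holder b g"
  obtains C C0 where "\<And>r q. norm (g r - g q) \<le> C * \<bar>r - q\<bar> powr b" "\<And>r. norm (g r) \<le> C0" "0 \<le> C" "0 \<le> C0"
proof -
  obtain C C0 where C: "\<And>r q. norm (g r - g q) \<le> C * \<bar>r - q\<bar> powr b" "\<And>r. norm (g r) \<le> C0"
    using assms unfolding bounded_Holder_def by blast
  have "0 \<le> C" using order_trans[OF norm_ge_zero C(1)[of 0 1]] by simp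
  moreover have "0 \<le> C0" using order_trans[OF norm_ge_zero C(2)] by simp
  ultimately show thesis using that C by blast
qed

lemma bounded_Holder_continuous: "0 < b \<Longrightarrow> bounded_Holder b g \<Longrightarrow> continuous_on UNIV g"
  by (meson bounded_HolderE Holder_continuous)

lemma bounded_Holder_minus:
  fixes g1 g2 :: "real \<Rightarrow> 'a::real_normed_vector"
  assumes "bounded_Holder b g1" "bounded_Holder b g2"
  shows "bounded_Holder b (\<lambda>r. g1 r - g2 r)"
proof -
  obtain C C0 where C: "\<And>r q. norm (g1 r - g1 q) \<le> C * \<bar>r - q\<bar> powr b" "\<And>r. norm (g1 r) \<le> C0"
    using bounded_HolderE[OF assms(1)] by metis
  obtain D D0 where D: "\<And>r q. norm (g2 r - g2 q) \<le> D * \<bar>r - q\<bar> powr b" "\<And>r. norm (g2 r) \<le> D0"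
    using bounded_HolderE[OF assms(2)] by metis
  have "norm ((g1 r - g2 r) - (g1 q - g2 q)) \<le> (C + D) * \<bar>r - q\<bar> powr b" for r q
    using norm_triangle_ineq4[of "g1 r - g1 q" "g2 r - g2 q"] C(1)[of r q] D(1)[of r q]
    by (simp add: algebra_simps)
  moreover have "norm (g1 r - g2 r) \<le> C0 + D0" for r
    using norm_triangle_ineq4[of "g1 r" "g2 r"] C(2)[of r] D(2)[of r] by linarith
  ultimately show ?thesis unfolding bounded_Holder_def by blast
qed

context
  fixes a b b' :: real and g w :: "real \<Rightarrow> ell2"
  assumes ab: "0 < a" "a < b" "b < 1" "1 - a < b'"
    and g: "bounded_Holder b g" and w: "bounded_Holder b' w"
begin

lemma coord_young_diag:
  assumes "s \<le> t"
  shows "coord (young_diag a s t g w) i = frac_integral a s t (\<lambda>r. coord (g r) i) (\<lambda>r. coord (w r) i)"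
proof -
  have "0 < b" "0 < b'" using ab by auto
  then have "continuous_on UNIV g" "continuous_on UNIV w"
    using g w by (auto intro: bounded_Holder_continuous)
  moreover obtain C C0 where "\<And>r q. norm (g r - g q) \<le> C * \<bar>r - q\<bar> powr b" "\<And>r. norm (g r) \<le> C0"
    using bounded_HolderE[OF g] by metis
  moreover obtain C' where "\<And>r q. norm (w r - w q) \<le> C' * \<bar>r - q\<bar> powr b'"
    using bounded_HolderE[OF w] by metis
  ultimately show ?thesis
    by (intro young_diag_estimate(1)[OF ab assms, where C=C and C0=C0 and C'=C'])
qed

lemma coord_bounded_Holder:
  obtains C C0 C' where "\<And>i r q. \<bar>coord (g r) i - coord (g q) i\<bar> \<le> C * \<bar>r - q\<bar> powr b"
    "\<And>i r. \<bar>coord (g r) i\<bar> \<le> C0" "\<And>i r q. \<bar>coord (w r) i - coord (w q) i\<bar> \<le> C' * \<bar>r - q\<bar> powr b'"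
proof -
  obtain C C0 where C: "\<And>r q. norm (g r - g q) \<le> C * \<bar>r - q\<bar> powr b" "\<And>r. norm (g r) \<le> C0"
    using bounded_HolderE[OF g] by metis
  obtain C' where C': "\<And>r q. norm (w r - w q) \<le> C' * \<bar>r - q\<bar> powr b'"
    using bounded_HolderE[OF w] by metis
  show thesis
    by (rule that[of C C0 C'])
      (use order_trans[OF abs_coord_le C(1)] order_trans[OF abs_coord_le C(2)] order_trans[OF abs_coord_le C'] in auto)
qed

lemma young_diag_combine:
  assumes "r \<le> s" "s \<le> t"
  shows "young_diag a r s g w + young_diag a s t g w = young_diag a r t g w"
proof (rule ell2_eqI)
  fix i
  obtain C C0 C' where "\<And>r q. \<bar>coord (g r) i - coord (g q) i\<bar> \<le> C * \<bar>r - q\<bar> powr b"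
    "\<And>r. \<bar>coord (g r) i\<bar> \<le> C0" "\<And>r q. \<bar>coord (w r) i - coord (w q) i\<bar> \<le> C' * \<bar>r - q\<bar> powr b'"
    by (rule coord_bounded_Holder) (rule that)
  from frac_integral_combine[OF ab this assms] assms
  show "coord (young_diag a r s g w + young_diag a s t g w) i = coord (young_diag a r t g w) i"
    by (simp add: coord_young_diag)
qed

lemma frac_integral_coord_order_independent:
  assumes "0 < a'" "a' < b" "1 - a' < b'" "s \<le> t"
  shows "frac_integral a' s t (\<lambda>r. coord (g r) i) (\<lambda>r. coord (w r) i) =
    frac_integral a s t (\<lambda>r. coord (g r) i) (\<lambda>r. coord (w r) i)"
proof -
  obtain C C0 C' where "\<And>r q. \<bar>coord (g r) i - coord (g q) i\<bar> \<le> C * \<bar>r - q\<bar> powr b"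
    "\<And>r. \<bar>coord (g r) i\<bar> \<le> C0" "\<And>r q. \<bar>coord (w r) i - coord (w q) i\<bar> \<le> C' * \<bar>r - q\<bar> powr b'"
    by (rule coord_bounded_Holder) (rule that)
  from frac_integral_order_independent[OF ab this assms] show ?thesis .
qed

lemma frac_integral_coord_diff:
  assumes g2: "bounded_Holder b g2" and st: "s \<le> t"
  shows "frac_integral a s t (\<lambda>r. coord (g r) i) (\<lambda>r. coord (w r) i) -
      frac_integral a s t (\<lambda>r. coord (g2 r) i) (\<lambda>r. coord (w r) i) =
    frac_integral a s t (\<lambda>r. coord (g r - g2 r) i) (\<lambda>r. coord (w r) i)"
proof -
  have pos: "0 < b" "0 < b'" using ab by auto
  have c: "continuous_on UNIV g" "continuous_on UNIV g2" "continuous_on UNIV w"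
    using g g2 w pos by (auto intro: bounded_Holder_continuous)
  obtain C C0 where C: "\<And>r q. norm (g r - g q) \<le> C * \<bar>r - q\<bar> powr b" "\<And>r. norm (g r) \<le> C0" "0 \<le> C" "0 \<le> C0"
    using bounded_HolderE[OF g] by metis
  obtain D D0 where D: "\<And>r q. norm (g2 r - g2 q) \<le> D * \<bar>r - q\<bar> powr b" "\<And>r. norm (g2 r) \<le> D0" "0 \<le> D" "0 \<le> D0"
    using bounded_HolderE[OF g2] by metis
  obtain C' where C': "\<And>r q. norm (w r - w q) \<le> C' * \<bar>r - q\<bar> powr b'"
    using bounded_HolderE[OF w] by metis
  \<comment> \<open>\<open>frac_integral_diff\<close> asks for one set of constants for both paths;
    sums of the individual constants serve.\<close>
  have 1: "\<bar>coord (g r) i - coord (g q) i\<bar> \<le> (C + D) * \<bar>r - q\<bar> powr b" for r q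
    using abs_coord_le[of "g r - g q" i] C(1)[of r q] D(3) by (simp add: distrib_right add_increasing2)
  have 2: "\<bar>coord (g2 r) i - coord (g2 q) i\<bar> \<le> (C + D) * \<bar>r - q\<bar> powr b" for r q
    using abs_coord_le[of "g2 r - g2 q" i] D(1)[of r q] C(3) by (simp add: distrib_right add_increasing)
  have 3: "\<bar>coord (g r) i\<bar> \<le> C0 + D0" "\<bar>coord (g2 r) i\<bar> \<le> C0 + D0" for r
    using abs_coord_le[of "g r" i] abs_coord_le[of "g2 r" i] C(2)[of r] C(4) D(2)[of r] D(4) by linarith+
  have 4: "\<bar>coord (w r) i - coord (w q) i\<bar> \<le> C' * \<bar>r - q\<bar> powr b'" for r q
    using abs_coord_le[of "w r - w q" i] C'[of r q] by simp
  show ?thesis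
    unfolding coord_diff
    by (rule frac_integral_diff[OF ab st, symmetric])
      (use coord_borel_measurable c 1 2 3 4 in auto)
qed

end

lemma young_diag_minus:
  assumes ab: "0 < a" "a < b" "b < 1" "1 - a < b'" and st: "s \<le> t"
    and g: "bounded_Holder b g1" "bounded_Holder b g2" and w: "bounded_Holder b' w"
  shows "young_diag a s t g1 w - young_diag a s t g2 w = young_diag a s t (\<lambda>r. g1 r - g2 r) w"
proof -
  note d = coord_young_diag[OF ab bounded_Holder_minus[OF g] w st]
  show ?thesis
    by (rule ell2_eqI)
      (simp only: coord_diff[of "young_diag a s t g1 w"] d coord_young_diag[OF ab g(1) w st]
        coord_young_diag[OF ab g(2) w st]
        frac_integral_coord_diff[OF ab g(1) w g(2) st])
qed

section \<open>Superposition operators\<close>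

context
  fixes h :: "int \<Rightarrow> real \<Rightarrow> real" and D :: real
  assumes diff: "\<And>i. h i C1_differentiable_on UNIV"
    and zero: "(\<lambda>i. (h i 0)\<^sup>2) summable_on UNIV"
    and D: "0 \<le> D" "\<And>i z. \<bar>deriv (h i) z\<bar> \<le> D"
begin

lemma C1_has_deriv: "(h i has_real_derivative deriv (h i) z) (at z)"
  using diff[of i] unfolding C1_differentiable_on_def
  by (metis DERIV_deriv_iff_has_field_derivative UNIV_I has_real_derivative_iff_has_vector_derivative)

lemma component_Lipschitz: "\<bar>h i y - h i z\<bar> \<le> D * \<bar>y - z\<bar>"
  using field_differentiable_bound[OF convex_UNIV, of "h i" "deriv (h i)" D y z] C1_has_deriv D by auto

lemma coord_superposition: "coord (drift_map h u) i = h i (coord u i)"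
  by (rule coord_drift_map[OF diff D(2) zero])

lemma superposition_Lipschitz: "norm (drift_map h u - drift_map h v) \<le> D * norm (u - v)"
  using norm_ell2_le_combination[of D 0 "drift_map h u - drift_map h v" "u - v" 0] D
    component_Lipschitz by (simp add: coord_superposition)

text \<open>In a coordinate the mixed difference of \<open>k\<close> splits into
  \<open>k a - k (b + (c - d))\<close>, a first difference over the distance
  \<open>(a - b) - (c - d)\<close>, and \<open>\<psi> b - \<psi> d\<close>, where the derivative of
  \<open>\<psi>\<close> is at most \<open>M |c - d|\<close>. This is where the second derivatives
  enter.\<close>

lemma superposition_second_difference:
  assumes diff2: "\<And>i. deriv (h i) C1_differentiable_on UNIV"
    and M: "0 \<le> M" "\<And>i z. \<bar>deriv (deriv (h i)) z\<bar> \<le> M"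
  shows "norm ((drift_map h u - drift_map h v) - (drift_map h p - drift_map h q)) \<le>
    D * norm ((u - v) - (p - q)) + M * norm (p - q) * norm (v - q)"
proof (rule norm_ell2_le_combination)
  fix i
  have der2: "(deriv (h i) has_real_derivative deriv (deriv (h i)) z) (at z)" for z
    using diff2[of i] unfolding C1_differentiable_on_def
    by (metis DERIV_deriv_iff_has_field_derivative UNIV_I has_real_derivative_iff_has_vector_derivative)
  let ?k = "h i" and ?a = "coord u i" and ?b = "coord v i" and ?c = "coord p i" and ?d = "coord q i"
  define \<psi> where "\<psi> y = ?k (y + (?c - ?d)) - ?k y" for y
  have lip: "\<bar>deriv ?k x - deriv ?k y\<bar> \<le> M * \<bar>x - y\<bar>" for x y
    using field_differentiable_bound[OF convex_UNIV, of "deriv ?k" "deriv (deriv ?k)" M x y] der2 M by auto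
  have lip2: "\<bar>deriv ?k (y + (?c - ?d)) - deriv ?k y\<bar> \<le> M * \<bar>?c - ?d\<bar>" for y
    using lip[of "y + (?c - ?d)" y] by simp
  have der: "(\<psi> has_real_derivative deriv ?k (y + (?c - ?d)) - deriv ?k y) (at y)" for y
    unfolding \<psi>_def using DERIV_shift[of ?k "deriv ?k (y + (?c - ?d))" y "?c - ?d"] C1_has_deriv
    by (intro DERIV_diff) auto
  have "\<bar>\<psi> ?b - \<psi> ?d\<bar> \<le> (M * \<bar>?c - ?d\<bar>) * \<bar>?b - ?d\<bar>"
    using field_differentiable_bound[OF convex_UNIV, of \<psi> "\<lambda>y. deriv ?k (y + (?c - ?d)) - deriv ?k y" "M * \<bar>?c - ?d\<bar>" ?b ?d]
      der lip2 by simp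
  \<comment> \<open>One factor is replaced by its norm, so that the other alone carries the square
    summability.\<close>
  also have "\<dots> \<le> (M * norm (p - q)) * \<bar>?b - ?d\<bar>"
    using M abs_coord_le[of "p - q" i] by (intro mult_right_mono mult_left_mono) auto
  finally have 1: "\<bar>\<psi> ?b - \<psi> ?d\<bar> \<le> (M * norm (p - q)) * \<bar>?b - ?d\<bar>" .
  have 2: "\<bar>?k ?a - ?k (?b + (?c - ?d))\<bar> \<le> D * \<bar>(?a - ?b) - (?c - ?d)\<bar>"
    using component_Lipschitz[of i ?a "?b + (?c - ?d)"] by (simp add: diff_diff_eq)
  have "(?k ?a - ?k ?b) - (?k ?c - ?k ?d) = (?k ?a - ?k (?b + (?c - ?d))) + (\<psi> ?b - \<psi> ?d)"
    by (simp add: \<psi>_def)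
  then show "\<bar>coord ((drift_map h u - drift_map h v) - (drift_map h p - drift_map h q)) i\<bar> \<le>
      D * \<bar>coord ((u - v) - (p - q)) i\<bar> + (M * norm (p - q)) * \<bar>coord (v - q) i\<bar>"
    using 1 2 by (simp add: coord_superposition)
qed (use D M in auto)

end

section \<open>Coordinate expansions\<close>

lemma inner_unit_vec: "inner v (unit_vec i) = coord v i"
proof -
  have "inner v (unit_vec i) = (\<Sum>\<^sub>\<infinity>j\<in>{i}. coord v j * coord (unit_vec i) j)"
    unfolding inner_ell2_def by (rule infsum_cong_neutral) (auto simp: unit_vec.rep_eq)
  then show ?thesis by (simp add: unit_vec.rep_eq)
qed

lemma inner_unit_vec': "inner (unit_vec i) v = coord v i"
  by (subst inner_commute) (rule inner_unit_vec)

lemma norm_unit_vec [simp]: "norm (unit_vec i) = 1"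
  by (simp add: norm_eq_sqrt_inner inner_unit_vec unit_vec.rep_eq)

lemma coord_sum: "coord (\<Sum>j\<in>F. x j) i = (\<Sum>j\<in>F. coord (x j) i)"
  by (induction F rule: infinite_finite_induct) auto

definition truncate_ell2 :: "int set \<Rightarrow> ell2 \<Rightarrow> ell2" where
  "truncate_ell2 F y = (\<Sum>j\<in>F. coord y j *\<^sub>R unit_vec j)"

lemma coord_truncate: "finite F \<Longrightarrow> coord (truncate_ell2 F y) i = (if i \<in> F then coord y i else 0)"
proof -
  assume F: "finite F"
  have "coord (truncate_ell2 F y) i = (\<Sum>j\<in>F. if j = i then coord y j else 0)"
    unfolding truncate_ell2_def coord_sum by (rule sum.cong) (auto simp: unit_vec.rep_eq)
  then show ?thesis using F by simp
qed

lemma norm_truncate_le: "finite F \<Longrightarrow> norm (truncate_ell2 F y) \<le> norm y"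
  using norm_ell2_le_combination[of 1 0 "truncate_ell2 F y" y 0] by (simp add: coord_truncate)

text \<open>By orthogonality the squared distance to a truncation is \<open>(norm y)^2\<close> minus
  a partial sum of squares, and the partial sums converge to \<open>(norm y)^2\<close>.\<close>

lemma unit_vec_expansion: "((\<lambda>j. coord y j *\<^sub>R unit_vec j) has_sum y) UNIV"
proof -
  have nrm: "(norm (y - truncate_ell2 F y))\<^sup>2 = (norm y)\<^sup>2 - (\<Sum>j\<in>F. (coord y j)\<^sup>2)" if F: "finite F" for F
  proof -
    have i: "inner v (truncate_ell2 F y) = (\<Sum>j\<in>F. coord y j * coord v j)" for v
      by (simp add: truncate_ell2_def inner_sum_right inner_unit_vec)
    have "inner (truncate_ell2 F y) (truncate_ell2 F y) = (\<Sum>j\<in>F. (coord y j)\<^sup>2)"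
      unfolding i using F by (intro sum.cong) (auto simp: coord_truncate power2_eq_square)
    moreover have "inner y (truncate_ell2 F y) = (\<Sum>j\<in>F. (coord y j)\<^sup>2)"
      unfolding i by (simp add: power2_eq_square)
    ultimately show ?thesis
      by (simp add: power2_norm_eq_inner inner_diff_left inner_diff_right inner_commute)
  qed
  have "((\<lambda>j. (coord y j)\<^sup>2) has_sum (norm y)\<^sup>2) UNIV"
    unfolding norm_ell2_square by (rule has_sum_infsum[OF summable_coord_square])
  then have "((\<lambda>F. \<Sum>j\<in>F. (coord y j)\<^sup>2) \<longlongrightarrow> (norm y)\<^sup>2) (finite_subsets_at_top UNIV)"
    by (simp add: has_sum_def)
  then have "((\<lambda>F. sqrt ((norm y)\<^sup>2 - (\<Sum>j\<in>F. (coord y j)\<^sup>2))) \<longlongrightarrow> sqrt ((norm y)\<^sup>2 - (norm y)\<^sup>2)) (finite_subsets_at_top UNIV)"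
    by (intro tendsto_intros)
  then have "((\<lambda>F. sqrt ((norm y)\<^sup>2 - (\<Sum>j\<in>F. (coord y j)\<^sup>2))) \<longlongrightarrow> 0) (finite_subsets_at_top UNIV)"
    by simp
  then have "((\<lambda>F. norm (y - truncate_ell2 F y)) \<longlongrightarrow> 0) (finite_subsets_at_top UNIV)"
    by (rule Lim_transform_eventually)
      (auto intro!: eventually_finite_subsets_at_top_weakI simp: nrm[symmetric])
  then have "((\<lambda>F. truncate_ell2 F y - y) \<longlongrightarrow> 0) (finite_subsets_at_top UNIV)"
    by (subst tendsto_norm_zero_iff[symmetric]) (simp add: norm_minus_commute)
  then show ?thesis unfolding has_sum_def truncate_ell2_def[symmetric] by (rule LIM_zero_cancel)
qed

text \<open>A sequence cofinal in the finite sets of integers: unordered sums are evaluated along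
  it, since dominated convergence is a statement about sequences.\<close>

definition cutoff :: "nat \<Rightarrow> int set" where "cutoff n = {- int n..int n}"

lemma cutoff_filterlim: "filterlim cutoff (finite_subsets_at_top UNIV) sequentially"
  unfolding filterlim_finite_subsets_at_top
proof (intro allI impI)
  fix X :: "int set" assume X: "finite X \<and> X \<subseteq> UNIV"
  define N where "N = nat (\<Sum>i\<in>X. \<bar>i\<bar>)"
  have "\<bar>i\<bar> \<le> int N" if "i \<in> X" for i
    unfolding N_def using member_le_sum[of i X abs] that X by auto
  then have "X \<subseteq> cutoff n" if "N \<le> n" for n
    using that unfolding cutoff_def by fastforce
  then show "\<forall>\<^sub>F n in sequentially. finite (cutoff n) \<and> X \<subseteq> cutoff n \<and> cutoff n \<subseteq> UNIV"
    unfolding eventually_sequentially by (auto simp: cutoff_def)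
qed

lemma finite_cutoff [simp]: "finite (cutoff n)" by (simp add: cutoff_def)

lemma truncate_cutoff_tendsto: "(\<lambda>n. truncate_ell2 (cutoff n) y) \<longlonglongrightarrow> y"
  using filterlim_compose[OF unit_vec_expansion[unfolded has_sum_def] cutoff_filterlim]
  by (simp add: truncate_ell2_def)

text \<open>The signs of the terms are absorbed into a vector \<open>v\<close> of norm at most
  \<open>norm y\<close>; the sum of absolute values is then one coordinate of
  \<open>B v\<close>.\<close>

lemma sum_abs_matrix_row_le:
  fixes B :: "ell2 \<Rightarrow>\<^sub>L ell2"
  assumes "finite F"
  shows "(\<Sum>i\<in>F. \<bar>coord (B (unit_vec i)) j * coord y i\<bar>) \<le> norm B * norm y"
proof -
  define v where "v = (\<Sum>i\<in>F. (sgn (coord (B (unit_vec i)) j * coord y i) * coord y i) *\<^sub>R unit_vec i)"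
  have cv: "coord v k = (if k \<in> F then sgn (coord (B (unit_vec k)) j * coord y k) * coord y k else 0)" for k
  proof -
    have "coord v k = (\<Sum>i\<in>F. if i = k then sgn (coord (B (unit_vec i)) j * coord y i) * coord y i else 0)"
      unfolding v_def coord_sum by (rule sum.cong) (auto simp: unit_vec.rep_eq)
    then show ?thesis using assms by simp
  qed
  have "norm v \<le> 1 * norm y + 0 * norm y"
    by (rule norm_ell2_le_combination) (auto simp: cv abs_mult abs_sgn_eq)
  then have v: "norm v \<le> norm y" by simp
  have "(\<Sum>i\<in>F. \<bar>coord (B (unit_vec i)) j * coord y i\<bar>) = coord (B v) j"
    unfolding v_def blinfun.sum_right coord_sum blinfun.scaleR_right coord_scaleR
    by (intro sum.cong) (auto simp: abs_sgn mult_ac)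
  also have "\<dots> \<le> norm (B v)" using abs_coord_le[of "B v" j] by linarith
  also have "\<dots> \<le> norm B * norm v" by (rule norm_blinfun)
  also have "\<dots> \<le> norm B * norm y" using v by (simp add: mult_left_mono)
  finally show ?thesis .
qed

text \<open>Exchanges the sum over \<open>i\<close> in \<open>young_integral\<close> with the time
  integral. The row bound gives absolute summability, so the unordered sum exists; its value is
  found along \<open>cutoff\<close>, dominated by \<open>norm (B r) * norm (y r)\<close>.\<close>

lemma has_sum_integral_matrix_row:
  fixes B :: "real \<Rightarrow> ell2 \<Rightarrow>\<^sub>L ell2" and y :: "real \<Rightarrow> ell2"
  assumes B: "continuous_on {s..t} B" and y: "continuous_on {s..t} y"
  shows "((\<lambda>i. LINT r:{s<..<t}|lborel. coord (B r (unit_vec i)) j * coord (y r) i) has_sum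
     (LINT r:{s<..<t}|lborel. coord (B r (y r)) j)) UNIV"
proof -
  define c where "c i = (LINT r:{s<..<t}|lborel. coord (B r (unit_vec i)) j * coord (y r) i)" for i
  have si: "set_integrable lborel {s<..<t} (\<lambda>r. coord (B r (unit_vec i)) j * coord (y r) i)" for i
    by (intro set_integrable_continuous continuous_intros B y)
  have nc: "set_integrable lborel {s<..<t} (\<lambda>r. norm (B r) * norm (y r))"
    by (intro set_integrable_continuous continuous_intros B y)
  have "(\<lambda>i. \<bar>c i\<bar>) summable_on UNIV"
  proof (rule nonneg_bdd_above_summable_on)
    show "bdd_above (sum (\<lambda>i. \<bar>c i\<bar>) ` {F. F \<subseteq> UNIV \<and> finite F})"
    proof (rule bdd_aboveI2)
      fix F :: "int set" assume "F \<in> {F. F \<subseteq> UNIV \<and> finite F}"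
      then have F: "finite F" by simp
      have "(\<Sum>i\<in>F. \<bar>c i\<bar>) \<le> (\<Sum>i\<in>F. LINT r:{s<..<t}|lborel. \<bar>coord (B r (unit_vec i)) j * coord (y r) i\<bar>)"
        unfolding c_def using set_integral_norm_bound[OF si] by (intro sum_mono) simp
      also have "\<dots> = (LINT r:{s<..<t}|lborel. \<Sum>i\<in>F. \<bar>coord (B r (unit_vec i)) j * coord (y r) i\<bar>)"
        using set_integrable_abs[OF si] unfolding set_integrable_def set_lebesgue_integral_def scaleR_sum_right
        by (intro Bochner_Integration.integral_sum[symmetric]) auto
      also have "\<dots> \<le> (LINT r:{s<..<t}|lborel. norm (B r) * norm (y r))"
      proof (rule set_integral_mono[OF _ nc])
        show "set_integrable lborel {s<..<t} (\<lambda>r. \<Sum>i\<in>F. \<bar>coord (B r (unit_vec i)) j * coord (y r) i\<bar>)"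
          by (intro set_integrable_continuous continuous_intros B y)
      qed (use sum_abs_matrix_row_le[OF F] in auto)
      finally show "(\<Sum>i\<in>F. \<bar>c i\<bar>) \<le> (LINT r:{s<..<t}|lborel. norm (B r) * norm (y r))" .
    qed
  qed auto
  then have "c summable_on UNIV" using abs_summable_summable[of c UNIV] by simp
  then have hs: "(c has_sum infsum c UNIV) UNIV" by (rule has_sum_infsum)
  have "(\<lambda>n. \<Sum>i\<in>cutoff n. c i) \<longlonglongrightarrow> infsum c UNIV"
    using filterlim_compose[OF hs[unfolded has_sum_def] cutoff_filterlim] .
  moreover have "(\<lambda>n. \<Sum>i\<in>cutoff n. c i) \<longlonglongrightarrow> (LINT r:{s<..<t}|lborel. coord (B r (y r)) j)"
  proof -
    have sum: "(\<Sum>i\<in>cutoff n. c i) = (LINT r:{s<..<t}|lborel. coord (B r (truncate_ell2 (cutoff n) (y r))) j)" for n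
    proof -
      have "(\<Sum>i\<in>cutoff n. c i) = (LINT r:{s<..<t}|lborel. \<Sum>i\<in>cutoff n. coord (B r (unit_vec i)) j * coord (y r) i)"
        unfolding c_def using si unfolding set_integrable_def set_lebesgue_integral_def scaleR_sum_right
        by (intro Bochner_Integration.integral_sum[symmetric]) auto
      then show ?thesis
        by (simp add: truncate_ell2_def blinfun.sum_right coord_sum blinfun.scaleR_right mult.commute)
    qed
    have ct: "continuous_on {s..t} (\<lambda>r. truncate_ell2 (cutoff n) (y r))" for n
      unfolding truncate_ell2_def by (intro continuous_intros y)
    show ?thesis
      unfolding sum set_lebesgue_integral_def
    proof (rule integral_dominated_convergence)
      show "integrable lborel (\<lambda>r. indicator {s<..<t} r *\<^sub>R (norm (B r) * norm (y r)))"
        using nc by (simp add: set_integrable_def)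
      have meas: "(\<lambda>r. indicator {s<..<t} r *\<^sub>R f r) \<in> borel_measurable lborel"
        if "continuous_on {s..t} f" for f :: "real \<Rightarrow> real"
        using set_integrable_continuous[OF that] unfolding set_integrable_def by (rule borel_measurable_integrable)
      show "(\<lambda>r. indicator {s<..<t} r *\<^sub>R coord (B r (y r)) j) \<in> borel_measurable lborel"
        by (intro meas continuous_intros B y)
      show "(\<lambda>r. indicator {s<..<t} r *\<^sub>R coord (B r (truncate_ell2 (cutoff n) (y r))) j) \<in> borel_measurable lborel" for n
        by (intro meas continuous_intros B ct)
      show "AE r in lborel. (\<lambda>n. indicator {s<..<t} r *\<^sub>R coord (B r (truncate_ell2 (cutoff n) (y r))) j)
          \<longlonglongrightarrow> indicator {s<..<t} r *\<^sub>R coord (B r (y r)) j"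
        by (intro AE_I2 tendsto_intros tendsto_coord blinfun.tendsto truncate_cutoff_tendsto)
      show "AE r in lborel. norm (indicator {s<..<t} r *\<^sub>R coord (B r (truncate_ell2 (cutoff n) (y r))) j)
          \<le> indicator {s<..<t} r *\<^sub>R (norm (B r) * norm (y r))" for n
      proof (intro AE_I2)
        fix r
        have "\<bar>coord (B r (truncate_ell2 (cutoff n) (y r))) j\<bar> \<le> norm (B r) * norm (truncate_ell2 (cutoff n) (y r))"
          by (rule order_trans[OF abs_coord_le norm_blinfun])
        also have "\<dots> \<le> norm (B r) * norm (y r)"
          by (intro mult_left_mono norm_truncate_le) auto
        finally show "norm (indicator {s<..<t} r *\<^sub>R coord (B r (truncate_ell2 (cutoff n) (y r))) j)
          \<le> indicator {s<..<t} r *\<^sub>R (norm (B r) * norm (y r))" by (simp add: indicator_def)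
      qed
    qed
  qed
  ultimately have "infsum c UNIV = (LINT r:{s<..<t}|lborel. coord (B r (y r)) j)" by (rule LIMSEQ_unique)
  then show ?thesis using hs unfolding c_def by simp
qed

section \<open>The semigroup\<close>

text \<open>A copy of the operator space that is an instance of the Banach algebra classes, so that the
  library's exponential applies to it.\<close>

typedef ell2_op = "UNIV :: (ell2 \<Rightarrow>\<^sub>L ell2) set"
  morphisms op_of Op by simp

setup_lifting type_definition_ell2_op

instantiation ell2_op :: real_vector
begin

lift_definition zero_ell2_op :: ell2_op is 0 .
lift_definition plus_ell2_op :: "ell2_op \<Rightarrow> ell2_op \<Rightarrow> ell2_op" is "(+)" .
lift_definition minus_ell2_op :: "ell2_op \<Rightarrow> ell2_op \<Rightarrow> ell2_op" is "(-)" .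
lift_definition uminus_ell2_op :: "ell2_op \<Rightarrow> ell2_op" is uminus .
lift_definition scaleR_ell2_op :: "real \<Rightarrow> ell2_op \<Rightarrow> ell2_op" is "(*\<^sub>R)" .

instance
  by standard (transfer; simp add: scaleR_add_left scaleR_add_right)+

end

instantiation ell2_op :: real_normed_algebra_1
begin

lift_definition one_ell2_op :: ell2_op is id_blinfun .
lift_definition times_ell2_op :: "ell2_op \<Rightarrow> ell2_op \<Rightarrow> ell2_op" is "(o\<^sub>L)" .
lift_definition norm_ell2_op :: "ell2_op \<Rightarrow> real" is norm .
definition dist_ell2_op :: "ell2_op \<Rightarrow> ell2_op \<Rightarrow> real" where "dist_ell2_op u v = norm (u - v)"
definition sgn_ell2_op :: "ell2_op \<Rightarrow> ell2_op" where "sgn_ell2_op u = u /\<^sub>R norm u"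
definition uniformity_ell2_op :: "(ell2_op \<times> ell2_op) filter"
  where "uniformity_ell2_op = (INF e\<in>{0<..}. principal {(x, y). dist x y < e})"
definition open_ell2_op :: "ell2_op set \<Rightarrow> bool"
  where "open_ell2_op U \<longleftrightarrow> (\<forall>x\<in>U. \<forall>\<^sub>F (x', y) in uniformity. x' = x \<longrightarrow> y \<in> U)"

instance
proof
  fix x y z :: ell2_op and c d :: real
  show "dist x y = norm (x - y)" by (rule dist_ell2_op_def)
  show "sgn x = x /\<^sub>R norm x" by (rule sgn_ell2_op_def)
  show "(uniformity :: (ell2_op \<times> ell2_op) filter) = (INF e\<in>{0<..}. principal {(x, y). dist x y < e})"
    by (rule uniformity_ell2_op_def)
  show "open U = (\<forall>x\<in>U. \<forall>\<^sub>F (x', y) in uniformity. x' = x \<longrightarrow> y \<in> U)" for U :: "ell2_op set"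
    by (rule open_ell2_op_def)
  show "x * y * z = x * (y * z)" by transfer (rule blinfun_eqI, simp)
  show "(x + y) * z = x * z + y * z"
    by transfer (rule bounded_bilinear.add_left[OF bounded_bilinear_blinfun_compose])
  show "x * (y + z) = x * y + x * z"
    by transfer (rule bounded_bilinear.add_right[OF bounded_bilinear_blinfun_compose])
  show "c *\<^sub>R x * y = c *\<^sub>R (x * y)"
    by transfer (rule bounded_bilinear.scaleR_left[OF bounded_bilinear_blinfun_compose])
  show "x * c *\<^sub>R y = c *\<^sub>R (x * y)"
    by transfer (rule bounded_bilinear.scaleR_right[OF bounded_bilinear_blinfun_compose])
  show "1 * x = x" by transfer (rule blinfun_eqI, simp)
  show "x * 1 = x" by transfer (rule blinfun_eqI, simp)
  show "(norm x = 0) = (x = 0)" by transfer simp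
  show "norm (x + y) \<le> norm x + norm y" by transfer (rule norm_triangle_ineq)
  show "norm (c *\<^sub>R x) = \<bar>c\<bar> * norm x" by transfer simp
  show "norm (x * y) \<le> norm x * norm y" by transfer (rule norm_blinfun_compose)
  have id1: "norm (id_blinfun :: ell2 \<Rightarrow>\<^sub>L ell2) = 1"
    using norm_blinfun[of "id_blinfun :: ell2 \<Rightarrow>\<^sub>L ell2" "unit_vec 0"] norm_blinfun_id_le[where 'a=ell2]
    by simp
  then show "norm (1 :: ell2_op) = 1" by transfer
  show "(0 :: ell2_op) \<noteq> 1" using id1 by transfer (metis norm_zero zero_neq_one)
qed

end

lemma bounded_linear_op_of: "bounded_linear op_of"
  by (rule bounded_linear_intro[where K=1]) (transfer; simp)+

lemma bounded_linear_Op: "bounded_linear Op"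
  by (rule bounded_linear_intro[where K=1]) (simp_all add: plus_ell2_op.abs_eq scaleR_ell2_op.abs_eq norm_ell2_op.abs_eq eq_onp_def)

instance ell2_op :: banach
proof
  fix X :: "nat \<Rightarrow> ell2_op" assume "Cauchy X"
  then have "Cauchy (\<lambda>n. op_of (X n))"
    by (rule bounded_linear.Cauchy[OF bounded_linear_op_of])
  then obtain l where "(\<lambda>n. op_of (X n)) \<longlonglongrightarrow> l"
    using Cauchy_convergent_iff convergent_def by blast
  then have "(\<lambda>n. Op (op_of (X n))) \<longlonglongrightarrow> Op l"
    by (rule bounded_linear.tendsto[OF bounded_linear_Op])
  then show "convergent X" by (auto simp: op_of_inverse convergent_def)
qed

lemma op_of_power: "op_of (x ^ n) = op_power (op_of x) n"
  by (induction n) (simp_all add: op_power_def one_ell2_op.rep_eq times_ell2_op.rep_eq)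

lemma op_exp_eq_exp: "op_exp (op_of x) = op_of (exp x)"
proof -
  have "op_of (exp x) = op_of (\<Sum>n. x ^ n /\<^sub>R fact n)" by (simp add: exp_def)
  also have "\<dots> = (\<Sum>n. op_of (x ^ n /\<^sub>R fact n))"
    by (rule bounded_linear.suminf[OF bounded_linear_op_of summable_exp_generic])
  also have "\<dots> = op_exp (op_of x)"
    by (simp add: op_exp_def scaleR_ell2_op.rep_eq op_of_power)
  finally show ?thesis by simp
qed

context
  fixes \<nu> l :: real
begin

private abbreviation (input) "S \<equiv> semigroup_S \<nu> l"
private abbreviation (input) "A \<equiv> op_A_shifted \<nu> l"

lemma semigroup_S_eq: "S t = op_of (exp (t *\<^sub>R Op (- A)))"
proof -
  have "(- t) *\<^sub>R A = op_of (t *\<^sub>R Op (- A))"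
    by (simp add: scaleR_ell2_op.rep_eq Op_inverse)
  then show ?thesis unfolding semigroup_S_def by (simp add: op_exp_eq_exp)
qed

lemma semigroup_S_0 [simp]: "S 0 = id_blinfun"
  by (simp add: semigroup_S_eq one_ell2_op.rep_eq)

lemma semigroup_S_add: "S (s + t) = S s o\<^sub>L S t"
  unfolding semigroup_S_eq times_ell2_op.rep_eq[symmetric]
  by (subst exp_add_commuting[symmetric]) (simp_all add: scaleR_add_left)

lemma semigroup_S_inverse: "S t (S (- t) v) = v" "S (- t) (S t v) = v"
  using semigroup_S_add[of t "- t"] semigroup_S_add[of "- t" t]
  by (metis add.right_inverse add.left_inverse blinfun_apply_blinfun_compose id_blinfun.rep_eq id_apply semigroup_S_0)+

lemma semigroup_S_derivative: "(S has_vector_derivative - (A o\<^sub>L S t)) (at t within X)"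
proof -
  have "((\<lambda>t. exp (t *\<^sub>R Op (- A))) has_vector_derivative Op (- A) * exp (t *\<^sub>R Op (- A))) (at t within X)"
    by (rule has_vector_derivative_at_within[OF exp_scaleR_has_vector_derivative_left])
  from bounded_linear.has_vector_derivative[OF bounded_linear_op_of this]
  have "(S has_vector_derivative op_of (Op (- A) * exp (t *\<^sub>R Op (- A)))) (at t within X)"
    unfolding semigroup_S_eq[abs_def] .
  then show ?thesis
    by (simp add: times_ell2_op.rep_eq Op_inverse semigroup_S_eq bounded_bilinear.minus_left[OF bounded_bilinear_blinfun_compose])
qed

lemma semigroup_S_commute: "S t (A v) = A (S t v)"
proof -
  have "exp (t *\<^sub>R Op (- A)) * Op (- A) = Op (- A) * exp (t *\<^sub>R Op (- A))"
    by (simp add: exp_times_scaleR_commute)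
  then have "op_of (exp (t *\<^sub>R Op (- A)) * Op (- A)) = op_of (Op (- A) * exp (t *\<^sub>R Op (- A)))" by simp
  then have "S t o\<^sub>L (- A) = (- A) o\<^sub>L S t"
    by (simp add: times_ell2_op.rep_eq Op_inverse semigroup_S_eq)
  then have "(S t o\<^sub>L (- A)) v = ((- A) o\<^sub>L S t) v" by simp
  then show ?thesis by (simp add: blinfun.minus_left blinfun.minus_right)
qed

lemma semigroup_S_apply_derivative:
  assumes "(f has_vector_derivative f') (at t within X)"
  shows "((\<lambda>t. S t (f t)) has_vector_derivative S t f' - A (S t (f t))) (at t within X)"
  using bounded_bilinear.has_vector_derivative[OF bounded_bilinear_blinfun_apply semigroup_S_derivative assms]
  by (simp add: blinfun.minus_left)

lemma semigroup_S_reflect_derivative: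
  "((\<lambda>t. S (c - t)) has_vector_derivative A o\<^sub>L S (c - t)) (at t within X)"
proof -
  have "((\<lambda>t. c - t) has_vector_derivative - 1) (at t)"
    by (auto intro!: derivative_eq_intros)
  from vector_diff_chain_at[OF this semigroup_S_derivative]
  have "((\<lambda>t. S (c - t)) has_vector_derivative A o\<^sub>L S (c - t)) (at t)"
    by (simp add: comp_def)
  then show ?thesis by (rule has_vector_derivative_at_within)
qed

lemma semigroup_S_reflect_apply_derivative:
  assumes "(f has_vector_derivative f') (at t within X)"
  shows "((\<lambda>t. S (- t) (f t)) has_vector_derivative S (- t) f' + A (S (- t) (f t))) (at t within X)"
  using bounded_bilinear.has_vector_derivative[OF bounded_bilinear_blinfun_apply semigroup_S_reflect_derivative[of 0] assms]
  by simp

lemma semigroup_S_reflect_continuous [continuous_intros]: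
  "continuous_on X (\<lambda>r. S (c - r))"
  using semigroup_S_reflect_derivative by (rule continuous_on_vector_derivative)

definition duhamel :: "ell2 \<Rightarrow> (real \<Rightarrow> ell2) \<Rightarrow> real \<Rightarrow> ell2" where
  "duhamel x b t = S t x + integral {0..t} (\<lambda>r. S (t - r) (b r))"

text \<open>Since \<open>A\<close> is bounded, \<open>S\<close> is a group and
  \<open>S (t - r)\<close> factors as \<open>S t\<close> after \<open>S (- r)\<close>; so
  \<open>S t\<close> leaves the integral and the product rule applies.\<close>

lemma duhamel_derivative:
  assumes b: "continuous_on {0..T} b" and t: "t \<in> {0..T}"
  shows "(duhamel x b has_vector_derivative b t - A (duhamel x b t)) (at t within {0..T})"
proof -
  have c: "continuous_on {0..T} (\<lambda>r. S (0 - r) (b r))"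
    by (intro continuous_intros b)
  define k where "k t = x + integral {0..t} (\<lambda>r. S (0 - r) (b r))" for t
  have eq: "duhamel x b t = S t (k t)" if "t \<in> {0..T}" for t
  proof -
    have "integral {0..t} ((\<lambda>v. S t v) \<circ> (\<lambda>r. S (0 - r) (b r))) = S t (integral {0..t} (\<lambda>r. S (0 - r) (b r)))"
      using that
      by (intro integral_linear[OF integrable_continuous_real blinfun.bounded_linear_right] continuous_on_subset[OF c]) auto
    moreover have "S (t - r) (b r) = S t (S (0 - r) (b r))" for r
      using semigroup_S_add[of t "0 - r"] by simp
    ultimately show ?thesis by (simp add: duhamel_def k_def blinfun.add_right comp_def)
  qed
  have "(k has_vector_derivative S (0 - t) (b t)) (at t within {0..T})"
    unfolding k_def
    using has_vector_derivative_add[OF has_vector_derivative_const[of x] integral_has_vector_derivative[OF c t]]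
    by simp
  from semigroup_S_apply_derivative[OF this]
  have "((\<lambda>t. S t (k t)) has_vector_derivative b t - A (duhamel x b t)) (at t within {0..T})"
    by (simp add: eq[OF t] semigroup_S_inverse)
  then show ?thesis
    by (rule has_vector_derivative_transform[OF t _ , rotated]) (simp add: eq)
qed

lemma duhamel_0 [simp]: "duhamel x b 0 = x"
  by (simp add: duhamel_def)

lemma duhamel_integral_equation:
  assumes b: "continuous_on {0..T} b" and t: "t \<in> {0..T}"
  shows "duhamel x b t = x + integral {0..t} (\<lambda>r. b r - A (duhamel x b r))"
proof -
  have "((\<lambda>r. b r - A (duhamel x b r)) has_integral duhamel x b t - duhamel x b 0) {0..t}"
    by (rule fundamental_theorem_of_calculus)
      (use t in \<open>auto intro!: has_vector_derivative_within_subset[OF duhamel_derivative[OF b]]\<close>)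
  then show ?thesis by (simp add: integral_unique)
qed

text \<open>Pulling the difference of the two functions back by \<open>S (- r)\<close> makes its
  derivative vanish, because \<open>S\<close> and \<open>A\<close> commute.\<close>

lemma duhamel_unique:
  assumes b: "continuous_on {0..T} b" and v: "continuous_on {0..T} v"
    and eq: "\<And>t. t \<in> {0..T} \<Longrightarrow> v t = x + integral {0..t} (\<lambda>r. b r - A (v r))" and t: "t \<in> {0..T}"
  shows "v t = duhamel x b t"
proof -
  have dv: "(v has_vector_derivative b r - A (v r)) (at r within {0..T})" if r: "r \<in> {0..T}" for r
  proof -
    have "((\<lambda>t. x + integral {0..t} (\<lambda>r. b r - A (v r))) has_vector_derivative b r - A (v r)) (at r within {0..T})"
    proof -
      have "continuous_on {0..T} (\<lambda>r. b r - A (v r))" by (intro continuous_intros b v)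
      from has_vector_derivative_add[OF has_vector_derivative_const[of x] integral_has_vector_derivative[OF this r]]
      show ?thesis by simp
    qed
    then show ?thesis by (rule has_vector_derivative_transform[OF r _, rotated]) (simp add: eq)
  qed
  define k where "k r = S (- r) (v r - duhamel x b r)" for r
  have "(k has_vector_derivative 0) (at r within {0..T})" if r: "r \<in> {0..T}" for r
  proof -
    from semigroup_S_reflect_apply_derivative[OF has_vector_derivative_diff[OF dv[OF r] duhamel_derivative[OF b r]]]
    have "(k has_vector_derivative S (- r) (b r - A (v r) - (b r - A (duhamel x b r))) +
        A (S (- r) (v r - duhamel x b r))) (at r within {0..T})"
      unfolding k_def[abs_def] .
    moreover have "b r - A (v r) - (b r - A (duhamel x b r)) = - A (v r - duhamel x b r)"
      by (simp add: blinfun.diff_right)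
    ultimately show ?thesis
      by (simp add: blinfun.minus_right semigroup_S_commute)
  qed
  then obtain c where c: "\<And>r. r \<in> {0..T} \<Longrightarrow> k r = c"
    using has_vector_derivative_zero_constant[of "{0..T}" k] by auto
  have "v 0 = x" using eq[of 0] t by simp
  then have "k t = 0" using c[of 0] c[OF t] t by (simp add: k_def)
  then have "S t (S (- t) (v t - duhamel x b t)) = 0" by (simp add: k_def)
  then show ?thesis by (simp add: semigroup_S_inverse)
qed

end

section \<open>Convolution of the semigroup with the Young integral\<close>

text \<open>Permits replacing a path by an extension that agrees with it on the interval of
  integration.\<close>

lemma frac_deriv_left_cong:
  assumes "\<And>q. s < q \<Longrightarrow> q \<le> r \<Longrightarrow> z q = z' q" "s < r"
  shows "frac_deriv_left a s z r = frac_deriv_left a s z' r"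
proof -
  have "(LINT q:{s<..<r}|lborel. (z r - z q) / (r - q) powr (1 + a)) =
      (LINT q:{s<..<r}|lborel. (z' r - z' q) / (r - q) powr (1 + a))"
    using assms by (intro set_lebesgue_integral_cong) auto
  then show ?thesis using assms by (simp add: frac_deriv_left_def)
qed

lemma frac_deriv_right_cong:
  assumes "\<And>q. r \<le> q \<Longrightarrow> q \<le> t \<Longrightarrow> w q = w' q" "r < t"
  shows "frac_deriv_right a t w r = frac_deriv_right a t w' r"
proof -
  have "(LINT q:{r<..<t}|lborel. (w r - w q) / (q - r) powr (2 - a)) =
      (LINT q:{r<..<t}|lborel. (w' r - w' q) / (q - r) powr (2 - a))"
    using assms by (intro set_lebesgue_integral_cong) auto
  then show ?thesis using assms by (simp add: frac_deriv_right_def)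
qed

text \<open>By additivity an increment is itself an integral over a short interval, and the Young
  estimate makes it Hoelder of order \<open>b'\<close>.\<close>

lemma young_diag_continuous:
  assumes ab: "0 < a" "a < b" "b < 1" "1 - a < b'"
    and g: "bounded_Holder b g" and w: "bounded_Holder b' w"
  shows "continuous_on {s..t} (\<lambda>r. young_diag a s r g w)"
proof -
  have pos: "0 < b" "0 < b'" using ab by auto
  have c: "continuous_on UNIV g" "continuous_on UNIV w"
    using g w pos by (auto intro: bounded_Holder_continuous)
  obtain C C0 where C: "\<And>r q. norm (g r - g q) \<le> C * \<bar>r - q\<bar> powr b" "\<And>r. norm (g r) \<le> C0" "0 \<le> C" "0 \<le> C0"
    using bounded_HolderE[OF g] by metis
  obtain C' where C': "\<And>r q. norm (w r - w q) \<le> C' * \<bar>r - q\<bar> powr b'" "0 \<le> C'"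
    using bounded_HolderE[OF w] by metis
  let ?K = "young_bound a b b' / (1 - a) * C'"
  have K: "0 \<le> ?K" using young_bound_nonneg[of a b b'] ab C' by simp
  have le: "norm (young_diag a s r g w - young_diag a s q g w) \<le> (?K * (C0 + C * (t - s) powr b)) * \<bar>r - q\<bar> powr b'"
    if "s \<le> q" "q \<le> r" "r \<le> t" for r q
  proof -
    have "norm (young_diag a s r g w - young_diag a s q g w) = norm (young_diag a q r g w)"
      using young_diag_combine[OF ab g w that(1,2)] by (metis add_diff_cancel_left')
    also have "\<dots> \<le> ?K * (C0 * (r - q) powr b' + C * (r - q) powr (b + b'))"
      by (rule young_diag_estimate(2)[OF ab that(2) c]) (use C C' in auto)
    also have "\<dots> = ?K * (C0 + C * (r - q) powr b) * (r - q) powr b'"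
      by (simp add: powr_add algebra_simps add_divide_distrib)
    also have "\<dots> \<le> ?K * (C0 + C * (t - s) powr b) * (r - q) powr b'"
      using that C K pos by (intro mult_right_mono mult_left_mono add_left_mono powr_mono2) auto
    finally show ?thesis using that by simp
  qed
  show ?thesis
  proof (rule Holder_continuous_on[OF pos(2)])
    fix r q assume "r \<in> {s..t}" "q \<in> {s..t}"
    then show "norm (young_diag a s r g w - young_diag a s q g w) \<le> (?K * (C0 + C * (t - s) powr b)) * \<bar>r - q\<bar> powr b'"
      using le[of q r] le[of r q] by (cases "q \<le> r") (auto simp: norm_minus_commute abs_minus_commute)
  qed
qed

lemma integral_coord:
  fixes y :: "real \<Rightarrow> ell2"
  assumes "continuous_on {s..t} y"
  shows "coord (integral {s..t} y) j = (LINT r:{s<..<t}|lborel. coord (y r) j)"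
proof -
  have "coord (integral {s..t} y) j = integral {s..t} (\<lambda>r. coord (y r) j)"
    using integral_linear[OF integrable_continuous_real[OF assms] bounded_linear_coord[of j]]
    by (simp add: comp_def)
  also have "\<dots> = integral {s<..<t} (\<lambda>r. coord (y r) j)"
    by (simp add: integral_open_interval_real)
  also have "\<dots> = (LINT r:{s<..<t}|lborel. coord (y r) j)"
    by (rule set_borel_integral_eq_integral(2)[symmetric])
      (intro set_integrable_continuous continuous_intros assms)
  finally show ?thesis .
qed

text \<open>Entry \<open>(j, i)\<close> of the integrand is the smooth function
  \<open>coord (S (t - r) (unit_vec i)) j\<close> times \<open>coord (g r) i\<close>, so integration
  by parts against a smooth factor applies to each entry. Summing over \<open>i\<close> reassembles
  row \<open>j\<close> of \<open>A S (t - r)\<close> acting on the path of integrals.\<close>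

lemma young_integral_convolution:
  fixes D :: "real \<Rightarrow> ell2 \<Rightarrow>\<^sub>L ell2"
  assumes ab: "0 < a" "a < b" "b < 1" "1 - a < b'" and t: "0 \<le> t"
    and g: "bounded_Holder b g" and w: "bounded_Holder b' w"
    and diag: "\<And>r i. r \<in> {0..t} \<Longrightarrow> D r (unit_vec i) = coord (g r) i *\<^sub>R unit_vec i"
    and om: "\<And>r. r \<in> {0..t} \<Longrightarrow> \<omega> r = w r"
  shows "young_integral a 0 t (\<lambda>r. semigroup_S \<nu> l (t - r) o\<^sub>L D r) \<omega> =
    young_diag a 0 t g w -
    integral {0..t} (\<lambda>r. op_A_shifted \<nu> l (semigroup_S \<nu> l (t - r) (young_diag a 0 r g w)))"
proof -
  let ?S = "semigroup_S \<nu> l" and ?A = "op_A_shifted \<nu> l"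
  define Y where "Y r = young_diag a 0 r g w" for r
  have cY: "continuous_on {0..t} Y" unfolding Y_def by (rule young_diag_continuous[OF ab g w])
  have cB: "continuous_on {0..t} (\<lambda>r. ?A o\<^sub>L ?S (t - r))"
    by (intro continuous_intros bounded_bilinear.continuous_on[OF bounded_bilinear_blinfun_compose])
  define y where "y = Y t - integral {0..t} (\<lambda>r. (?A o\<^sub>L ?S (t - r)) (Y r))"
  have cy: "coord y j = coord (Y t) j - (LINT r:{0<..<t}|lborel. coord ((?A o\<^sub>L ?S (t - r)) (Y r)) j)" for j
    unfolding y_def coord_diff
    by (subst integral_coord) (intro continuous_intros cB cY, simp)
  obtain C C0 C' where C: "\<And>i r q. \<bar>coord (g r) i - coord (g q) i\<bar> \<le> C * \<bar>r - q\<bar> powr b"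
    "\<And>i r. \<bar>coord (g r) i\<bar> \<le> C0" "\<And>i r q. \<bar>coord (w r) i - coord (w q) i\<bar> \<le> C' * \<bar>r - q\<bar> powr b'"
    by (rule coord_bounded_Holder[OF ab g w]) (rule that)
  have entry: "(LINT r:{0<..<t}|lborel.
        frac_deriv_left a 0 (\<lambda>q. inner (unit_vec j) ((?S (t - q) o\<^sub>L D q) (unit_vec i))) r *
        frac_deriv_right a t (\<lambda>q. inner (unit_vec i) (\<omega> q)) r) =
      (LINT r:{0<..<t}|lborel. coord ((?A o\<^sub>L ?S (t - r)) (unit_vec i)) j * coord (Y r) i) -
      (if i = j then coord (Y t) j else 0)" for i j
  proof -
    have "(LINT r:{0<..<t}|lborel.
        frac_deriv_left a 0 (\<lambda>q. inner (unit_vec j) ((?S (t - q) o\<^sub>L D q) (unit_vec i))) r *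
        frac_deriv_right a t (\<lambda>q. inner (unit_vec i) (\<omega> q)) r) =
       - frac_integral a 0 t (\<lambda>q. coord (?S (t - q) (unit_vec i)) j * coord (g q) i) (\<lambda>q. coord (w q) i)"
      unfolding frac_integral_def minus_minus
    proof (intro set_lebesgue_integral_cong allI impI arg_cong2[where f="(*)"])
      fix r assume r: "r \<in> {0<..<t}"
      show "frac_deriv_left a 0 (\<lambda>q. inner (unit_vec j) ((?S (t - q) o\<^sub>L D q) (unit_vec i))) r =
          frac_deriv_left a 0 (\<lambda>q. coord (?S (t - q) (unit_vec i)) j * coord (g q) i) r"
        by (rule frac_deriv_left_cong)
          (use r in \<open>auto simp: inner_unit_vec' diag blinfun.scaleR_right\<close>)
      show "frac_deriv_right a t (\<lambda>q. inner (unit_vec i) (\<omega> q)) r = frac_deriv_right a t (\<lambda>q. coord (w q) i) r"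
        by (rule frac_deriv_right_cong) (use r in \<open>auto simp: inner_unit_vec' om\<close>)
    qed simp
    also have "frac_integral a 0 t (\<lambda>q. coord (?S (t - q) (unit_vec i)) j * coord (g q) i) (\<lambda>q. coord (w q) i) =
      coord (?S (t - t) (unit_vec i)) j * frac_integral a 0 t (\<lambda>q. coord (g q) i) (\<lambda>q. coord (w q) i) -
      (LINT r:{0<..<t}|lborel. coord ((?A o\<^sub>L ?S (t - r)) (unit_vec i)) j *
         frac_integral a 0 r (\<lambda>q. coord (g q) i) (\<lambda>q. coord (w q) i))"
    proof (rule frac_integral_mult_C1[OF ab C])
      fix q :: real
      have "((\<lambda>q. ?S (t - q) (unit_vec i)) has_vector_derivative (?A o\<^sub>L ?S (t - q)) (unit_vec i)) (at q)"
        by (rule bounded_linear.has_vector_derivative[OF blinfun.bounded_linear_left semigroup_S_reflect_derivative])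
      from bounded_linear.has_vector_derivative[OF bounded_linear_coord[of j] this]
      show "((\<lambda>q. coord (?S (t - q) (unit_vec i)) j) has_real_derivative coord ((?A o\<^sub>L ?S (t - q)) (unit_vec i)) j) (at q)"
        by (simp add: has_real_derivative_iff_has_vector_derivative)
    next
      show "continuous_on UNIV (\<lambda>q. coord ((?A o\<^sub>L ?S (t - q)) (unit_vec i)) j)"
        by (intro continuous_intros bounded_bilinear.continuous_on[OF bounded_bilinear_blinfun_compose])
    qed fact
    also have "(LINT r:{0<..<t}|lborel. coord ((?A o\<^sub>L ?S (t - r)) (unit_vec i)) j *
         frac_integral a 0 r (\<lambda>q. coord (g q) i) (\<lambda>q. coord (w q) i)) =
       (LINT r:{0<..<t}|lborel. coord ((?A o\<^sub>L ?S (t - r)) (unit_vec i)) j * coord (Y r) i)"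
      by (intro set_lebesgue_integral_cong) (auto simp: Y_def coord_young_diag[OF ab g w])
    \<comment> \<open>\<open>S 0\<close> is the identity, so the boundary term survives on the
      diagonal only.\<close>
    also have "coord (?S (t - t) (unit_vec i)) j * frac_integral a 0 t (\<lambda>q. coord (g q) i) (\<lambda>q. coord (w q) i) =
        (if i = j then coord (Y t) j else 0)"
      using t by (simp add: unit_vec.rep_eq Y_def coord_young_diag[OF ab g w])
    finally show ?thesis by simp
  qed
  have row: "(\<Sum>\<^sub>\<infinity>i. LINT r:{0<..<t}|lborel.
        frac_deriv_left a 0 (\<lambda>q. inner (unit_vec j) ((?S (t - q) o\<^sub>L D q) (unit_vec i))) r *
        frac_deriv_right a t (\<lambda>q. inner (unit_vec i) (\<omega> q)) r) = - coord y j" for j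
  proof -
    have "((\<lambda>i. if i = j then coord (Y t) j else 0) has_sum coord (Y t) j) UNIV"
      using has_sum_finite[of "{j}" "\<lambda>i. if i = j then coord (Y t) j else 0"]
      by (subst has_sum_cong_neutral[of "{j}" UNIV _ "\<lambda>i. if i = j then coord (Y t) j else 0"]) auto
    then have "((\<lambda>i. - (if i = j then coord (Y t) j else 0)) has_sum - coord (Y t) j) UNIV"
      by (simp only: has_sum_uminus minus_minus)
    from has_sum_add[OF has_sum_integral_matrix_row[OF cB cY, of j] this]
    show ?thesis unfolding entry by (simp add: cy infsumI)
  qed
  \<comment> \<open>The outer minus sign of \<open>young_integral\<close> cancels the one in
    \<open>row\<close>.\<close>
  have "((\<lambda>j. (- coord y j) *\<^sub>R unit_vec j) has_sum (- y)) UNIV"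
    using unit_vec_expansion[of "- y"] by simp
  then have "young_integral a 0 t (\<lambda>r. ?S (t - r) o\<^sub>L D r) \<omega> = y"
    unfolding young_integral_def row by (simp add: infsumI)
  then show ?thesis unfolding y_def Y_def by simp
qed

section \<open>The fixed point argument\<close>

text \<open>The denominator \<open>Q + 1\<close> covers \<open>Q = 0\<close>; the minimum with 1 is
  taken because the local estimates assume \<open>d\<close> at most 1.\<close>

lemma small_step_exists:
  fixes \<gamma> Q \<epsilon> :: real
  assumes "0 < \<gamma>" "0 \<le> Q" "0 < \<epsilon>"
  obtains d where "0 < d" "d \<le> 1" "d powr \<gamma> * Q \<le> \<epsilon>"
proof -
  define e where "e = \<epsilon> / (Q + 1)"
  have e: "0 < e" using assms by (simp add: e_def)
  define d where "d = min 1 (e powr (1 / \<gamma>))"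
  have d: "0 < d" "d \<le> 1" using e by (auto simp: d_def)
  have "d powr \<gamma> \<le> (e powr (1 / \<gamma>)) powr \<gamma>"
    using d assms by (intro powr_mono2) (auto simp: d_def)
  also have "\<dots> = e" using assms e by (simp add: powr_powr)
  finally have "d powr \<gamma> * Q \<le> e * Q" using assms by (intro mult_right_mono) auto
  also have "\<dots> \<le> \<epsilon>" using assms by (simp add: e_def field_simps)
  finally show thesis using that d by blast
qed

text \<open>The equation freed of its origin: \<open>F\<close> will be the drift minus
  \<open>A\<close>, and \<open>N\<close> the superposition operator of \<open>h\<close>. The last
  assumption controls Hoelder increments of \<open>N u - N v\<close>, for which Lipschitz continuity
  of \<open>N\<close> does not suffice.\<close>

locale young_equation =
  fixes a b b' T L D M :: real and F N :: "ell2 \<Rightarrow> ell2" and w :: "real \<Rightarrow> ell2" and x :: ell2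
  assumes ab: "0 < a" "a < b" "b < 1" "1 - a < b'" and bb': "b < b'" "b' \<le> 1" and T: "0 < T"
    and w: "bounded_Holder b' w"
    and L: "0 \<le> L" "\<And>u v. norm (F u - F v) \<le> L * norm (u - v)"
    and D: "0 \<le> D" "\<And>u v. norm (N u - N v) \<le> D * norm (u - v)"
    and M: "0 \<le> M" "\<And>u v p q. norm ((N u - N v) - (N p - N q)) \<le>
      D * norm ((u - v) - (p - q)) + M * norm (p - q) * norm (v - q)"
begin

text \<open>Freezing time outside \<open>[0, T]\<close> extends paths to the line without increasing
  their Hoelder constants.\<close>

definition clamp :: "real \<Rightarrow> real" where "clamp t = max 0 (min T t)"

lemma clamp_range: "clamp t \<in> {0..T}" using T by (auto simp: clamp_def)
lemma clamp_id: "t \<in> {0..T} \<Longrightarrow> clamp t = t" by (auto simp: clamp_def)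
lemma clamp_contraction: "\<bar>clamp r - clamp q\<bar> \<le> \<bar>r - q\<bar>" by (auto simp: clamp_def max_def min_def)
lemma clamp_clamp: "clamp (clamp t) = clamp t" using clamp_range clamp_id by blast

definition picard :: "(real \<Rightarrow> ell2) \<Rightarrow> real \<Rightarrow> ell2" where
  "picard u t = x + integral {0..clamp t} (\<lambda>r. F (u r)) + young_diag a 0 (clamp t) (\<lambda>r. N (u r)) w"

lemma pos: "0 < b" "0 < b'" using ab by auto

lemma young_diag_trivial [simp]: "young_diag a s s g w = 0"
proof (rule ell2_eqI)
  have "(\<lambda>i. 0\<^sup>2 :: real) summable_on (UNIV :: int set)" by simp
  then show "coord (young_diag a s s g w) i = coord 0 i" for i
    unfolding young_diag_def frac_integral_def
    by (subst coord_Abs_ell2) (simp_all add: set_lebesgue_integral_def)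
qed

lemma picard_0: "picard u 0 = x"
  using T by (simp add: picard_def clamp_def)

lemma picard_clamp: "picard u (clamp t) = picard u t"
  by (simp add: picard_def clamp_clamp)

lemma superposition_bounded_Holder:
  assumes "bounded_Holder b u"
  shows "bounded_Holder b (\<lambda>r. N (u r))"
proof -
  obtain C C0 where C: "\<And>r q. norm (u r - u q) \<le> C * \<bar>r - q\<bar> powr b" "\<And>r. norm (u r) \<le> C0"
    using bounded_HolderE[OF assms] by metis
  have "norm (N (u r) - N (u q)) \<le> (D * C) * \<bar>r - q\<bar> powr b" for r q
    using order_trans[OF D(2) mult_left_mono[OF C(1) D(1)]] by (simp add: mult.assoc)
  moreover have "norm (N (u r)) \<le> norm (N 0) + D * C0" for r
  proof -
    have "norm (N (u r)) \<le> norm (N 0) + norm (N (u r) - N 0)"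
      using norm_triangle_ineq[of "N 0" "N (u r) - N 0"] by simp
    also have "norm (N (u r) - N 0) \<le> D * C0"
      using order_trans[OF D(2)[of "u r" 0] mult_left_mono[OF _ D(1)]] C(2)[of r] by simp
    finally show ?thesis by simp
  qed
  ultimately show ?thesis unfolding bounded_Holder_def by blast
qed

lemma F_continuous:
  assumes "bounded_Holder b u"
  shows "continuous_on X (\<lambda>r. F (u r))"
proof -
  have "L-lipschitz_on UNIV F"
    by (rule lipschitz_onI) (use L in \<open>auto simp: dist_norm\<close>)
  then have "continuous_on UNIV F" by (rule lipschitz_on_continuous_on)
  moreover have "continuous_on X u"
    using bounded_Holder_continuous[OF pos(1) assms] continuous_on_subset by blast
  ultimately show ?thesis by (intro continuous_on_compose2[of UNIV F X u]) auto
qed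

lemma picard_increment:
  assumes u: "bounded_Holder b u" and st: "0 \<le> s" "s \<le> t" "t \<le> T"
  shows "picard u t - picard u s = integral {s..t} (\<lambda>r. F (u r)) + young_diag a s t (\<lambda>r. N (u r)) w"
proof -
  have "integral {0..s} (\<lambda>r. F (u r)) + integral {s..t} (\<lambda>r. F (u r)) = integral {0..t} (\<lambda>r. F (u r))"
    by (rule Henstock_Kurzweil_Integration.integral_combine)
      (use st in \<open>auto intro!: integrable_continuous_real F_continuous u\<close>)
  moreover have "young_diag a 0 s (\<lambda>r. N (u r)) w + young_diag a s t (\<lambda>r. N (u r)) w = young_diag a 0 t (\<lambda>r. N (u r)) w"
    by (rule young_diag_combine[OF ab superposition_bounded_Holder[OF u] w st(1,2)])
  ultimately show ?thesis
    using st by (simp add: picard_def clamp_id algebra_simps)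
qed

text \<open>Choosing one Hoelder constant of \<open>w\<close> once makes \<open>K\<close> below a
  constant of the locale.\<close>

definition W :: real where "W = (SOME W. 0 \<le> W \<and> (\<forall>r q. norm (w r - w q) \<le> W * \<bar>r - q\<bar> powr b'))"

lemma W: "0 \<le> W" "norm (w r - w q) \<le> W * \<bar>r - q\<bar> powr b'"
proof -
  have "\<exists>W. 0 \<le> W \<and> (\<forall>r q. norm (w r - w q) \<le> W * \<bar>r - q\<bar> powr b')"
    using bounded_HolderE[OF w] by metis
  from someI_ex[OF this] show "0 \<le> W" "norm (w r - w q) \<le> W * \<bar>r - q\<bar> powr b'"
    unfolding W_def[symmetric] by auto
qed

definition K :: real where "K = young_bound a b b' / (1 - a) * W"

lemma K: "0 \<le> K"
  unfolding K_def using young_bound_nonneg[of a b b'] ab W by simp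

text \<open>The source of smallness: for \<open>c\<close> at least \<open>b'\<close> and length at
  most \<open>d\<close>, with \<open>d\<close> at most 1, \<open>(t - s)^c\<close> is at most
  \<open>d^(b' - b) (t - s)^b\<close>. The Young terms have \<open>c = b'\<close> and
  \<open>c = b + b'\<close>, the drift has \<open>c = 1\<close>, where \<open>b'\<close> at most 1
  enters.\<close>

lemma local_estimate:
  assumes st: "s \<le> t" "t - s \<le> d" and d: "0 < d" "d \<le> 1"
    and phi: "continuous_on {s..t} \<phi>" "\<And>r. r \<in> {s..t} \<Longrightarrow> norm (\<phi> r) \<le> P"
    and g: "bounded_Holder b g" "\<And>r. r \<in> {s..t} \<Longrightarrow> norm (g r) \<le> G0"
      "\<And>r q. r \<in> {s..t} \<Longrightarrow> q \<in> {s..t} \<Longrightarrow> norm (g r - g q) \<le> G1 * \<bar>r - q\<bar> powr b"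
    and nn: "0 \<le> P" "0 \<le> G0" "0 \<le> G1"
  shows "norm (integral {s..t} \<phi> + young_diag a s t g w) \<le>
    d powr (b' - b) * (P + K * (G0 + G1)) * (t - s) powr b"
proof -
  have split: "(t - s) powr c \<le> d powr (b' - b) * (t - s) powr b" if c: "b' \<le> c" for c
  proof (cases "s = t")
    case False
    have "(t - s) powr c = (t - s) powr (c - b) * (t - s) powr b"
      by (simp add: powr_add[symmetric])
    also have "\<dots> \<le> d powr (c - b) * (t - s) powr b"
      using st bb' c by (intro mult_right_mono powr_mono2) auto
    also have "\<dots> \<le> d powr (b' - b) * (t - s) powr b"
      using d c by (intro mult_right_mono powr_mono') auto
    finally show ?thesis .
  qed simp
  have "norm (integral {s..t} \<phi>) \<le> P * (t - s)"
    by (rule integral_bound) (use st phi in auto)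
  also have "\<dots> \<le> P * (d powr (b' - b) * (t - s) powr b)"
    using split[of 1] bb' st nn by (intro mult_left_mono) auto
  finally have 1: "norm (integral {s..t} \<phi>) \<le> P * (d powr (b' - b) * (t - s) powr b)" .
  have "norm (young_diag a s t g w) \<le> K * (G0 * (t - s) powr b' + G1 * (t - s) powr (b + b'))"
    unfolding K_def
    by (rule young_diag_estimate(2)[OF ab st(1) bounded_Holder_continuous[OF pos(1) g(1)]
        bounded_Holder_continuous[OF pos(2) w]]) (use g W in auto)
  also have "\<dots> \<le> K * (G0 * (d powr (b' - b) * (t - s) powr b) + G1 * (d powr (b' - b) * (t - s) powr b))"
    using K nn pos by (intro mult_left_mono add_mono split) auto
  finally have 2: "norm (young_diag a s t g w) \<le>
      K * (G0 * (d powr (b' - b) * (t - s) powr b) + G1 * (d powr (b' - b) * (t - s) powr b))" .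
  show ?thesis
    using norm_triangle_ineq[of "integral {s..t} \<phi>" "young_diag a s t g w"] 1 2
    by (simp add: algebra_simps)
qed

section \<open>Exponentially weighted Hoelder bounds\<close>

text \<open>The exponential weight makes the Picard map a contraction on all of \<open>[0, T]\<close> at once, once the
  step \<open>d\<close> is small; the increments are only compared over distances at most \<open>d\<close>.\<close>

definition wh :: "real \<Rightarrow> real \<Rightarrow> (real \<Rightarrow> ell2) \<Rightarrow> bool" where
  "wh d k u \<longleftrightarrow> (\<forall>s t. 0 \<le> s \<longrightarrow> s \<le> t \<longrightarrow> t \<le> T \<longrightarrow> t - s \<le> d \<longrightarrow>
     norm (u t - u s) \<le> k * exp (t / d) * (t - s) powr b)"

lemma whD:
  "wh d k u \<Longrightarrow> 0 \<le> s \<Longrightarrow> s \<le> t \<Longrightarrow> t \<le> T \<Longrightarrow> t - s \<le> d \<Longrightarrow>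
     norm (u t - u s) \<le> k * exp (t / d) * (t - s) powr b"
  by (simp add: wh_def)

lemma whI:
  "(\<And>s t. 0 \<le> s \<Longrightarrow> s \<le> t \<Longrightarrow> t \<le> T \<Longrightarrow> t - s \<le> d \<Longrightarrow>
     norm (u t - u s) \<le> k * exp (t / d) * (t - s) powr b) \<Longrightarrow> wh d k u"
  by (simp add: wh_def)

lemma wh_mono:
  assumes "wh d k u" "k \<le> k'"
  shows "wh d k' u"
proof (rule whI)
  fix s t assume st: "0 \<le> s" "s \<le> t" "t \<le> T" "t - s \<le> d"
  have "k * exp (t / d) * (t - s) powr b \<le> k' * exp (t / d) * (t - s) powr b"
    using assms(2) by (intro mult_right_mono) auto
  with whD[OF assms(1) st] show "norm (u t - u s) \<le> k' * exp (t / d) * (t - s) powr b"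
    by (rule order_trans)
qed

lemma wh_cong:
  assumes "wh d k u" "\<And>t. t \<in> {0..T} \<Longrightarrow> u t = v t"
  shows "wh d k v"
  by (rule whI) (use whD[OF assms(1)] assms(2) in fastforce)

lemma wh_add:
  assumes "wh d k u" "wh d k' v"
  shows "wh d (k + k') (\<lambda>t. u t + v t)"
  unfolding wh_def
proof (intro allI impI)
  fix s t assume st: "0 \<le> s" "s \<le> t" "t \<le> T" "t - s \<le> d"
  have "norm (u t + v t - (u s + v s)) \<le> norm (u t - u s) + norm (v t - v s)"
    using norm_triangle_ineq[of "u t - u s" "v t - v s"] by (simp add: algebra_simps)
  also have "\<dots> \<le> k * exp (t / d) * (t - s) powr b + k' * exp (t / d) * (t - s) powr b"
    using assms st unfolding wh_def by (intro add_mono) auto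
  finally show "norm (u t + v t - (u s + v s)) \<le> (k + k') * exp (t / d) * (t - s) powr b"
    by (simp add: algebra_simps)
qed

lemma wh_minus_commute:
  assumes "wh d k (\<lambda>t. u t - v t)"
  shows "wh d k (\<lambda>t. v t - u t)"
proof (rule whI)
  fix s t assume st: "0 \<le> s" "s \<le> t" "t \<le> T" "t - s \<le> d"
  have "norm (v t - u t - (v s - u s)) = norm (u t - v t - (u s - v s))"
    by (subst norm_minus_cancel[symmetric]) (simp add: algebra_simps)
  then show "norm (v t - u t - (v s - u s)) \<le> k * exp (t / d) * (t - s) powr b"
    using whD[OF assms st] by simp
qed

lemma wh_limit:
  assumes "\<And>n. wh d k (U n)" "\<And>t. t \<in> {0..T} \<Longrightarrow> (\<lambda>n. U n t) \<longlonglongrightarrow> u t"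
  shows "wh d k u"
  unfolding wh_def
proof (intro allI impI)
  fix s t assume st: "0 \<le> s" "s \<le> t" "t \<le> T" "t - s \<le> d"
  have "(\<lambda>n. norm (U n t - U n s)) \<longlonglongrightarrow> norm (u t - u s)"
    using st by (intro tendsto_intros assms) auto
  then show "norm (u t - u s) \<le> k * exp (t / d) * (t - s) powr b"
    by (rule LIMSEQ_le_const2) (use assms(1) st in \<open>auto simp: wh_def\<close>)
qed

lemma wh_of_Holder:
  assumes "\<And>r q. norm (u r - u q) \<le> R * \<bar>r - q\<bar> powr b" "0 < d"
  shows "wh d R u"
  unfolding wh_def
proof (intro allI impI)
  fix s t assume st: "0 \<le> s" "s \<le> t" "t \<le> T" "t - s \<le> d"
  have R: "0 \<le> R" using order_trans[OF norm_ge_zero assms(1)[of 0 1]] by simp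
  have "norm (u t - u s) \<le> R * 1 * (t - s) powr b" using assms(1)[of t s] st by simp
  also have "\<dots> \<le> R * exp (t / d) * (t - s) powr b"
    using st assms(2) R by (intro mult_right_mono mult_left_mono) auto
  finally show "norm (u t - u s) \<le> R * exp (t / d) * (t - s) powr b" .
qed

text \<open>Walking back from \<open>t\<close> in steps of length \<open>d\<close>, the weight falls
  by the factor \<open>1/e\<close> per step, so the increments sum to at most twice the last one. A
  factor \<open>T / d\<close>, which would outweigh the gain in \<open>d\<close>, is thereby
  avoided.\<close>

lemma wh_sup:
  assumes u: "wh d k u" and k: "0 \<le> k" and d: "0 < d" "d \<le> 1" and t: "0 \<le> t" "t \<le> T"
  shows "norm (u t - u 0) \<le> 2 * k * exp (t / d) * d powr b"
proof -
  have "norm (u t - u 0) \<le> 2 * k * exp (t / d) * d powr b"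
    if "0 \<le> t" "t \<le> T" "t \<le> real n * d" for n t
    using that
  proof (induction n arbitrary: t)
    case 0
    then have "t = 0" by simp
    then show ?case using k by simp
  next
    case (Suc n)
    show ?case
    proof (cases "t \<le> d")
      case True
      have "norm (u t - u 0) \<le> k * exp (t / d) * t powr b"
        using whD[OF u, of 0 t] Suc.prems True by simp
      also have "\<dots> \<le> (2 * k) * exp (t / d) * d powr b"
        using k True Suc.prems pos by (intro mult_mono powr_mono2) auto
      finally show ?thesis .
    next
      case False
      have "norm (u (t - d) - u 0) \<le> 2 * k * exp ((t - d) / d) * d powr b"
        using Suc.prems False d by (intro Suc.IH) (auto simp: algebra_simps)
      also have "exp ((t - d) / d) = exp (t / d) * exp (- 1)"
      proof -
        have "(t - d) / d = t / d + (- 1)" using d by (simp add: diff_divide_distrib)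
        then show ?thesis by (simp only: exp_add)
      qed
      also have "2 * k * (exp (t / d) * exp (- 1)) * d powr b \<le> 2 * k * (exp (t / d) * (1 / 2)) * d powr b"
      proof -
        \<comment> \<open>The ratio \<open>1/e\<close> is at most \<open>1/2\<close>, which is the
          origin of the constant 2 in the bound.\<close>
        have "(2::real) \<le> exp 1" using exp_ge_add_one_self[of 1] by simp
        then have "exp (- 1 :: real) \<le> 1 / 2" by (simp add: exp_minus field_simps)
        then show ?thesis using k by (intro mult_right_mono mult_left_mono) auto
      qed
      finally have 1: "norm (u (t - d) - u 0) \<le> k * exp (t / d) * d powr b" by simp
      have 2: "norm (u t - u (t - d)) \<le> k * exp (t / d) * d powr b"
        using whD[OF u, of "t - d" t] False d Suc.prems by simp
      show ?thesis
        using norm_triangle_ineq[of "u t - u (t - d)" "u (t - d) - u 0"] 1 2 by simp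
    qed
  qed
  moreover have "t \<le> real (nat \<lceil>t / d\<rceil>) * d"
    using d t mult_right_mono[OF real_nat_ceiling_ge[of "t / d"], of d] by simp
  ultimately show ?thesis using t by blast
qed

lemma wh_sup_le:
  assumes u: "wh d k u" and k: "0 \<le> k" and d: "0 < d" "d \<le> 1" and t: "0 \<le> r" "r \<le> t" "t \<le> T"
  shows "norm (u r - u 0) \<le> 2 * k * exp (t / d)"
proof -
  have "norm (u r - u 0) \<le> 2 * k * exp (r / d) * d powr b"
    using wh_sup[OF u k d] t by auto
  also have "\<dots> \<le> 2 * k * exp (t / d) * 1"
    using k d t pos by (intro mult_mono) (auto simp: divide_right_mono powr_le_one_le intro: powr_le1)
  finally show ?thesis by simp
qed

text \<open>The weight at \<open>t\<close> dominates the weights at all earlier times, so on a short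
  interval the bound is an ordinary Hoelder bound.\<close>

lemma wh_local:
  assumes u: "wh d k u" and k: "0 \<le> k" and d: "0 < d" and st: "0 \<le> s" "t \<le> T" "t - s \<le> d"
    and r: "r \<in> {s..t}" and q: "q \<in> {s..t}"
  shows "norm (u r - u q) \<le> k * exp (t / d) * \<bar>r - q\<bar> powr b"
proof -
  have le: "norm (u r - u q) \<le> k * exp (t / d) * \<bar>r - q\<bar> powr b"
    if "q \<le> r" "r \<in> {s..t}" "q \<in> {s..t}" for r q
  proof -
    have "norm (u r - u q) \<le> k * exp (r / d) * (r - q) powr b"
      using whD[OF u, of q r] st that by simp
    also have "\<dots> \<le> k * exp (t / d) * (r - q) powr b"
      using k d that by (intro mult_right_mono mult_left_mono) (auto simp: divide_right_mono)
    finally show ?thesis using that by simp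
  qed
  show ?thesis using le[of q r] le[of r q] r q by (cases "q \<le> r") (auto simp: norm_minus_commute abs_minus_commute)
qed

text \<open>Beyond distance \<open>d\<close> both points are compared with time 0, each at the cost
  \<open>2 k exp (T / d) d^b\<close>; hence the 4.\<close>

lemma wh_Holder:
  assumes u: "wh d k u" and k: "0 \<le> k" and d: "0 < d" "d \<le> 1" and cl: "\<And>t. u (clamp t) = u t"
  shows "norm (u r - u q) \<le> 4 * k * exp (T / d) * \<bar>r - q\<bar> powr b"
proof -
  have le: "norm (u r - u q) \<le> 4 * k * exp (T / d) * \<bar>r - q\<bar> powr b"
    if "q \<le> r" "r \<in> {0..T}" "q \<in> {0..T}" for r q
  proof (cases "r - q \<le> d")
    case True
    have "norm (u r - u q) \<le> k * exp (r / d) * \<bar>r - q\<bar> powr b"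
      using wh_local[OF u k d(1), of q r r q] True that by auto
    also have "\<dots> \<le> (4 * k) * exp (T / d) * \<bar>r - q\<bar> powr b"
      using k d that by (intro mult_right_mono mult_mono) (auto simp: divide_right_mono)
    finally show ?thesis .
  next
    case False
    have s: "norm (u p - u 0) \<le> 2 * k * exp (T / d) * d powr b" if p: "p \<in> {0..T}" for p
    proof -
      have "norm (u p - u 0) \<le> 2 * k * exp (p / d) * d powr b"
        using wh_sup[OF u k d] p by auto
      also have "\<dots> \<le> 2 * k * exp (T / d) * d powr b"
        using k d p by (intro mult_right_mono mult_left_mono) (auto simp: divide_right_mono)
      finally show ?thesis .
    qed
    have "norm (u r - u q) \<le> norm (u r - u 0) + norm (u q - u 0)"
      using norm_triangle_ineq4[of "u r - u 0" "u q - u 0"] by simp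
    also have "\<dots> \<le> 4 * k * exp (T / d) * d powr b" using s[OF that(2)] s[OF that(3)] by simp
    also have "\<dots> \<le> 4 * k * exp (T / d) * \<bar>r - q\<bar> powr b"
      using False k d pos by (intro mult_left_mono powr_mono2) auto
    finally show ?thesis .
  qed
  have "norm (u (clamp r) - u (clamp q)) \<le> 4 * k * exp (T / d) * \<bar>clamp r - clamp q\<bar> powr b"
    using le[of "clamp q" "clamp r"] le[of "clamp r" "clamp q"] clamp_range[of r] clamp_range[of q]
    by (cases "clamp q \<le> clamp r") (auto simp: norm_minus_commute abs_minus_commute)
  also have "\<dots> \<le> 4 * k * exp (T / d) * \<bar>r - q\<bar> powr b"
    using k clamp_contraction pos by (intro mult_left_mono powr_mono2) auto
  finally show ?thesis by (simp add: cl)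
qed

lemma bounded_Holder_of_Holder:
  fixes u :: "real \<Rightarrow> ell2"
  assumes h: "\<And>r q. norm (u r - u q) \<le> R * \<bar>r - q\<bar> powr c" and c: "0 < c" and cl: "\<And>t. u (clamp t) = u t"
  shows "bounded_Holder c u"
proof -
  have R: "0 \<le> R" using order_trans[OF norm_ge_zero h[of 0 1]] by simp
  have "norm (u r) \<le> norm (u 0) + R * T powr c" for r
  proof -
    have "norm (u (clamp r)) \<le> norm (u 0) + norm (u (clamp r) - u 0)"
      using norm_triangle_ineq[of "u 0" "u (clamp r) - u 0"] by simp
    also have "norm (u (clamp r) - u 0) \<le> R * \<bar>clamp r - 0\<bar> powr c" by (rule h)
    also have "\<dots> \<le> R * T powr c"
      using clamp_range[of r] R c by (intro mult_left_mono powr_mono2) auto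
    finally show ?thesis by (simp add: cl)
  qed
  then show ?thesis using h unfolding bounded_Holder_def by blast
qed

section \<open>Estimates for the Picard map\<close>

text \<open>Collects the coefficients of 1, of \<open>norm x + 2 k\<close> and of \<open>k\<close>;
  the factor 2 comes from bounding \<open>norm x + 2 k\<close> by
  \<open>2 (1 + norm x + k)\<close>.\<close>

definition growth_const :: real where
  "growth_const = norm (F 0) + K * norm (N 0) + 2 * (L + K * D) + K * D"

lemma growth_const_nonneg: "0 \<le> growth_const"
  unfolding growth_const_def using K L D by simp

text \<open>The bound is affine in \<open>k\<close>, because Lipschitz continuity bounds the Hoelder
  increments of \<open>N u\<close> by those of \<open>u\<close>. The coefficient can thus be made
  small independently of the radius, which is what yields an invariant ball on all of
  \<open>[0, T]\<close>.\<close>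

lemma picard_growth:
  assumes u: "bounded_Holder b u" "u 0 = x" "wh d k u" and k: "0 \<le> k" and d: "0 < d" "d \<le> 1"
  shows "wh d (d powr (b' - b) * growth_const * (1 + norm x + k)) (picard u)"
  unfolding wh_def
proof (intro allI impI)
  fix s t assume st: "0 \<le> s" "s \<le> t" "t \<le> T" "t - s \<le> d"
  let ?e = "exp (t / d)"
  \<comment> \<open>The weight is at least 1, so constant terms may be multiplied by it.\<close>
  have e: "1 \<le> ?e" using st d by simp
  have e0: "0 \<le> ?e" by simp
  have sup: "norm (u r) \<le> ?e * (norm x + 2 * k)" if "r \<in> {s..t}" for r
  proof -
    have "norm (u r) \<le> norm x + norm (u r - u 0)"
      using norm_triangle_ineq[of x "u r - u 0"] u(2) by simp
    also have "\<dots> \<le> ?e * norm x + 2 * k * ?e"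
      using wh_sup_le[OF u(3) k d, of r t] that st mult_right_mono[OF e, of "norm x"]
      by (intro add_mono) auto
    finally show ?thesis by (simp add: algebra_simps)
  qed
  have lin: "norm (H (u r)) \<le> ?e * (norm (H 0) + C * (norm x + 2 * k))"
    if r: "r \<in> {s..t}" and H: "\<And>u v. norm (H u - H v) \<le> C * norm (u - v)" "0 \<le> C" for H :: "ell2 \<Rightarrow> ell2" and C r
  proof -
    have "norm (H (u r)) \<le> norm (H 0) + norm (H (u r) - H 0)"
      using norm_triangle_ineq[of "H 0" "H (u r) - H 0"] by simp
    also have "norm (H (u r) - H 0) \<le> C * norm (u r)" using H(1)[of "u r" 0] by simp
    also have "norm (H 0) + C * norm (u r) \<le> ?e * norm (H 0) + C * (?e * (norm x + 2 * k))"
      using H(2) sup[OF r] mult_right_mono[OF e, of "norm (H 0)"] by (intro add_mono mult_left_mono) auto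
    finally show ?thesis by (simp add: algebra_simps)
  qed
  have "norm (picard u t - picard u s) \<le> d powr (b' - b) *
      (?e * (norm (F 0) + L * (norm x + 2 * k)) + K * (?e * (norm (N 0) + D * (norm x + 2 * k)) + ?e * (D * k))) * (t - s) powr b"
    unfolding picard_increment[OF u(1) st(1-3)]
  proof (rule local_estimate[OF st(2,4) d F_continuous[OF u(1)] _ superposition_bounded_Holder[OF u(1)]])
    fix r q assume r: "r \<in> {s..t}" and q: "q \<in> {s..t}"
    have "norm (N (u r) - N (u q)) \<le> D * (k * ?e * \<bar>r - q\<bar> powr b)"
      using order_trans[OF D(2) mult_left_mono[OF wh_local[OF u(3) k d(1) st(1,3,4) r q] D(1)]] .
    then show "norm (N (u r) - N (u q)) \<le> ?e * (D * k) * \<bar>r - q\<bar> powr b" by (simp add: mult_ac)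
  qed (use lin L D k in auto)
  also have "\<dots> = d powr (b' - b) * (?e * (norm (F 0) + L * (norm x + 2 * k) + K * (norm (N 0) + D * (norm x + 2 * k) + D * k))) * (t - s) powr b"
    by (simp add: algebra_simps)
  also have "\<dots> \<le> d powr (b' - b) * (?e * (growth_const * (1 + norm x + k))) * (t - s) powr b"
  proof (intro mult_right_mono mult_left_mono)
    have p: "0 \<le> L" "0 \<le> K * D" "0 \<le> K * norm (N 0)" "0 \<le> norm (F 0)" using K L D by auto
    have "norm (F 0) + L * (norm x + 2 * k) + K * (norm (N 0) + D * (norm x + 2 * k) + D * k) =
      (norm (F 0) + K * norm (N 0)) * 1 + (L + K * D) * (norm x + 2 * k) + (K * D) * k"
      by (simp add: algebra_simps)
    also have "\<dots> \<le> (norm (F 0) + K * norm (N 0)) * (1 + norm x + k) + (L + K * D) * (2 * (1 + norm x + k))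
       + (K * D) * (1 + norm x + k)"
      using p k by (intro add_mono mult_left_mono) auto
    also have "\<dots> = growth_const * (1 + norm x + k)"
      by (simp add: growth_const_def algebra_simps)
    finally show "norm (F 0) + L * (norm x + 2 * k) + K * (norm (N 0) + D * (norm x + 2 * k) + D * k) \<le>
      growth_const * (1 + norm x + k)" .
  qed auto
  finally show "norm (picard u t - picard u s) \<le>
      d powr (b' - b) * growth_const * (1 + norm x + k) * ?e * (t - s) powr b"
    by (simp add: mult_ac)
qed

text \<open>\<open>2 L\<close> and two of the three \<open>D\<close> come from the sup bound
  \<open>2 k\<close>, the third \<open>D\<close> from the Hoelder part, and \<open>2 M R\<close>
  from the quadratic term of the second difference.\<close>

definition contraction_const :: "real \<Rightarrow> real" where
  "contraction_const R = 2 * L + K * (3 * D + 2 * M * R)"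

lemma contraction_const_nonneg: "0 \<le> R \<Longrightarrow> 0 \<le> contraction_const R"
  unfolding contraction_const_def using K L D M by simp

text \<open>Only the difference of \<open>u\<close> and \<open>v\<close> is measured with the
  weight; \<open>R\<close> is an unweighted constant of \<open>v\<close>. The quadratic term
  therefore carries the weight once, and the estimate is linear in \<open>k\<close>.\<close>

lemma picard_contraction:
  assumes u: "bounded_Holder b u" and v: "bounded_Holder b v" "\<And>r q. norm (v r - v q) \<le> R * \<bar>r - q\<bar> powr b"
    and 0: "u 0 = v 0" and uv: "wh d k (\<lambda>t. u t - v t)" and k: "0 \<le> k" and d: "0 < d" "d \<le> 1"
  shows "wh d (d powr (b' - b) * contraction_const R * k) (\<lambda>t. picard u t - picard v t)"
  unfolding wh_def
proof (intro allI impI)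
  fix s t assume st: "0 \<le> s" "s \<le> t" "t \<le> T" "t - s \<le> d"
  let ?e = "exp (t / d)"
  have R: "0 \<le> R" using order_trans[OF norm_ge_zero v(2)[of 0 1]] by simp
  have sup: "norm (u r - v r) \<le> 2 * k * ?e" if "r \<in> {s..t}" for r
    using wh_sup_le[OF uv k d, of r t] that st 0 by simp
  have lip: "norm (H (u r) - H (v r)) \<le> C * (2 * k * ?e)"
    if r: "r \<in> {s..t}" and H: "\<And>u v. norm (H u - H v) \<le> C * norm (u - v)" "0 \<le> C" for H :: "ell2 \<Rightarrow> ell2" and C r
    using order_trans[OF H(1) mult_left_mono[OF sup[OF r] H(2)]] .
  have "(picard u t - picard v t) - (picard u s - picard v s) =
      (integral {s..t} (\<lambda>r. F (u r)) - integral {s..t} (\<lambda>r. F (v r))) +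
      (young_diag a s t (\<lambda>r. N (u r)) w - young_diag a s t (\<lambda>r. N (v r)) w)"
    using picard_increment[OF u st(1-3)] picard_increment[OF v(1) st(1-3)] by (simp add: algebra_simps)
  also have "integral {s..t} (\<lambda>r. F (u r)) - integral {s..t} (\<lambda>r. F (v r)) = integral {s..t} (\<lambda>r. F (u r) - F (v r))"
    by (intro integral_diff[symmetric] integrable_continuous_real F_continuous u v)
  also have "young_diag a s t (\<lambda>r. N (u r)) w - young_diag a s t (\<lambda>r. N (v r)) w =
      young_diag a s t (\<lambda>r. N (u r) - N (v r)) w"
    by (rule young_diag_minus[OF ab st(2) superposition_bounded_Holder[OF u] superposition_bounded_Holder[OF v(1)] w])
  also have "norm (integral {s..t} (\<lambda>r. F (u r) - F (v r)) + young_diag a s t (\<lambda>r. N (u r) - N (v r)) w) \<le>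
     d powr (b' - b) * (L * (2 * k * ?e) + K * (D * (2 * k * ?e) + ?e * (D * k + M * (2 * k) * R))) * (t - s) powr b"
  proof (rule local_estimate[OF st(2,4) d _ _ bounded_Holder_minus[OF superposition_bounded_Holder[OF u] superposition_bounded_Holder[OF v(1)]]])
    show "continuous_on {s..t} (\<lambda>r. F (u r) - F (v r))"
      by (intro continuous_intros F_continuous u v)
    fix r q assume r: "r \<in> {s..t}" and q: "q \<in> {s..t}"
    have "norm ((N (u r) - N (v r)) - (N (u q) - N (v q))) \<le>
        D * norm ((u r - v r) - (u q - v q)) + M * norm (u q - v q) * norm (v r - v q)" by (rule M(2))
    also have "\<dots> \<le> D * (k * ?e * \<bar>r - q\<bar> powr b) + M * (2 * k * ?e) * (R * \<bar>r - q\<bar> powr b)"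
      using D M k sup[OF q] v(2)[of r q] wh_local[OF uv k d(1) st(1,3,4) r q]
      by (intro add_mono mult_left_mono mult_mono) auto
    finally show "norm (N (u r) - N (v r) - (N (u q) - N (v q))) \<le> ?e * (D * k + M * (2 * k) * R) * \<bar>r - q\<bar> powr b"
      by (simp add: algebra_simps)
  qed (use lip L D M k R in auto)
  also have "\<dots> = d powr (b' - b) * contraction_const R * k * ?e * (t - s) powr b"
    by (simp add: contraction_const_def algebra_simps)
  finally show "norm (picard u t - picard v t - (picard u s - picard v s)) \<le>
      d powr (b' - b) * contraction_const R * k * ?e * (t - s) powr b" .
qed

definition halving :: "real \<Rightarrow> real \<Rightarrow> bool" where
  "halving R d \<longleftrightarrow> (\<forall>u v k. bounded_Holder b u \<longrightarrow> bounded_Holder b v \<longrightarrow>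
     (\<forall>r q. norm (v r - v q) \<le> R * \<bar>r - q\<bar> powr b) \<longrightarrow> u 0 = v 0 \<longrightarrow> wh d k (\<lambda>t. u t - v t) \<longrightarrow> 0 \<le> k \<longrightarrow>
     wh d (k / 2) (\<lambda>t. picard u t - picard v t))"

lemma halvingD:
  assumes "halving R d" "bounded_Holder b u" "bounded_Holder b v" "\<And>r q. norm (v r - v q) \<le> R * \<bar>r - q\<bar> powr b"
    "u 0 = v 0" "wh d k (\<lambda>t. u t - v t)" "0 \<le> k"
  shows "wh d (k / 2) (\<lambda>t. picard u t - picard v t)"
  using assms unfolding halving_def by blast

lemma halving_exists:
  assumes "0 \<le> R"
  obtains d where "0 < d" "d \<le> 1" "halving R d"
proof -
  obtain d where d: "0 < d" "d \<le> 1" "d powr (b' - b) * contraction_const R \<le> 1 / 2"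
    using small_step_exists[of "b' - b" "contraction_const R" "1 / 2"] contraction_const_nonneg[OF assms] bb' by auto
  have "halving R d"
    unfolding halving_def
  proof (intro allI impI)
    fix u v k
    assume *: "bounded_Holder b u" "bounded_Holder b v" "\<forall>r q. norm (v r - v q) \<le> R * \<bar>r - q\<bar> powr b"
       "u 0 = v 0" "wh d k (\<lambda>t. u t - v t)" "0 \<le> k"
    have "wh d (d powr (b' - b) * contraction_const R * k) (\<lambda>t. picard u t - picard v t)"
      by (rule picard_contraction) (use * d in auto)
    then show "wh d (k / 2) (\<lambda>t. picard u t - picard v t)"
      by (rule wh_mono) (use mult_right_mono[OF d(3) *(6)] in simp)
  qed
  then show thesis using that d by blast
qed

section \<open>Uniqueness and existence of the fixed point\<close>

lemma wh_null:
  assumes wh: "\<And>n::nat. wh d (c / 2 ^ n) u" and c: "0 \<le> c" and d: "0 < d" "d \<le> 1" and t: "t \<in> {0..T}"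
  shows "u t = u 0"
proof -
  have "norm (u t - u 0) \<le> (2 * c * exp (t / d) * d powr b) * (1 / 2) ^ n" for n
    using wh_sup[OF wh _ d, of n t] t c by (simp add: power_one_over)
  moreover have "(\<lambda>n. (2 * c * exp (t / d) * d powr b) * (1 / 2) ^ n) \<longlonglongrightarrow> (2 * c * exp (t / d) * d powr b) * 0"
    by (intro tendsto_mult tendsto_const LIMSEQ_power_zero) simp
  ultimately have "norm (u t - u 0) \<le> 0"
    by (intro LIMSEQ_le_const) auto
  then show ?thesis by simp
qed

definition solution :: "(real \<Rightarrow> ell2) \<Rightarrow> bool" where
  "solution u \<longleftrightarrow> (\<forall>t\<in>{0..T}. u t = x + integral {0..t} (\<lambda>r. F (u r)) + young_diag a 0 t (\<lambda>r. N (u r)) w)"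

lemma solution_iff_picard: "solution u \<longleftrightarrow> (\<forall>t\<in>{0..T}. u t = picard u t)"
  by (simp add: solution_def picard_def clamp_id)

text \<open>Both solutions are fixed points on \<open>[0, T]\<close>, so the constant in the
  weighted bound for their difference can be halved indefinitely. The step is chosen from the
  constant of \<open>v\<close> alone.\<close>

lemma solution_unique:
  assumes u: "bounded_Holder b u" "solution u" and v: "bounded_Holder b v" "solution v" and t: "t \<in> {0..T}"
  shows "u t = v t"
proof -
  obtain R1 where R1: "\<And>r q. norm (u r - u q) \<le> R1 * \<bar>r - q\<bar> powr b" "0 \<le> R1"
    using bounded_HolderE[OF u(1)] by metis
  obtain R where R: "\<And>r q. norm (v r - v q) \<le> R * \<bar>r - q\<bar> powr b" "0 \<le> R"
    using bounded_HolderE[OF v(1)] by metis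
  obtain d where d: "0 < d" "d \<le> 1" and half: "halving R d"
    using halving_exists[OF R(2)] by metis
  have pu: "u t = picard u t" and pv: "v t = picard v t" if "t \<in> {0..T}" for t
    using u(2) v(2) that by (auto simp: solution_iff_picard)
  have 0: "u 0 = x" "v 0 = x" using pu[of 0] pv[of 0] picard_0 T by auto
  let ?k = "R1 + R"
  have "wh d (?k / 2 ^ n) (\<lambda>t. u t - v t)" for n
  proof (induction n)
    case 0
    have "norm ((u r - v r) - (u q - v q)) \<le> ?k * \<bar>r - q\<bar> powr b" for r q
      using norm_triangle_ineq4[of "u r - u q" "v r - v q"] R1(1)[of r q] R(1)[of r q]
      by (simp add: algebra_simps)
    then show ?case using wh_of_Holder[of "\<lambda>t. u t - v t" ?k d] d by simp
  next
    case (Suc n)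
    have "wh d (?k / 2 ^ n / 2) (\<lambda>t. picard u t - picard v t)"
      by (rule halvingD[OF half u(1) v(1) R(1) _ Suc]) (use R R1 0 in auto)
    then show ?case
      by (rule wh_cong[where u="\<lambda>t. picard u t - picard v t", THEN wh_mono])
        (auto simp: pu[symmetric] pv[symmetric] field_simps)
  qed
  from wh_null[OF this _ d t] show ?thesis using R R1 0 by simp
qed

lemma solution_exists:
  obtains u where "bounded_Holder b u" "solution u"
proof -
  \<comment> \<open>With this radius \<open>1 + norm x + k0 = 2 k0\<close>, so the factor
    \<open>1/2\<close> provided by \<open>d0\<close> maps the ball of radius \<open>k0\<close> into
    itself.\<close>
  define k0 where "k0 = 1 + norm x"
  have k0: "0 \<le> k0" by (simp add: k0_def)
  obtain d0 where d0: "0 < d0" "d0 \<le> 1" "d0 powr (b' - b) * growth_const \<le> 1 / 2"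
    using small_step_exists[of "b' - b" growth_const "1 / 2"] growth_const_nonneg bb' by auto
  \<comment> \<open>The constant that \<open>wh_Holder\<close> gives for the whole ball. It depends
    on \<open>d0\<close>, so \<open>d\<close> can be chosen only afterwards.\<close>
  define R where "R = 4 * k0 * exp (T / d0)"
  have R0: "0 \<le> R" using k0 by (simp add: R_def)
  obtain d where d: "0 < d" "d \<le> 1" and half: "halving R d"
    using halving_exists[OF R0] by metis
  define U where "U n = (picard ^^ n) (\<lambda>_. x)" for n
  have USuc: "U (Suc n) = picard (U n)" for n by (simp add: U_def)
  have H: "norm (u r - u q) \<le> R * \<bar>r - q\<bar> powr b" if "wh d0 k0 u" "\<And>t. u (clamp t) = u t" for u r q
    unfolding R_def by (rule wh_Holder[OF that(1) k0 d0(1,2) that(2)])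
  have inv: "wh d0 k0 (U n) \<and> U n 0 = x \<and> (\<forall>t. U n (clamp t) = U n t)" for n
  proof (induction n)
    case 0
    then show ?case using k0 by (simp add: U_def wh_def)
  next
    case (Suc n)
    then have bh: "bounded_Holder b (U n)"
      using bounded_Holder_of_Holder[of "U n" R b] H[of "U n"] pos by auto
    have "d0 powr (b' - b) * growth_const * (1 + norm x + k0) \<le> 1 / 2 * (2 * k0)"
      using d0(3) k0 by (intro mult_mono) (auto simp: k0_def)
    then have "wh d0 k0 (picard (U n))"
      using picard_growth[OF bh _ _ k0 d0(1,2)] Suc by (auto intro: wh_mono)
    then show ?case by (simp add: USuc picard_0 picard_clamp)
  qed
  have UH: "norm (U n r - U n q) \<le> R * \<bar>r - q\<bar> powr b" for n r q using H inv by blast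
  have Ub: "bounded_Holder b (U n)" for n
    using bounded_Holder_of_Holder[of "U n" R b] UH[of n] pos inv by auto
  \<comment> \<open>Two iterates with Hoelder constant \<open>R\<close> have a difference with
    constant \<open>2 R\<close>.\<close>
  define c where "c = 2 * R"
  have c0: "0 \<le> c" using R0 by (simp add: c_def)
  have diff: "wh d (c / 2 ^ n) (\<lambda>t. U (Suc n) t - U n t)" for n
  proof (induction n)
    case 0
    have "norm ((U 1 r - U 0 r) - (U 1 q - U 0 q)) \<le> c * \<bar>r - q\<bar> powr b" for r q
      using norm_triangle_ineq4[of "U 1 r - U 1 q" "U 0 r - U 0 q"] UH[of 1 r q] UH[of 0 r q]
      by (simp add: algebra_simps c_def)
    then show ?case using wh_of_Holder[of "\<lambda>t. U 1 t - U 0 t" c d] d by simp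
  next
    case (Suc n)
    have "wh d (c / 2 ^ n / 2) (\<lambda>t. picard (U (Suc n)) t - picard (U n) t)"
      by (rule halvingD[OF half Ub Ub UH _ Suc]) (use inv c0 in auto)
    then show ?case by (simp add: USuc mult.commute)
  qed
  \<comment> \<open>Geometric sum of the consecutive differences, kept as an exact partial sum so
    that the induction closes.\<close>
  have tele: "wh d (2 * c / 2 ^ n * (1 - 1 / 2 ^ j)) (\<lambda>t. U (n + j) t - U n t)" for n j
  proof (induction j)
    case 0
    then show ?case by (simp add: wh_def)
  next
    case (Suc j)
    have "wh d (2 * c / 2 ^ n * (1 - 1 / 2 ^ j) + c / 2 ^ (n + j))
       (\<lambda>t. (U (n + j) t - U n t) + (U (Suc (n + j)) t - U (n + j) t))"
      by (rule wh_add[OF Suc diff])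
    moreover have "2 * c / 2 ^ n * (1 - 1 / 2 ^ j) + c / 2 ^ (n + j) = 2 * c / 2 ^ n * (1 - 1 / 2 ^ Suc j)"
      by (simp add: power_add field_simps)
    ultimately show ?case by (simp add: add.commute)
  qed
  have conv: "convergent (\<lambda>n. U n t)" if t: "t \<in> {0..T}" for t
  proof -
    have "summable (\<lambda>n. U (Suc n) t - U n t)"
    proof (rule summable_comparison_test')
      show "summable (\<lambda>n. (2 * c * exp (t / d) * d powr b) * (1 / 2) ^ n)"
        by (intro summable_mult summable_geometric) simp
      show "norm (U (Suc n) t - U n t) \<le> (2 * c * exp (t / d) * d powr b) * (1 / 2) ^ n" for n
        using wh_sup[OF diff[of n] _ d, of t] t c0 inv by (simp add: power_one_over)
    qed
    then have "(\<lambda>n. \<Sum>i<n. U (Suc i) t - U i t) \<longlonglongrightarrow> (\<Sum>i. U (Suc i) t - U i t)"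
      by (rule summable_LIMSEQ)
    from tendsto_add[OF this tendsto_const[of "U 0 t"]]
    have "(\<lambda>n. U n t) \<longlonglongrightarrow> (\<Sum>i. U (Suc i) t - U i t) + U 0 t"
      using sum_lessThan_telescope[of "\<lambda>n. U n t"] by simp
    then show ?thesis by (auto simp: convergent_def)
  qed
  define u where "u t = lim (\<lambda>n. U n t)" for t
  have conv': "convergent (\<lambda>n. U n t)" for t
    using conv[OF clamp_range[of t]] inv by simp
  have lim: "(\<lambda>n. U n t) \<longlonglongrightarrow> u t" for t
    using conv'[of t] unfolding u_def by (simp add: convergent_LIMSEQ_iff)
  \<comment> \<open>The limit stays in the ball, so \<open>R\<close> and \<open>d\<close> are valid
    for it as well.\<close>
  have u1: "wh d0 k0 u" by (rule wh_limit[of _ _ U]) (use inv lim in auto)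
  have u2: "u (clamp t) = u t" for t
    using inv by (simp add: u_def)
  have u3: "u 0 = x" using inv by (simp add: u_def)
  have ub: "bounded_Holder b u"
    using bounded_Holder_of_Holder[of u R b] H[of u] u1 u2 pos by auto
  have uU: "wh d (2 * c / 2 ^ n) (\<lambda>t. u t - U n t)" for n
  proof (rule wh_limit[of _ _ "\<lambda>j t. U (n + j) t - U n t"])
    show "wh d (2 * c / 2 ^ n) (\<lambda>t. U (n + j) t - U n t)" for j
    proof -
      have "2 * c / 2 ^ n * (1 - 1 / 2 ^ j) \<le> 2 * c / 2 ^ n * 1"
        using c0 by (intro mult_left_mono) auto
      from wh_mono[OF tele this] show ?thesis by (simp only: mult_1_right)
    qed
    show "(\<lambda>j. U (n + j) t - U n t) \<longlonglongrightarrow> u t - U n t" for t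
      using tendsto_diff[OF LIMSEQ_ignore_initial_segment[OF lim, of n t] tendsto_const[of "U n t"]]
      by (simp only: add.commute[of n])
  qed
  \<comment> \<open>Both \<open>picard u\<close> and \<open>u\<close> are compared with
    \<open>picard (U n) = U (Suc n)\<close>; each distance contributes half of the bound, which
    vanishes as \<open>n\<close> grows.\<close>
  have res: "wh d (2 * c / 2 ^ n) (\<lambda>t. picard u t - u t)" for n
  proof -
    have 0: "u 0 = U n 0" using inv u3 by simp
    have k: "0 \<le> 2 * c / 2 ^ n" using c0 by simp
    have "wh d (2 * c / 2 ^ n / 2) (\<lambda>t. picard u t - picard (U n) t)"
      by (rule halvingD[OF half ub Ub UH 0 uU k])
    from wh_add[OF this wh_minus_commute[OF uU[of "Suc n"]]]
    have "wh d (2 * c / 2 ^ n / 2 + 2 * c / 2 ^ Suc n) (\<lambda>t. picard u t - u t)"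
      by (rule wh_cong) (simp add: USuc)
    moreover have "2 * c / 2 ^ n / 2 + 2 * c / 2 ^ Suc n = 2 * c / 2 ^ n" by (simp add: field_simps)
    ultimately show ?thesis by (simp only:)
  qed
  have "0 \<le> 2 * c" using c0 by simp
  have "picard u t - u t = picard u 0 - u 0" if "t \<in> {0..T}" for t
    by (rule wh_null[OF res \<open>0 \<le> 2 * c\<close> d that])
  then have "solution u" by (simp add: solution_iff_picard picard_0 u3)
  with ub show thesis using that by blast
qed

end

section \<open>Mild solutions\<close>

text \<open>By the convolution formula the mild equation says that \<open>v - Y\<close> is the
  variation of constants path with inhomogeneity \<open>f(v) - A Y\<close>. Independence of the
  order reduces \<alpha> to the fixed order \<open>a\<close>.\<close>

lemma mild_solution_iff:
  fixes \<alpha> :: real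
  assumes a: "0 < a" "a < b" "1 - a < b'" and al: "0 < \<alpha>" "\<alpha> < b" "1 - \<alpha> < b'" and b: "b < 1"
    and w: "bounded_Holder b' w" "\<And>r. r \<in> {0..T} \<Longrightarrow> \<omega> r = w r"
    and v: "bounded_Holder b v'" "\<And>r. r \<in> {0..T} \<Longrightarrow> v r = v' r"
    and f: "continuous_on UNIV (drift_map f)"
    and N: "bounded_Holder b (\<lambda>r. drift_map h (v' r))"
    and diag: "\<And>u i. diag_op h u (unit_vec i) = coord (drift_map h u) i *\<^sub>R unit_vec i"
  shows "mild_solution \<nu> l f h \<alpha> \<omega> x T v \<longleftrightarrow>
    (\<forall>t\<in>{0..T}. v' t = x + integral {0..t} (\<lambda>r. drift_map f (v' r) - op_A_shifted \<nu> l (v' r)) +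
       young_diag a 0 t (\<lambda>r. drift_map h (v' r)) w)"
proof -
  let ?A = "op_A_shifted \<nu> l" and ?S = "semigroup_S \<nu> l"
  define Y where "Y t = young_diag a 0 t (\<lambda>r. drift_map h (v' r)) w" for t
  define F where "F r = drift_map f (v' r) - ?A (Y r)" for r
  have pos: "0 < b" using a by auto
  have cv: "continuous_on X v'" for X
    using bounded_Holder_continuous[OF pos v(1)] continuous_on_subset by blast
  have cf: "continuous_on X (\<lambda>r. drift_map f (v' r))" for X
    by (intro continuous_on_compose2[OF f cv]) auto
  have cY: "continuous_on {0..t} Y" for t
    unfolding Y_def by (rule young_diag_continuous[OF a(1,2) b a(3) N w(1)])
  have cF: "continuous_on {0..t} F" for t
    unfolding F_def by (intro continuous_intros cf cY)
  have cS: "continuous_on {0..t} (\<lambda>r. ?S (t - r) (u r))" if "continuous_on {0..t} u" for t u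
    by (intro continuous_intros that)
  have rhs: "?S t x + integral {0..t} (\<lambda>r. ?S (t - r) (drift_map f (v r)))
        + young_integral \<alpha> 0 t (\<lambda>r. ?S (t - r) o\<^sub>L diag_op h (v r)) \<omega> = duhamel \<nu> l x F t + Y t"
    if t: "t \<in> {0..T}" for t
  proof -
    have "young_integral \<alpha> 0 t (\<lambda>r. ?S (t - r) o\<^sub>L diag_op h (v r)) \<omega> =
      young_diag \<alpha> 0 t (\<lambda>r. drift_map h (v' r)) w -
      integral {0..t} (\<lambda>r. ?A (?S (t - r) (young_diag \<alpha> 0 r (\<lambda>r. drift_map h (v' r)) w)))"
      by (rule young_integral_convolution[OF al(1,2) b al(3) _ N w(1)])
        (use t v w diag in auto)
    also have "young_diag \<alpha> 0 t (\<lambda>r. drift_map h (v' r)) w = Y t"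
      unfolding Y_def young_diag_def
      using t frac_integral_coord_order_independent[OF a(1,2) b a(3) N w(1) al] by simp
    also have "integral {0..t} (\<lambda>r. ?A (?S (t - r) (young_diag \<alpha> 0 r (\<lambda>r. drift_map h (v' r)) w))) =
       integral {0..t} (\<lambda>r. ?S (t - r) (?A (Y r)))"
      unfolding Y_def young_diag_def
      by (intro integral_cong)
        (use frac_integral_coord_order_independent[OF a(1,2) b a(3) N w(1) al] in \<open>simp add: semigroup_S_commute\<close>)
    finally have y: "young_integral \<alpha> 0 t (\<lambda>r. ?S (t - r) o\<^sub>L diag_op h (v r)) \<omega> =
       Y t - integral {0..t} (\<lambda>r. ?S (t - r) (?A (Y r)))" .
    have "integral {0..t} (\<lambda>r. ?S (t - r) (drift_map f (v r))) = integral {0..t} (\<lambda>r. ?S (t - r) (drift_map f (v' r)))"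
      by (intro integral_cong) (use t v in auto)
    moreover have "integral {0..t} (\<lambda>r. ?S (t - r) (F r)) =
        integral {0..t} (\<lambda>r. ?S (t - r) (drift_map f (v' r))) - integral {0..t} (\<lambda>r. ?S (t - r) (?A (Y r)))"
      unfolding F_def blinfun.diff_right
      by (intro integral_diff integrable_continuous_real cS cf)
        (intro continuous_intros cY)
    ultimately show ?thesis unfolding y duhamel_def by simp
  qed
  \<comment> \<open>Here the \<open>A Y\<close> contained in \<open>F\<close> cancels, leaving the
    drift minus \<open>A v'\<close>.\<close>
  have int: "integral {0..t} (\<lambda>r. F r - ?A (v' r - Y r)) = integral {0..t} (\<lambda>r. drift_map f (v' r) - ?A (v' r))" for t
    by (intro integral_cong) (simp add: F_def blinfun.diff_right)
  have "mild_solution \<nu> l f h \<alpha> \<omega> x T v \<longleftrightarrow> (\<forall>t\<in>{0..T}. v' t - Y t = duhamel \<nu> l x F t)"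
    unfolding mild_solution_def using rhs v(2) by (auto simp: algebra_simps)
  also have "\<dots> \<longleftrightarrow> (\<forall>t\<in>{0..T}. v' t - Y t = x + integral {0..t} (\<lambda>r. F r - ?A (v' r - Y r)))"
  proof
    assume *: "\<forall>t\<in>{0..T}. v' t - Y t = duhamel \<nu> l x F t"
    show "\<forall>t\<in>{0..T}. v' t - Y t = x + integral {0..t} (\<lambda>r. F r - ?A (v' r - Y r))"
    proof
      fix t assume t: "t \<in> {0..T}"
      have "v' t - Y t = x + integral {0..t} (\<lambda>r. F r - ?A (duhamel \<nu> l x F r))"
        using * t duhamel_integral_equation[OF cF t] by simp
      also have "integral {0..t} (\<lambda>r. F r - ?A (duhamel \<nu> l x F r)) = integral {0..t} (\<lambda>r. F r - ?A (v' r - Y r))"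
        by (intro integral_cong) (use * t in auto)
      finally show "v' t - Y t = x + integral {0..t} (\<lambda>r. F r - ?A (v' r - Y r))" .
    qed
  next
    assume *: "\<forall>t\<in>{0..T}. v' t - Y t = x + integral {0..t} (\<lambda>r. F r - ?A (v' r - Y r))"
    show "\<forall>t\<in>{0..T}. v' t - Y t = duhamel \<nu> l x F t"
      using duhamel_unique[OF cF[of T], of "\<lambda>t. v' t - Y t"] * continuous_on_diff[OF cv cY] by blast
  qed
  finally show ?thesis unfolding int Y_def[symmetric] by (auto simp: algebra_simps)
qed

theorem theorem3p4:
  fixes \<nu> lam \<beta> \<beta>' H D\<^sub>f D\<^sub>h M\<^sub>h T :: real
    and \<sigma> x :: ell2
    and \<omega> :: "real \<Rightarrow> ell2"
    and f h :: "int \<Rightarrow> real \<Rightarrow> real"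
    and M :: "'a measure"
    and B :: "int \<Rightarrow> real \<Rightarrow> 'a \<Rightarrow> real"
    and P :: "(real \<Rightarrow> ell2) measure"
  assumes "0 < \<nu>" and "0 < lam"
    and "1/2 < \<beta>" and "\<beta> < \<beta>'" and "\<beta>' < H" and "H < 1"
    and "fbm_law M B H \<sigma> P"
    and "\<omega> \<in> space P" and "\<omega> \<in> C0_holder_paths \<beta>'"
    and "\<And>i. f i C1_differentiable_on UNIV"
    and "(\<lambda>i. (f i 0)\<^sup>2) summable_on UNIV"
    and "0 \<le> D\<^sub>f" and "\<And>i \<zeta>. \<bar>deriv (f i) \<zeta>\<bar> \<le> D\<^sub>f"
    and "\<And>i. h i C1_differentiable_on UNIV"
    and "\<And>i. deriv (h i) C1_differentiable_on UNIV"
    and "(\<lambda>i. (h i 0)\<^sup>2) summable_on UNIV"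
    and "0 \<le> D\<^sub>h" and "\<And>i \<zeta>. \<bar>deriv (h i) \<zeta>\<bar> \<le> D\<^sub>h"
    and "0 \<le> M\<^sub>h" and "\<And>i \<zeta>. \<bar>deriv (deriv (h i)) \<zeta>\<bar> \<le> M\<^sub>h"
    and "0 < T"
  shows "\<exists>u. holder_on \<beta> {0..T} u \<and>
    (\<forall>\<alpha>\<in>{1 - \<beta>'<..<\<beta>}. mild_solution \<nu> lam f h \<alpha> \<omega> x T u \<and>
      (\<forall>v. holder_on \<beta> {0..T} v \<and> mild_solution \<nu> lam f h \<alpha> \<omega> x T v \<longrightarrow>
        (\<forall>t\<in>{0..T}. v t = u t)))"
proof -
  note f = assms(10,11,12,13) and h = assms(14,16,17,18) and h2 = assms(15,19,20)
  \<comment> \<open>Extension by constants beyond \<open>[0, T]\<close>, which places the noise and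
    any competing solution on the whole line.\<close>
  define c where "c t = max 0 (min T t)" for t :: real
  have c: "c t \<in> {0..T}" "\<bar>c r - c q\<bar> \<le> \<bar>r - q\<bar>" "s \<in> {0..T} \<Longrightarrow> c s = s" for t r q s
    using \<open>0 < T\<close> by (auto simp: c_def max_def min_def)
  have extend: "bounded_Holder e (\<lambda>t. v (c t))" if "holder_on e {0..T} v" "0 < e" for e and v :: "real \<Rightarrow> ell2"
  proof -
    from that(1) obtain C where C: "\<And>s t. s \<in> {0..T} \<Longrightarrow> t \<in> {0..T} \<Longrightarrow> norm (v s - v t) \<le> C * \<bar>s - t\<bar> powr e"
      unfolding holder_on_def by blast
    have "0 \<le> C" using order_trans[OF norm_ge_zero C[of 0 T]] \<open>0 < T\<close> by (simp add: zero_le_mult_iff)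
    have le: "norm (v (c r) - v (c q)) \<le> C * \<bar>r - q\<bar> powr e" for r q
    proof -
      have "norm (v (c r) - v (c q)) \<le> C * \<bar>c r - c q\<bar> powr e" by (rule C[OF c(1) c(1)])
      also have "\<dots> \<le> C * \<bar>r - q\<bar> powr e"
        using \<open>0 \<le> C\<close> c(2) that(2) by (intro mult_left_mono powr_mono2) auto
      finally show ?thesis .
    qed
    moreover have "norm (v (c r)) \<le> norm (v 0) + C * T powr e" for r
    proof -
      have "norm (v (c r)) \<le> norm (v 0) + norm (v (c r) - v 0)"
        using norm_triangle_ineq[of "v 0" "v (c r) - v 0"] by simp
      also have "norm (v (c r) - v 0) \<le> C * \<bar>c r - 0\<bar> powr e"
        by (rule C[OF c(1)]) (use \<open>0 < T\<close> in auto)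
      also have "\<dots> \<le> C * T powr e"
        using \<open>0 \<le> C\<close> c(1)[of r] that(2) by (intro mult_left_mono powr_mono2) auto
      finally show ?thesis by simp
    qed
    ultimately show ?thesis unfolding bounded_Holder_def by blast
  qed
  define w where "w = (\<lambda>t. \<omega> (c t))"
  have wH: "bounded_Holder \<beta>' w" "\<And>r. r \<in> {0..T} \<Longrightarrow> \<omega> r = w r"
    using extend[of \<beta>' \<omega>] assms(3,4,9) c(3) by (auto simp: w_def C0_holder_paths_def)
  let ?A = "op_A_shifted \<nu> lam"
  let ?F = "\<lambda>u. drift_map f u - ?A u"
  have lipf: "norm (drift_map f u - drift_map f v) \<le> D\<^sub>f * norm (u - v)" for u v
    by (rule superposition_Lipschitz[OF f])
  have lipF: "norm (?F u - ?F v) \<le> (D\<^sub>f + norm ?A) * norm (u - v)" for u v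
  proof -
    have "norm (?F u - ?F v) \<le> norm (drift_map f u - drift_map f v) + norm (?A (u - v))"
      using norm_triangle_ineq4[of "drift_map f u - drift_map f v" "?A (u - v)"]
      by (simp add: blinfun.diff_right algebra_simps)
    also have "\<dots> \<le> D\<^sub>f * norm (u - v) + norm ?A * norm (u - v)"
      by (intro add_mono lipf norm_blinfun)
    finally show ?thesis by (simp add: distrib_right)
  qed
  have cf: "continuous_on UNIV (drift_map f)"
    by (rule lipschitz_on_continuous_on[OF lipschitz_onI[of _ _ "D\<^sub>f"]])
      (use lipf f(3) in \<open>auto simp: dist_norm\<close>)
  have diag: "diag_op h u (unit_vec i) = coord (drift_map h u) i *\<^sub>R unit_vec i" for u i
    by (rule ell2_eqI)
      (simp add: diag_op_well_defined(1)[OF h(1,4,2)] coord_superposition[OF h] unit_vec.rep_eq)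
  \<comment> \<open>Order \<open>1/2\<close> is admissible since
    \<open>1 - \<beta>' < 1/2 < \<beta>\<close>; it is fixed once, and \<open>iff\<close> transfers
    the result to every other admissible \<alpha>.\<close>
  interpret young_equation "1/2" \<beta> \<beta>' T "D\<^sub>f + norm ?A" D\<^sub>h M\<^sub>h ?F "drift_map h" w x
    by unfold_locales
      (use assms(3-6) \<open>0 < T\<close> wH lipF f(3) h(3) h2(2) superposition_Lipschitz[OF h]
        superposition_second_difference[OF h h2] in auto)
  have iff: "mild_solution \<nu> lam f h \<alpha> \<omega> x T v \<longleftrightarrow> solution v'"
    if "\<alpha> \<in> {1 - \<beta>'<..<\<beta>}" "bounded_Holder \<beta> v'" "\<And>r. r \<in> {0..T} \<Longrightarrow> v r = v' r" for \<alpha> v v'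
    unfolding solution_def
    by (rule mild_solution_iff[OF _ _ _ _ _ _ _ wH that(2,3) cf superposition_bounded_Holder[OF that(2)] diag])
      (use that(1) assms(3-6) in auto)
  obtain u where u: "bounded_Holder \<beta> u" "solution u" by (rule solution_exists)
  have "holder_on \<beta> {0..T} u"
    using bounded_HolderE[OF u(1)] unfolding holder_on_def by metis
  moreover have "mild_solution \<nu> lam f h \<alpha> \<omega> x T u" if "\<alpha> \<in> {1 - \<beta>'<..<\<beta>}" for \<alpha>
    using iff[OF that u(1)] u(2) by simp
  moreover have "v t = u t"
    if "\<alpha> \<in> {1 - \<beta>'<..<\<beta>}" "holder_on \<beta> {0..T} v" "mild_solution \<nu> lam f h \<alpha> \<omega> x T v" "t \<in> {0..T}" for \<alpha> v t
  proof -
    \<comment> \<open>A competitor is known to be Hoelder on \<open>[0, T]\<close> only, so its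
      extension is compared with \<open>u\<close>.\<close>
    have v: "bounded_Holder \<beta> (\<lambda>t. v (c t))" using extend that(2) assms(3) by auto
    have "solution (\<lambda>t. v (c t))" using iff[OF that(1) v, of v] that(3) c(3) by simp
    from solution_unique[OF v this u that(4)] show ?thesis using c(3)[OF that(4)] by simp
  qed
  ultimately show ?thesis by blast
qed

end
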